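(* Let $M\subset\mathbb{R}^3$ be a compact smooth surface, and let $B_M$ denote the meromorphic continuation to $\mathbb{C}$ of the function $s\mapsto\int_{M\times M}\|v-u\|^s\,dA(v)\,dA(u)$, $\operatorname{Re}s>-2$. Then the spheres are characterized by the vanishing of the residue of $B_M$ at $s=-4$: $\operatorname{Res}_{s=-4}B_M=0$ if and only if $M$ is a sphere.
   Context: $\|\cdot\|$ is the Euclidean norm on $\mathbb{R}^3$ and $dA$ is the area element of $M$. The double integral is analytic in $s$ for $\operatorname{Re}s>-2$ and extends to a meromorphic function on $\mathbb{C}$ whose only possible poles are at most simple poles at $s=-2,-4,-6,\dots$; the residue is taken to be zero where there is no pole. A sphere is a set of the form $\{x\in\mathbb{R}^3 : \|x-c\|=r\}$ with $c\in\mathbb{R}^3$ and $r>0$.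
   Formalization: The compact smooth surface M is taken to be nonempty, connected and without boundary; without connectedness the claim fails, since two disjoint spheres also give residue zero at s = -4. *)

theory Defs
  imports "HOL-Analysis.Analysis" "HOL-Complex_Analysis.Complex_Analysis"
begin

(* Meant for open S: all iterated directional derivatives up to order k exist
   and are continuous, i.e. f is of class C^k on S. *)
fun Ck_on :: "nat \<Rightarrow> ('a::real_normed_vector \<Rightarrow> 'b::real_normed_vector) \<Rightarrow> 'a set \<Rightarrow> bool" where
  "Ck_on 0 f S \<longleftrightarrow> continuous_on S f"
| "Ck_on (Suc k) f S \<longleftrightarrow>
     (\<forall>x\<in>S. f differentiable (at x)) \<and>
     (\<forall>v. Ck_on k (\<lambda>x. frechet_derivative f (at x) v) S)"

definition smooth_on :: "('a::real_normed_vector \<Rightarrow> 'b::real_normed_vector) \<Rightarrow> 'a set \<Rightarrow> bool" where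
  "smooth_on f S \<longleftrightarrow> (\<forall>k. Ck_on k f S)"

definition local_parametrization ::
  "(real^3) set \<Rightarrow> (real^2) set \<Rightarrow> (real^2 \<Rightarrow> real^3) \<Rightarrow> bool" where
  "local_parametrization M V \<phi> \<longleftrightarrow>
     open V \<and>
     openin (top_of_set M) (\<phi> ` V) \<and>
     smooth_on \<phi> V \<and>
     (\<forall>x\<in>V. inj (frechet_derivative \<phi> (at x))) \<and>
     (\<exists>\<psi>. homeomorphism V (\<phi> ` V) \<phi> \<psi>)"

(* Embedded surface; since the parameter domains are open in the plane, it has no boundary. *)
definition smooth_surface :: "(real^3) set \<Rightarrow> bool" where
  "smooth_surface M \<longleftrightarrow> (\<forall>p\<in>M. \<exists>V \<phi>. local_parametrization M V \<phi> \<and> p \<in> \<phi> ` V)"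

(* |d\<phi>/dx1 \<times> d\<phi>/dx2| *)
definition area_density :: "(real^2 \<Rightarrow> real^3) \<Rightarrow> real^2 \<Rightarrow> real" where
  "area_density \<phi> x =
     norm (cross3 (frechet_derivative \<phi> (at x) (axis 1 1))
                  (frechet_derivative \<phi> (at x) (axis 2 1)))"

(* The image under \<phi> of the measure area_density \<phi> x dx on V, as a Borel measure on R^3
   concentrated on \<phi> ` V. *)
definition chart_area :: "(real^2) set \<Rightarrow> (real^2 \<Rightarrow> real^3) \<Rightarrow> (real^3) measure" where
  "chart_area V \<phi> =
     distr (density (restrict_space lborel V) (\<lambda>x. ennreal (area_density \<phi> x))) borel \<phi>"

(* By the change of variables formula, the area measures of two charts of a smooth surface agree on
   the overlap of their images. The supremum in the lattice of measures is therefore the Borel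
   measure on R^3 concentrated on M that restricts to chart_area V \<phi> on each \<phi> ` V: the measure dA. *)
definition area_measure :: "(real^3) set \<Rightarrow> (real^3) measure" where
  "area_measure M = (SUP (V, \<phi>) \<in> {(V, \<phi>). local_parametrization M V \<phi>}. chart_area V \<phi>)"

(* Note that 0 powr s = 0 also for Re s <= 0, but the diagonal is a null set. *)
definition riesz_energy :: "(real^3) set \<Rightarrow> complex \<Rightarrow> complex" where
  "riesz_energy M s =
     (\<integral>p. complex_of_real (norm (fst p - snd p)) powr s
        \<partial>(area_measure M \<Otimes>\<^sub>M area_measure M))"

(* Determines B up to its values on a discrete set, which do not affect residues. *)
definition meromorphic_continuation_of_energy ::
  "(complex \<Rightarrow> complex) \<Rightarrow> (real^3) set \<Rightarrow> bool" where
  "meromorphic_continuation_of_energy B M \<longleftrightarrow>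
     B meromorphic_on UNIV \<and> (\<forall>s. Re s > -2 \<longrightarrow> B s = riesz_energy M s)"

end

theory Submission imports Defs "HOL-Probability.Probability" begin

text \<open>
  The Gaussian energy \<open>J(t) = \<integral>\<integral> exp (- t |u - v|\<^sup>2) dA(u) dA(v)\<close> has the Mellin transform
  \<open>\<integral>\<^sub>0\<^sup>\<infinity> t powr (z - 1) J(t) dt = \<Gamma>(z) B(-2z)\<close>, so a term \<open>c / t\<^sup>2\<close> in the expansion of \<open>J\<close> at infinity
  gives the residue \<open>2c\<close> of \<open>B\<close> at \<open>-4\<close>. By Laplace's method in a chart that is normalized at \<open>u\<close>,
  \<open>\<integral> exp (- t |u - v|\<^sup>2) dA(v) = \<pi> / t + q(u) / t\<^sup>2 + O(t powr (-5/2))\<close> uniformly in \<open>u\<close>, where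
  \<open>q(u) = \<pi> ((a - c)\<^sup>2 + 4 b\<^sup>2) / 16\<close> and \<open>a, b, c\<close> are the entries of the second fundamental form at \<open>u\<close> in an
  orthonormal frame. Hence the residue is \<open>2 \<integral> q dA\<close>, and it vanishes iff every point is umbilic.

  A connected umbilic patch lies in a sphere or in a plane. A patch around a point farthest from the
  origin cannot lie in a plane, so it lies in some sphere \<open>S\<close>; the points near which the surface lies in
  \<open>S\<close> form an open and closed subset, so the whole surface lies in \<open>S\<close>. If \<open>S\<close> had a point \<open>q\<close> outside the
  surface, the point of the surface nearest to \<open>q\<close> would be critical for the distance to \<open>q\<close>, which is
  impossible unless it is the antipode of \<open>q\<close>, and the antipode is the farthest point of \<open>S\<close>.
\<close>

section \<open>Area measure and charts\<close>

text \<open>The Mellin transform trades a power that is singular on the diagonal for a smooth,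
  bounded integrand. Any error exponent below -2 lets the continuation reach z = 2; -5/2 is what
  cubic remainders give without using cancellation at the next order. The factor 2 comes from s =
  -2z, as c / (2 - z) = 2c / (s + 4) and Gamma(2) = 1.

  Integrating over u forces every constant to be uniform in u. Therefore all patches are brought
  into one normal form whose constants \<open>R\<close> and \<open>K\<close> are explicit, and
  compactness supplies these constants.

  The number (a - c)^2 + 4 b^2 is the squared difference of the principal curvatures. So q is
  nonnegative, its integral vanishes only if q vanishes almost everywhere, and continuity of the
  second fundamental form removes the exceptional null set. Since q is local, the residue also
  vanishes for a disjoint union of spheres; connectedness enters when neighbouring patches are shown
  to lie in the same sphere.\<close>

definition dir_deriv :: "'a::real_normed_vector \<Rightarrow> ('a \<Rightarrow> 'b::real_normed_vector) \<Rightarrow> 'a \<Rightarrow> 'b" where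
  "dir_deriv v f = (\<lambda>x. frechet_derivative f (at x) v)"

section \<open>Directional derivatives of smooth maps and restriction of charts\<close>

lemma Ck_on_subset: "Ck_on k f S \<Longrightarrow> T \<subseteq> S \<Longrightarrow> Ck_on k f T"
  by (induction k arbitrary: f) (auto intro: continuous_on_subset)

lemma smooth_on_subset: "smooth_on f S \<Longrightarrow> T \<subseteq> S \<Longrightarrow> smooth_on f T"
  unfolding smooth_on_def using Ck_on_subset by blast

lemma smooth_on_dir_deriv: "smooth_on f S \<Longrightarrow> smooth_on (dir_deriv v f) S"
  unfolding smooth_on_def dir_deriv_def by (metis Ck_on.simps(2))

lemma smooth_on_continuous: "smooth_on f S \<Longrightarrow> continuous_on S f"
  unfolding smooth_on_def by (metis Ck_on.simps(1))

lemma smooth_on_has_derivative: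
  assumes "smooth_on f S" "x \<in> S"
  shows "(f has_derivative (\<lambda>v. dir_deriv v f x)) (at x)"
proof -
  have "Ck_on (Suc 0) f S" using assms(1) unfolding smooth_on_def by blast
  then show ?thesis using assms(2) by (simp add: dir_deriv_def frechet_derivative_works[symmetric])
qed

lemma linear_dir_deriv: "smooth_on f S \<Longrightarrow> x \<in> S \<Longrightarrow> linear (\<lambda>v. dir_deriv v f x)"
  using smooth_on_has_derivative has_derivative_linear by blast

text \<open>The homeomorphism clause is what keeps the image of a smaller domain open in
  \<open>M\<close>. This is used whenever a chart is shrunk to a ball, to a preimage or to the image
  of a ball under a linear map.\<close>

lemma local_parametrization_restrict:
  assumes "local_parametrization M V \<phi>" "open U" "U \<subseteq> V"
  shows "local_parametrization M U \<phi>"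
proof -
  have lp: "open V" "openin (top_of_set M) (\<phi> ` V)" "smooth_on \<phi> V" "\<forall>x\<in>V. inj (frechet_derivative \<phi> (at x))"
    using assms(1) by (auto simp: local_parametrization_def)
  obtain \<psi> where \<psi>: "homeomorphism V (\<phi> ` V) \<phi> \<psi>" using assms(1)
    by (auto simp: local_parametrization_def)
  have "openin (top_of_set V) U" using assms by (simp add: openin_open_eq lp(1))
  then have "openin (top_of_set (\<phi> ` V)) (\<phi> ` U)" using \<psi> homeomorphism_imp_open_map by blast
  then have "openin (top_of_set M) (\<phi> ` U)" using lp(2) openin_trans by blast
  moreover have "homeomorphism U (\<phi> ` U) \<phi> \<psi>" using \<psi> assms(3)
    by (rule homeomorphism_of_subsets) auto
  ultimately show ?thesis
    using assms lp smooth_on_subset unfolding local_parametrization_def by blast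
qed

lemma area_density_dir_deriv: "area_density \<phi> x = norm (cross3 (dir_deriv (axis 1 1) \<phi> x) (dir_deriv (axis 2 1) \<phi> x))"
  by (simp add: area_density_def dir_deriv_def)

lemma continuous_on_area_density: "smooth_on \<phi> V \<Longrightarrow> continuous_on V (area_density \<phi>)"
  unfolding area_density_dir_deriv
  by (intro continuous_on_norm continuous_on_cross smooth_on_continuous[OF smooth_on_dir_deriv])

text \<open>The domain is moved into an indicator because the comparison of charts works with total
  functions on \<open>lborel\<close> rather than with the restricted space of
  \<open>chart_area\<close>. The two measurability claims are included since \<open>\<phi>\<close>
  is controlled only on \<open>V\<close>.\<close>

lemma emeasure_chart_area:
  assumes V: "open V" and \<phi>: "smooth_on \<phi> V" and A: "A \<in> sets borel"
  shows "emeasure (chart_area V \<phi>) A = (\<integral>\<^sup>+x. ennreal (indicator {x \<in> V. \<phi> x \<in> A} x * area_density \<phi> x) \<partial>lborel)"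
    and "{x \<in> V. \<phi> x \<in> A} \<in> sets borel"
    and "(\<lambda>x. indicator {x \<in> V. \<phi> x \<in> A} x * area_density \<phi> x) \<in> borel_measurable borel"
proof -
  have m: "\<phi> \<in> borel_measurable (restrict_space lborel V)"
    using borel_measurable_continuous_on_restrict[OF smooth_on_continuous[OF \<phi>]]
    by (simp cong: measurable_cong_sets sets_restrict_space_cong)
  have ad: "area_density \<phi> \<in> borel_measurable (restrict_space lborel V)"
    using borel_measurable_continuous_on_restrict[OF continuous_on_area_density[OF \<phi>]]
    by (simp cong: measurable_cong_sets sets_restrict_space_cong)
  have eq: "\<phi> -` A \<inter> V = {x \<in> V. \<phi> x \<in> A}" by auto
  have "\<phi> -` A \<inter> space (restrict_space lborel V) \<in> sets (restrict_space lborel V)"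
    using m A by (rule measurable_sets)
  then have s: "{x \<in> V. \<phi> x \<in> A} \<in> sets (restrict_space lborel V)"
    by (simp add: space_restrict_space eq)
  then show S: "{x \<in> V. \<phi> x \<in> A} \<in> sets borel" using V by (auto simp: sets_restrict_space)
  have "(\<lambda>x. indicator V x *\<^sub>R area_density \<phi> x) \<in> borel_measurable borel"
    using V continuous_on_area_density[OF \<phi>] by (intro borel_measurable_continuous_on_indicator) auto
  then have "(\<lambda>x. indicator {x \<in> V. \<phi> x \<in> A} x * (indicator V x *\<^sub>R area_density \<phi> x)) \<in> borel_measurable borel"
    using S by measurable
  moreover have "(\<lambda>x. indicator {x \<in> V. \<phi> x \<in> A} x * (indicator V x *\<^sub>R area_density \<phi> x)) = (\<lambda>x. indicator {x \<in> V. \<phi> x \<in> A} x * area_density \<phi> x)"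
    by (auto simp: indicator_def)
  ultimately show "(\<lambda>x. indicator {x \<in> V. \<phi> x \<in> A} x * area_density \<phi> x) \<in> borel_measurable borel"
    by simp
  have "emeasure (chart_area V \<phi>) A = emeasure (density (restrict_space lborel V) (\<lambda>x. ennreal (area_density \<phi> x))) (\<phi> -` A \<inter> V)"
    unfolding chart_area_def using m A by (subst emeasure_distr) (auto simp: space_restrict_space)
  also have "\<dots> = (\<integral>\<^sup>+x. ennreal (area_density \<phi> x) * indicator {x \<in> V. \<phi> x \<in> A} x \<partial>restrict_space lborel V)"
    unfolding eq using s ad by (intro emeasure_density) auto
  also have "\<dots> = (\<integral>\<^sup>+x. (ennreal (area_density \<phi> x) * indicator {x \<in> V. \<phi> x \<in> A} x) * indicator V x \<partial>lborel)"
    using V by (intro nn_integral_restrict_space) auto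
  also have "\<dots> = (\<integral>\<^sup>+x. ennreal (indicator {x \<in> V. \<phi> x \<in> A} x * area_density \<phi> x) \<partial>lborel)"
    by (intro nn_integral_cong) (auto simp: indicator_def)
  finally show "emeasure (chart_area V \<phi>) A = (\<integral>\<^sup>+x. ennreal (indicator {x \<in> V. \<phi> x \<in> A} x * area_density \<phi> x) \<partial>lborel)" .
qed

lemma sets_chart_area [simp]: "sets (chart_area V \<phi>) = sets borel"
  by (simp add: chart_area_def)

text \<open>A scalar is a vector in \<open>real^1\<close>; this carries the vector-valued change of
  variables theorem over to real integrands. Pointwise differentiability of \<open>g\<close> on
  \<open>S\<close> is what the lifting of an immersion provides for transition maps.\<close>

lemma absolutely_integrable_change_of_variables_real:
  fixes f :: "real^'m::{finite,wellorder} \<Rightarrow> real" and g :: "real^'m::_ \<Rightarrow> real^'m::_"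
  assumes S: "S \<in> sets lebesgue"
    and der: "\<And>x. x \<in> S \<Longrightarrow> (g has_derivative g' x) (at x within S)" and inj: "inj_on g S"
    and int: "f absolutely_integrable_on (g ` S)"
  shows "(\<lambda>x. \<bar>det (matrix (g' x))\<bar> * f (g x)) absolutely_integrable_on S"
    "integral S (\<lambda>x. \<bar>det (matrix (g' x))\<bar> * f (g x)) = integral (g ` S) f"
proof -
  define F where "F = (\<lambda>x. vec (f x) :: real^1)"
  have "F absolutely_integrable_on (g ` S) \<and> integral (g ` S) F = vec (integral (g ` S) f)"
    using int by (simp add: absolutely_integrable_on_1_iff integral_on_1_eq F_def o_def)
  then have "(\<lambda>x. \<bar>det (matrix (g' x))\<bar> *\<^sub>R F (g x)) absolutely_integrable_on S \<and> integral S (\<lambda>x. \<bar>det (matrix (g' x))\<bar> *\<^sub>R F (g x)) = vec (integral (g ` S) f)"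
    using has_absolute_integral_change_of_variables[OF S der inj, of F "vec (integral (g ` S) f)"] by blast
  then show "(\<lambda>x. \<bar>det (matrix (g' x))\<bar> * f (g x)) absolutely_integrable_on S"
    "integral S (\<lambda>x. \<bar>det (matrix (g' x))\<bar> * f (g x)) = integral (g ` S) f"
    by (simp_all add: absolutely_integrable_on_1_iff integral_on_1_eq F_def o_def vec_eq_iff)
qed

text \<open>Absolute integrability refers to the completed Lebesgue measure, the measures of charts
  to \<open>lborel\<close>. Borel measurability of the truncated function makes the two integrals
  agree.\<close>

lemma absolutely_integrable_indicator_lborel:
  fixes f :: "'a::euclidean_space \<Rightarrow> real"
  assumes "(\<lambda>x. indicator S x * f x) \<in> borel_measurable borel"
  shows "f absolutely_integrable_on S \<longleftrightarrow> integrable lborel (\<lambda>x. indicator S x * f x)"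
    and "f absolutely_integrable_on S \<Longrightarrow> integral S f = (\<integral>x. indicator S x * f x \<partial>lborel)"
proof -
  show 1: "f absolutely_integrable_on S \<longleftrightarrow> integrable lborel (\<lambda>x. indicator S x * f x)"
    unfolding set_integrable_def using assms by (subst integrable_completion) auto
  assume a: "f absolutely_integrable_on S"
  have "integral S f = (LINT x:S|lebesgue. f x)" using set_lebesgue_integral_eq_integral(2)[OF a] by simp
  also have "\<dots> = (\<integral>x. indicator S x * f x \<partial>lborel)"
    unfolding set_lebesgue_integral_def using assms by (subst integral_completion) auto
  finally show "integral S f = (\<integral>x. indicator S x * f x \<partial>lborel)" .
qed

lemma linear_2: "linear (f :: real^2 \<Rightarrow> 'b::real_vector) \<Longrightarrow> f v = (v$1) *\<^sub>R f (axis 1 1) + (v$2) *\<^sub>R f (axis 2 1)"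
proof -
  assume f: "linear f"
  have "v = (v$1) *\<^sub>R axis 1 1 + (v$2) *\<^sub>R axis 2 1"
    by (simp add: vec_eq_iff forall_2 axis_def)
  then have "f v = f ((v$1) *\<^sub>R axis 1 1 + (v$2) *\<^sub>R axis 2 1)" by (rule arg_cong)
  then show ?thesis by (simp add: linear_add[OF f] linear_scale[OF f])
qed

text \<open>A bilinear alternating product changes by the determinant. Applied to a transition map
  this turns one area density into the other; applied to an orthonormalizing map it compares the two
  unnormalized normals.\<close>

lemma cross_linear_2:
  fixes A :: "real^2 \<Rightarrow> real^3" and T :: "real^2 \<Rightarrow> real^2"
  assumes A: "linear A" and T: "linear T"
  shows "cross3 (A (T (axis 1 1))) (A (T (axis 2 1))) = det (matrix T) *\<^sub>R cross3 (A (axis 1 1)) (A (axis 2 1))"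
proof -
  have d: "det (matrix T) = T (axis 1 1) $ 1 * T (axis 2 1) $ 2 - T (axis 2 1) $ 1 * T (axis 1 1) $ 2"
    by (simp add: det_2 matrix_def)
  show ?thesis unfolding d linear_2[OF A, of "T (axis 1 1)"] linear_2[OF A, of "T (axis 2 1)"]
    by (simp add: cross3_simps vec_eq_iff forall_3)
qed

text \<open>The transition map \<open>\<tau>\<close> is only known to be continuous; it is differentiable because \<open>\<theta>\<close> is an
  immersion, i.e. its derivative has a linear left inverse.\<close>
lemma has_derivative_lift_immersion:
  fixes \<phi> :: "'a::real_normed_vector \<Rightarrow> 'c::euclidean_space" and \<theta> :: "'b::euclidean_space \<Rightarrow> 'c"
  assumes S: "open S" "x \<in> S" and \<phi>: "(\<phi> has_derivative \<phi>') (at x)" and \<theta>: "(\<theta> has_derivative \<theta>') (at (\<tau> x))"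
    and inj: "inj \<theta>'" and eq: "\<And>z. z \<in> S \<Longrightarrow> \<theta> (\<tau> z) = \<phi> z" and cont: "continuous (at x) \<tau>"
  obtains \<tau>' where "(\<tau> has_derivative \<tau>') (at x)" "\<And>v. \<theta>' (\<tau>' v) = \<phi>' v"
proof -
  have l\<theta>: "linear \<theta>'" and l\<phi>: "linear \<phi>'" using \<theta> \<phi> has_derivative_linear by auto
  obtain P where P: "linear P" "P \<circ> \<theta>' = id" using linear_injective_left_inverse[OF l\<theta> inj] by blast
  have P': "P (\<theta>' v) = v" for v using P(2) by (metis comp_apply id_apply)
  have bP: "bounded_linear P" using P(1) by (rule linear_linear[THEN iffD1] linear_conv_bounded_linear[THEN iffD1])
  then obtain KP where KP: "KP > 0" "\<And>v. norm (P v) \<le> norm v * KP" using bounded_linear.pos_bounded by blast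
  have b\<phi>: "bounded_linear \<phi>'" using \<phi> has_derivative_bounded_linear by blast
  define \<tau>' where "\<tau>' = P \<circ> \<phi>'"
  have b\<tau>: "bounded_linear \<tau>'" unfolding \<tau>'_def using bP b\<phi> bounded_linear_compose[of P \<phi>']
    by (simp add: o_def)
  then obtain KT where KT: "KT > 0" "\<And>v. norm (\<tau>' v) \<le> norm v * KT" using bounded_linear.pos_bounded
    by blast
  have key: "\<forall>\<^sub>F z in at x. norm (\<tau> z - \<tau> x - \<tau>' (z - x)) \<le> e * norm (z - x)" if e: "e > 0" for e
  proof -
    \<comment> \<open>The first entry lets half of \<open>norm D\<close> be absorbed on the left,
      which gives a Lipschitz bound for \<open>\<tau>\<close> at \<open>x\<close>; with that bound
      the second entry turns the remaining error into at most
      \<open>e * norm (z - x)\<close>.\<close>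
    define \<eta> where "\<eta> = min (1 / (2 * KP)) (e / (2 * KP * (2 * (KP + KT) + 1)))"
    have \<eta>: "\<eta> > 0" "KP * \<eta> \<le> 1 / 2" using KP KT e
      by (auto simp: \<eta>_def min_def field_simps add_pos_pos split: if_splits)
    have \<eta>2: "KP * (\<eta> * (2 * (KP + KT) + 1)) \<le> e"
    proof -
      have p: "2 * (KP + KT) + 1 > 0" using KP KT by simp
      have half: "KP * (e / (2 * KP * q) * q) = e / 2" if "q > 0" for q using KP that by simp
      have "KP * (\<eta> * (2 * (KP + KT) + 1)) \<le> KP * (e / (2 * KP * (2 * (KP + KT) + 1)) * (2 * (KP + KT) + 1))"
        using KP p by (intro mult_left_mono mult_right_mono) (auto simp: \<eta>_def)
      also have "\<dots> = e / 2" by (rule half[OF p])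
      finally show ?thesis using e by simp
    qed
    obtain d1 where d1: "d1 > 0" "\<And>w. norm (w - \<tau> x) < d1 \<Longrightarrow> norm (\<theta> w - \<theta> (\<tau> x) - \<theta>' (w - \<tau> x)) \<le> \<eta> * norm (w - \<tau> x)"
      using \<theta> \<eta>(1) unfolding has_derivative_at_alt by blast
    obtain d2 where d2: "d2 > 0" "\<And>z. norm (z - x) < d2 \<Longrightarrow> norm (\<phi> z - \<phi> x - \<phi>' (z - x)) \<le> min \<eta> 1 * norm (z - x)"
      using \<phi> \<eta>(1) unfolding has_derivative_at_alt by (metis min_less_iff_conj zero_less_one)
    have "\<forall>\<^sub>F z in at x. dist (\<tau> z) (\<tau> x) < d1" using cont d1(1)
      unfolding continuous_at tendsto_iff by blast
    moreover have "\<forall>\<^sub>F z in at x. dist z x < d2" using d2(1) by (auto simp: eventually_at)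
    moreover have "\<forall>\<^sub>F z in at x. z \<in> S" using S by (intro eventually_at_in_open') auto
    ultimately show ?thesis
    proof eventually_elim
      case (elim z)
      define D where "D = \<tau> z - \<tau> x"
      have e1: "norm (\<theta> (\<tau> z) - \<theta> (\<tau> x) - \<theta>' D) \<le> \<eta> * norm D"
        using d1(2)[of "\<tau> z"] elim by (simp add: dist_norm D_def)
      have e2: "norm (\<phi> z - \<phi> x - \<phi>' (z - x)) \<le> \<eta> * norm (z - x)" and e3: "norm (\<phi> z - \<phi> x - \<phi>' (z - x)) \<le> 1 * norm (z - x)"
      proof -
        have "norm (\<phi> z - \<phi> x - \<phi>' (z - x)) \<le> min \<eta> 1 * norm (z - x)"
          using d2(2)[of z] elim by (simp add: dist_norm)
        moreover have "min \<eta> 1 * norm (z - x) \<le> \<eta> * norm (z - x)" "min \<eta> 1 * norm (z - x) \<le> 1 * norm (z - x)"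
          by (rule mult_right_mono; simp)+
        ultimately show "norm (\<phi> z - \<phi> x - \<phi>' (z - x)) \<le> \<eta> * norm (z - x)" "norm (\<phi> z - \<phi> x - \<phi>' (z - x)) \<le> 1 * norm (z - x)"
          by linarith+
      qed
      have eqs: "\<theta> (\<tau> z) = \<phi> z" "\<theta> (\<tau> x) = \<phi> x" using elim S eq by auto
      \<comment> \<open>\<open>P\<close> inverts \<open>\<theta>'\<close>, so applying it to the
        difference of the two first-order remainders cancels everything except the remainder of
        \<open>\<tau>\<close>.\<close>
      have dec: "D - \<tau>' (z - x) = P ((\<phi> z - \<phi> x - \<phi>' (z - x)) - (\<theta> (\<tau> z) - \<theta> (\<tau> x) - \<theta>' D))"
        unfolding eqs by (simp add: linear_diff[OF P(1)] P' \<tau>'_def)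
      have n1: "norm (D - \<tau>' (z - x)) \<le> KP * (\<eta> * norm (z - x) + \<eta> * norm D)"
      proof -
        have "norm (D - \<tau>' (z - x)) \<le> norm ((\<phi> z - \<phi> x - \<phi>' (z - x)) - (\<theta> (\<tau> z) - \<theta> (\<tau> x) - \<theta>' D)) * KP"
          unfolding dec by (rule KP(2))
        also have "\<dots> \<le> (\<eta> * norm (z - x) + \<eta> * norm D) * KP"
          using e1 e2 KP(1) norm_triangle_ineq4[of "\<phi> z - \<phi> x - \<phi>' (z - x)" "\<theta> (\<tau> z) - \<theta> (\<tau> x) - \<theta>' D"]
          by (intro mult_right_mono) auto
        finally show ?thesis by (simp add: mult.commute)
      qed
      have n2: "norm D \<le> 2 * (KP + KT) * norm (z - x)"
      proof -
        have "norm (D - \<tau>' (z - x)) \<le> norm ((\<phi> z - \<phi> x - \<phi>' (z - x)) - (\<theta> (\<tau> z) - \<theta> (\<tau> x) - \<theta>' D)) * KP"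
          unfolding dec by (rule KP(2))
        also have "\<dots> \<le> (1 * norm (z - x) + \<eta> * norm D) * KP"
          using e1 e3 KP(1) norm_triangle_ineq4[of "\<phi> z - \<phi> x - \<phi>' (z - x)" "\<theta> (\<tau> z) - \<theta> (\<tau> x) - \<theta>' D"]
          by (intro mult_right_mono) auto
        also have "\<dots> = KP * norm (z - x) + (KP * \<eta>) * norm D" by (simp add: algebra_simps)
        also have "\<dots> \<le> KP * norm (z - x) + 1 / 2 * norm D" using \<eta>(2)
          by (intro add_left_mono mult_right_mono) auto
        finally have "norm (D - \<tau>' (z - x)) \<le> KP * norm (z - x) + 1 / 2 * norm D" .
        moreover have "norm D \<le> norm (D - \<tau>' (z - x)) + norm (\<tau>' (z - x))"
          using norm_triangle_sub[of D "\<tau>' (z - x)"] by linarith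
        moreover have "norm (\<tau>' (z - x)) \<le> KT * norm (z - x)" using KT(2)[of "z - x"]
          by (simp add: mult.commute)
        ultimately have "norm D \<le> 2 * (KP * norm (z - x)) + 2 * (KT * norm (z - x))" by linarith
        then show ?thesis by (simp add: algebra_simps)
      qed
      have "norm (D - \<tau>' (z - x)) \<le> KP * (\<eta> * norm (z - x) + \<eta> * (2 * (KP + KT) * norm (z - x)))"
        using n1 n2 KP \<eta>(1) by (smt (verit, best) mult_left_mono)
      also have "\<dots> = KP * (\<eta> * (2 * (KP + KT) + 1)) * norm (z - x)" by (simp add: algebra_simps)
      also have "\<dots> \<le> e * norm (z - x)" using \<eta>2 by (rule mult_right_mono) auto
      finally show ?case by (simp add: D_def)
    qed
  qed
  have der: "(\<tau> has_derivative \<tau>') (at x)"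
    unfolding has_derivative_at_alt
  proof (intro conjI b\<tau> allI impI)
    fix e :: real assume "e > 0"
    then obtain d where d: "d > 0" "\<And>z. z \<noteq> x \<Longrightarrow> dist z x < d \<Longrightarrow> norm (\<tau> z - \<tau> x - \<tau>' (z - x)) \<le> e * norm (z - x)"
      using key[of e] unfolding eventually_at by auto
    show "\<exists>d>0. \<forall>z. norm (z - x) < d \<longrightarrow> norm (\<tau> z - \<tau> x - \<tau>' (z - x)) \<le> e * norm (z - x)"
    proof (intro exI[of _ d] conjI d(1) allI impI)
      fix z assume "norm (z - x) < d"
      then show "norm (\<tau> z - \<tau> x - \<tau>' (z - x)) \<le> e * norm (z - x)"
        using d(2)[of z] linear_0[of \<tau>'] b\<tau> by (cases "z = x") (auto simp: dist_norm bounded_linear.linear)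
    qed
  qed
  have "(\<theta> \<circ> \<tau> has_derivative \<theta>' \<circ> \<tau>') (at x)" using der \<theta>
    by (rule diff_chain_at)
  then have "(\<phi> has_derivative \<theta>' \<circ> \<tau>') (at x)"
    by (rule has_derivative_transform_within_open[OF _ S]) (simp add: eq)
  then have "\<theta>' \<circ> \<tau>' = \<phi>'" using \<phi> has_derivative_unique by blast
  then have "\<theta>' (\<tau>' v) = \<phi>' v" for v by (metis comp_apply)
  then show thesis using that der by blast
qed


lemma inj_dir_deriv: "local_parametrization M V \<phi> \<Longrightarrow> x \<in> V \<Longrightarrow> inj (\<lambda>v. dir_deriv v \<phi> x)"
  by (simp add: local_parametrization_def dir_deriv_def)

lemma local_parametrization_image_subset: "local_parametrization M V \<phi> \<Longrightarrow> \<phi> ` V \<subseteq> M"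
  unfolding local_parametrization_def using openin_imp_subset by blast

text \<open>The transition map \<open>\<tau>\<close> is differentiable by the lifting lemma, the
  chain rule gives the density identity \<open>dens\<close>, and the change of variables formula
  does the rest. Finiteness in the chart \<open>\<theta>\<close> supplies the absolute integrability
  from which that formula starts; the chart \<open>\<phi>\<close> inherits it.\<close>

lemma chart_area_overlap:
  assumes lp: "local_parametrization M V \<phi>" and lp': "local_parametrization M W \<theta>"
    and A: "A \<in> sets borel" "A \<subseteq> \<phi> ` V" "A \<subseteq> \<theta> ` W"
    and fin: "emeasure (chart_area W \<theta>) A < \<infinity>"
  shows "emeasure (chart_area V \<phi>) A = emeasure (chart_area W \<theta>) A"
proof -
  have V: "open V" "smooth_on \<phi> V" and W: "open W" "smooth_on \<theta> W"
    using lp lp' by (auto simp: local_parametrization_def)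
  obtain \<kappa> where \<kappa>: "homeomorphism V (\<phi> ` V) \<phi> \<kappa>" using lp
    by (auto simp: local_parametrization_def)
  obtain \<psi> where \<psi>: "homeomorphism W (\<theta> ` W) \<theta> \<psi>" using lp'
    by (auto simp: local_parametrization_def)
  define \<tau> where "\<tau> = \<psi> \<circ> \<phi>"
  define O' where "O' = {x \<in> V. \<phi> x \<in> \<theta> ` W}"
  obtain T where T: "open T" "\<theta> ` W = M \<inter> T" using lp'
    by (auto simp: local_parametrization_def openin_open)
  have "O' = V \<inter> \<phi> -` T" using local_parametrization_image_subset[OF lp] T(2) by (auto simp: O'_def)
  then have openO: "open O'" using continuous_open_preimage[OF smooth_on_continuous[OF V(2)] V(1) T(1)] by simp
  have "continuous_on O' \<tau>" unfolding \<tau>_def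
    by (intro continuous_on_compose continuous_on_subset[OF smooth_on_continuous[OF V(2)]] continuous_on_subset[OF homeomorphism_cont2[OF \<psi>]])
      (auto simp: O'_def)
  then have cont: "continuous (at x) \<tau>" if "x \<in> O'" for x using openO that
    by (simp add: continuous_on_eq_continuous_at)
  have \<theta>\<tau>: "\<theta> (\<tau> x) = \<phi> x" and \<tau>W: "\<tau> x \<in> W" if "x \<in> O'" for x
    using that \<psi> by (auto simp: \<tau>_def O'_def homeomorphism_apply1 homeomorphism_apply2)
  have "\<exists>\<tau>'. (\<tau> has_derivative \<tau>') (at x) \<and> (\<forall>v. dir_deriv (\<tau>' v) \<theta> (\<tau> x) = dir_deriv v \<phi> x)" if x: "x \<in> O'" for x
  proof -
    have xV: "x \<in> V" using x by (simp add: O'_def)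
    show ?thesis
      using has_derivative_lift_immersion[OF openO x smooth_on_has_derivative[OF V(2) xV] smooth_on_has_derivative[OF W(2) \<tau>W[OF x]] inj_dir_deriv[OF lp' \<tau>W[OF x]] \<theta>\<tau> cont[OF x]]
      by blast
  qed
  then obtain \<tau>' where \<tau>': "\<And>x. x \<in> O' \<Longrightarrow> (\<tau> has_derivative \<tau>' x) (at x)"
    "\<And>x v. x \<in> O' \<Longrightarrow> dir_deriv (\<tau>' x v) \<theta> (\<tau> x) = dir_deriv v \<phi> x"
      by metis
  have dens: "\<bar>det (matrix (\<tau>' x))\<bar> * area_density \<theta> (\<tau> x) = area_density \<phi> x" if x: "x \<in> O'" for x
  proof -
    have "cross3 (dir_deriv (\<tau>' x (axis 1 1)) \<theta> (\<tau> x)) (dir_deriv (\<tau>' x (axis 2 1)) \<theta> (\<tau> x)) =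
      det (matrix (\<tau>' x)) *\<^sub>R cross3 (dir_deriv (axis 1 1) \<theta> (\<tau> x)) (dir_deriv (axis 2 1) \<theta> (\<tau> x))"
      using linear_dir_deriv[OF W(2) \<tau>W[OF x]] has_derivative_linear[OF \<tau>'(1)[OF x]] by (rule cross_linear_2)
    then show ?thesis unfolding area_density_dir_deriv \<tau>'(2)[OF x] by simp
  qed
  define S where "S = {x \<in> V. \<phi> x \<in> A}"
  have SO: "S \<subseteq> O'" using A by (auto simp: S_def O'_def)
  have inj: "inj_on \<tau> S"
  proof (rule inj_onI)
    fix x y assume xy: "x \<in> S" "y \<in> S" "\<tau> x = \<tau> y"
    then have "\<phi> x = \<phi> y" using \<theta>\<tau> SO by (metis subsetD)
    then show "x = y" using xy homeomorphism_apply1[OF \<kappa>] by (metis (no_types, lifting) S_def mem_Collect_eq)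
  qed
  have im: "\<tau> ` S = {y \<in> W. \<theta> y \<in> A}"
  proof (intro set_eqI iffI)
    fix y assume "y \<in> \<tau> ` S"
    then show "y \<in> {y \<in> W. \<theta> y \<in> A}" using \<theta>\<tau> \<tau>W SO by (auto simp: S_def)
  next
    fix y assume y: "y \<in> {y \<in> W. \<theta> y \<in> A}"
    then obtain x where x: "x \<in> V" "\<phi> x = \<theta> y" using A(2) by auto
    then have "\<tau> x = y" using y \<psi> by (auto simp: \<tau>_def homeomorphism_apply1)
    then show "y \<in> \<tau> ` S" using x y by (auto simp: S_def)
  qed
  note cV = emeasure_chart_area[OF V A(1)] and cW = emeasure_chart_area[OF W A(1)]
  have nn: "area_density \<theta> y \<ge> 0" "area_density \<phi> x \<ge> 0" for x y by (auto simp: area_density_def)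
  have intW: "integrable lborel (\<lambda>y. indicator {y \<in> W. \<theta> y \<in> A} y * area_density \<theta> y)"
    using fin cW nn by (intro integrableI_nonneg) auto
  then have ai: "area_density \<theta> absolutely_integrable_on (\<tau> ` S)" unfolding im
    using absolutely_integrable_indicator_lborel(1)[OF cW(3)] by simp
  have Sleb: "S \<in> sets lebesgue" using cV(2) unfolding S_def by simp
  have der: "(\<tau> has_derivative \<tau>' x) (at x within S)" if "x \<in> S" for x
    using \<tau>'(1) SO that by (auto intro: has_derivative_at_withinI)
  have cov: "(\<lambda>x. \<bar>det (matrix (\<tau>' x))\<bar> * area_density \<theta> (\<tau> x)) absolutely_integrable_on S"
    "integral S (\<lambda>x. \<bar>det (matrix (\<tau>' x))\<bar> * area_density \<theta> (\<tau> x)) = integral (\<tau> ` S) (area_density \<theta>)"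
    by (rule absolutely_integrable_change_of_variables_real[OF Sleb _ inj ai], rule der, assumption)+
  have eqS: "\<bar>det (matrix (\<tau>' x))\<bar> * area_density \<theta> (\<tau> x) = area_density \<phi> x" if "x \<in> S" for x
    using dens SO that by auto
  have aiS: "area_density \<phi> absolutely_integrable_on S"
    by (subst set_integrable_cong[OF refl refl eqS[symmetric]]) (auto intro: cov(1))
  have "integral S (area_density \<phi>) = integral (\<tau> ` S) (area_density \<theta>)"
    unfolding cov(2)[symmetric] by (rule integral_cong) (simp add: eqS)
  then have "(\<integral>x. indicator S x * area_density \<phi> x \<partial>lborel) = (\<integral>y. indicator {y \<in> W. \<theta> y \<in> A} y * area_density \<theta> y \<partial>lborel)"
    using absolutely_integrable_indicator_lborel(2)[OF cV(3)[folded S_def] aiS] absolutely_integrable_indicator_lborel(2)[OF cW(3)] ai im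
    by simp
  moreover have "emeasure (chart_area V \<phi>) A = ennreal (\<integral>x. indicator S x * area_density \<phi> x \<partial>lborel)"
    unfolding cV(1) S_def[symmetric]
    using absolutely_integrable_indicator_lborel(1)[OF cV(3)[folded S_def]] aiS nn
    by (intro nn_integral_eq_integral) auto
  moreover have "emeasure (chart_area W \<theta>) A = ennreal (\<integral>y. indicator {y \<in> W. \<theta> y \<in> A} y * area_density \<theta> y \<partial>lborel)"
    unfolding cW(1) using intW nn by (intro nn_integral_eq_integral) auto
  ultimately show ?thesis by simp
qed

section \<open>The supremum of the chart measures as one finite measure\<close>

lemma chart_area_Int_image:
  assumes "local_parametrization M V \<phi>" "A \<in> sets borel" "B \<in> sets borel" "\<phi> ` V \<subseteq> B"
  shows "emeasure (chart_area V \<phi>) (A \<inter> B) = emeasure (chart_area V \<phi>) A"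
proof -
  have V: "open V" "smooth_on \<phi> V" using assms by (auto simp: local_parametrization_def)
  have "{x \<in> V. \<phi> x \<in> A \<inter> B} = {x \<in> V. \<phi> x \<in> A}" using assms by auto
  then show ?thesis using emeasure_chart_area(1)[OF V] assms by (simp add: sets.Int)
qed

text \<open>The density is bounded on a ball whose closure stays inside the domain. Finite area is
  needed for comparing charts and for a finite total mass.\<close>

lemma small_chart:
  assumes "smooth_surface M" "p \<in> M"
  obtains V \<phi> where "local_parametrization M V \<phi>" "p \<in> \<phi> ` V" "emeasure (chart_area V \<phi>) UNIV < \<infinity>"
proof -
  obtain V \<phi> where lp: "local_parametrization M V \<phi>" and p: "p \<in> \<phi> ` V" using assms
    by (auto simp: smooth_surface_def)
  then obtain x where x: "x \<in> V" "p = \<phi> x" by auto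
  have V: "open V" "smooth_on \<phi> V" using lp by (auto simp: local_parametrization_def)
  obtain r where r: "r > 0" "cball x r \<subseteq> V" using V(1) x(1) open_contains_cball by blast
  have lpb: "local_parametrization M (ball x r) \<phi>"
    using local_parametrization_restrict[OF lp open_ball] r ball_subset_cball by blast
  then have U: "open (ball x r)" "smooth_on \<phi> (ball x r)" by (auto simp: local_parametrization_def)
  have "compact (area_density \<phi> ` cball x r)"
    using continuous_on_subset[OF continuous_on_area_density[OF V(2)] r(2)] by (intro compact_continuous_image) auto
  then obtain b where b: "\<And>y. y \<in> cball x r \<Longrightarrow> area_density \<phi> y \<le> b"
    using compact_imp_bounded bounded_real by (metis abs_le_D1 imageI)
  have "emeasure (chart_area (ball x r) \<phi>) UNIV \<le> (\<integral>\<^sup>+y. ennreal b * indicator (ball x r) y \<partial>lborel)"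
    unfolding emeasure_chart_area(1)[OF U space_in_borel]
    by (intro nn_integral_mono) (auto simp: indicator_def intro!: ennreal_leI b)
  also have "\<dots> = ennreal b * emeasure lborel (ball x r)" by (intro nn_integral_cmult_indicator) auto
  also have "\<dots> < \<infinity>" using emeasure_lborel_ball_finite[of x r] by (simp add: ennreal_mult_less_top)
  finally show thesis using that lpb x r by auto
qed

text \<open>The supremum of measures is squeezed. An explicit measure \<open>\<nu>\<close>, glued
  from finitely many charts, dominates every chart measure and agrees with each of them on the image
  of the chart, so the supremum, lying between the two, agrees there as well. Finite mass and
  concentration on \<open>M\<close> are read off from \<open>\<nu>\<close>.\<close>

lemma area_measure_on_charts:
  assumes M: "smooth_surface M" "compact M" "M \<noteq> {}"
  shows sets_area_measure: "sets (area_measure M) = sets borel"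
    and finite_measure_area: "finite_measure (area_measure M)"
    and emeasure_area_outside: "emeasure (area_measure M) (- M) = 0"
    and emeasure_area_chart: "\<And>V \<phi> A. local_parametrization M V \<phi> \<Longrightarrow> A \<in> sets borel \<Longrightarrow> A \<subseteq> \<phi> ` V \<Longrightarrow>
      emeasure (area_measure M) A = emeasure (chart_area V \<phi>) A"
proof -
  define I where "I = {(V, \<phi>). local_parametrization M V \<phi>}"
  define chart where "chart = (\<lambda>(V, \<phi>). chart_area V \<phi>)"
  have am: "area_measure M = (SUP i\<in>I. chart i)"
    unfolding area_measure_def I_def chart_def by (rule SUP_cong) auto
  have sc [simp]: "sets (chart i) = sets borel" for i by (cases i) (simp add: chart_def)
  obtain p where "p \<in> M" using M(3) by auto
  then have I0: "I \<noteq> {}" using M(1) unfolding smooth_surface_def I_def by blast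
  show sets: "sets (area_measure M) = sets borel" unfolding am by (rule sets_SUP) (use I0 in auto)
  have borelM: "M \<in> sets borel" using M(2) by (simp add: compact_imp_closed borel_closed)
  have im_borel: "\<phi> ` V \<in> sets borel" if "(V, \<phi>) \<in> I" for V \<phi>
  proof -
    have "openin (top_of_set M) (\<phi> ` V)" using that by (simp add: I_def local_parametrization_def)
    then obtain T where "open T" "\<phi> ` V = M \<inter> T" unfolding openin_open by blast
    then show ?thesis using borelM by auto
  qed
  have "\<exists>i. i \<in> I \<and> p \<in> snd i ` fst i \<and> emeasure (chart i) UNIV < \<infinity>" if p: "p \<in> M" for p
  proof -
    obtain V \<phi> where "local_parametrization M V \<phi>" "p \<in> \<phi> ` V" "emeasure (chart_area V \<phi>) UNIV < \<infinity>"
      by (rule small_chart[OF M(1) p]) (rule that)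
    then show ?thesis by (intro exI[of _ "(V, \<phi>)"]) (simp add: I_def chart_def)
  qed
  then obtain c where c: "\<And>p. p \<in> M \<Longrightarrow> c p \<in> I \<and> p \<in> snd (c p) ` fst (c p) \<and> emeasure (chart (c p)) UNIV < \<infinity>"
    by metis
  have "\<exists>T. open T \<and> snd (c p) ` fst (c p) = M \<inter> T" if "p \<in> M" for p
    using c[OF that] by (cases "c p") (auto simp: I_def local_parametrization_def openin_open)
  then obtain T where T: "\<And>p. p \<in> M \<Longrightarrow> open (T p) \<and> snd (c p) ` fst (c p) = M \<inter> T p"
    by metis
  have "M \<subseteq> (\<Union>p\<in>M. T p)" using c T by auto
  then obtain F where F: "F \<subseteq> M" "finite F" "M \<subseteq> (\<Union>p\<in>F. T p)"
    using compactE_image[OF M(2), of M T] T by auto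
  obtain ps where ps: "set ps = F" using finite_list[OF F(2)] by blast
  define n where "n = length ps"
  define K where "K = (\<lambda>i. snd (c (ps ! i)) ` fst (c (ps ! i)))"
  \<comment> \<open>Removing the earlier images makes the cover disjoint, so that the contributions
    of the charts may be added.\<close>
  define P where "P = (\<lambda>i. K i - (\<Union>j<i. K j))"
  define ch where "ch = (\<lambda>i. chart (c (ps ! i)))"
  have psM: "ps ! i \<in> M" if "i < n" for i using that F ps n_def nth_mem by blast
  have Kb: "K i \<in> sets borel" if "i < n" for i
    using im_borel[of "fst (c (ps!i))" "snd (c (ps!i))"] c[OF psM[OF that]] by (simp add: K_def)
  have Pb: "P i \<in> sets borel" if "i < n" for i
    unfolding P_def using Kb that by (intro sets.Diff sets.finite_UN) auto
  have KM: "K i \<subseteq> M" if "i < n" for i unfolding K_def using T[OF psM[OF that]] by auto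
  have MK: "M \<subseteq> (\<Union>i<n. K i)"
  proof
    fix q assume q: "q \<in> M"
    then obtain p where p: "p \<in> F" "q \<in> T p" using F by auto
    then obtain i where i: "i < n" "ps ! i = p" using ps n_def by (metis in_set_conv_nth)
    have "q \<in> K i" unfolding K_def i(2) using T[of p] p F q by auto
    then show "q \<in> (\<Union>i<n. K i)" using i by auto
  qed
  have MP: "M = (\<Union>i<n. P i)"
  proof
    show "(\<Union>i<n. P i) \<subseteq> M" using KM by (auto simp: P_def)
    show "M \<subseteq> (\<Union>i<n. P i)"
    proof
      fix q assume "q \<in> M"
      then obtain i where i: "i < n" "q \<in> K i" using MK by auto
      define j where "j = (LEAST j. q \<in> K j)"
      have "q \<in> K j" "j \<le> i" using i unfolding j_def by (auto intro: LeastI Least_le)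
      moreover have "q \<notin> K l" if "l < j" for l using that unfolding j_def by (rule not_less_Least)
      ultimately show "q \<in> (\<Union>i<n. P i)" using i by (auto simp: P_def intro!: bexI[of _ j])
    qed
  qed
  have disj: "disjoint_family_on P {..<n}"
  proof -
    have "P i \<inter> P j = {}" if "i < j" for i j using that by (auto simp: P_def)
    then show ?thesis unfolding disjoint_family_on_def by (metis Int_commute nat_neq_iff)
  qed
  have chI: "local_parametrization M (fst (c (ps!i))) (snd (c (ps!i)))" if "i < n" for i
    using c[OF psM[OF that]] by (auto simp: I_def case_prod_beta)
  have ch_eq: "ch i = chart_area (fst (c (ps!i))) (snd (c (ps!i)))" for i by (simp add: ch_def chart_def case_prod_beta)
  have chfin: "emeasure (ch i) A < \<infinity>" if "i < n" for i A
  proof -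
    have "emeasure (ch i) A \<le> emeasure (ch i) UNIV"
      by (rule emeasure_mono) (auto simp: ch_def sets_eq_imp_space_eq)
    also have "\<dots> < \<infinity>" using c[OF psM[OF that]] by (simp add: ch_def)
    finally show ?thesis .
  qed
  define \<nu> where "\<nu> = measure_of UNIV (sets borel) (\<lambda>A. \<Sum>i<n. emeasure (ch i) (A \<inter> P i))"
  have sets_\<nu>: "sets \<nu> = sets borel" unfolding \<nu>_def
    using sets.sigma_sets_eq[of "borel :: (real^3) measure"] by (simp add: sets_measure_of_conv)
  have em_\<nu>: "emeasure \<nu> A = (\<Sum>i<n. emeasure (ch i) (A \<inter> P i))" if A: "A \<in> sets borel" for A
  proof (rule emeasure_measure_of[OF \<nu>_def])
    show "A \<in> sets \<nu>" using A sets_\<nu> by simp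
    show "positive (sets \<nu>) (\<lambda>A. \<Sum>i<n. emeasure (ch i) (A \<inter> P i))" by (simp add: positive_def)
    show "countably_additive (sets \<nu>) (\<lambda>A. \<Sum>i<n. emeasure (ch i) (A \<inter> P i))"
    proof (rule countably_additiveI)
      fix D :: "nat \<Rightarrow> (real^3) set" assume D: "range D \<subseteq> sets \<nu>" "disjoint_family D"
      have "(\<Sum>k. \<Sum>i<n. emeasure (ch i) (D k \<inter> P i)) = (\<Sum>i<n. \<Sum>k. emeasure (ch i) (D k \<inter> P i))"
        by (rule suminf_sum) auto
      also have "\<dots> = (\<Sum>i<n. emeasure (ch i) ((\<Union>k. D k) \<inter> P i))"
      proof (intro sum.cong refl)
        fix i assume i: "i \<in> {..<n}"
        have "(\<Sum>k. emeasure (ch i) (D k \<inter> P i)) = emeasure (ch i) (\<Union>k. D k \<inter> P i)"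
          using D Pb i sets_\<nu> by (intro suminf_emeasure) (auto simp: ch_def disjoint_family_on_def)
        then show "(\<Sum>k. emeasure (ch i) (D k \<inter> P i)) = emeasure (ch i) ((\<Union>k. D k) \<inter> P i)"
          by simp
      qed
      finally show "(\<Sum>k. \<Sum>i<n. emeasure (ch i) (D k \<inter> P i)) = (\<Sum>i<n. emeasure (ch i) ((\<Union>k. D k) \<inter> P i))" .
    qed
  qed auto
  \<comment> \<open>An arbitrary chart may have infinite area; the comparison runs from the chosen
    chart, which contains \<open>P i\<close> in its image and has finite area.\<close>
  have overlap: "emeasure (chart_area V \<phi>) (A \<inter> P i) = emeasure (ch i) (A \<inter> P i)"
    if "local_parametrization M V \<phi>" "A \<in> sets borel" "A \<subseteq> \<phi> ` V" "i < n" for V \<phi> A i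
    unfolding ch_eq using that chI chfin[OF that(4)] Pb
    by (intro chart_area_overlap[of M]) (auto simp: P_def K_def ch_eq)
  have chart_sum: "emeasure (chart_area V \<phi>) A = emeasure \<nu> A"
    if lp: "local_parametrization M V \<phi>" and A: "A \<in> sets borel" "A \<subseteq> \<phi> ` V" for V \<phi> A
  proof -
    have "A = (\<Union>i<n. A \<inter> P i)" using local_parametrization_image_subset[OF lp] A MP by auto
    then have "emeasure (chart_area V \<phi>) A = emeasure (chart_area V \<phi>) (\<Union>i<n. A \<inter> P i)" by simp
    also have "\<dots> = (\<Sum>i<n. emeasure (chart_area V \<phi>) (A \<inter> P i))"
    proof (intro sum_emeasure[symmetric])
      show "disjoint_family_on (\<lambda>i. A \<inter> P i) {..<n}" using disj unfolding disjoint_family_on_def by blast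
    qed (use A Pb in auto)
    also have "\<dots> = emeasure \<nu> A" unfolding em_\<nu>[OF A(1)] using overlap[OF lp A] by (intro sum.cong) auto
    finally show ?thesis .
  qed
  have "(SUP i\<in>I. chart i) \<le> \<nu>"
  proof (rule SUP_least)
    fix i assume i: "i \<in> I"
    obtain V \<phi> where i_eq: "i = (V, \<phi>)" and lp: "local_parametrization M V \<phi>" using i
      by (auto simp: I_def)
    have B: "\<phi> ` V \<in> sets borel" using im_borel i i_eq by blast
    show "chart i \<le> \<nu>"
    proof (subst le_measure)
      show "sets (chart i) = sets \<nu>" by (simp add: sets_\<nu>)
      show "\<forall>A\<in>sets (chart i). emeasure (chart i) A \<le> emeasure \<nu> A"
      proof
        fix A assume "A \<in> sets (chart i)"
        then have A: "A \<in> sets borel" by simp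
        have "emeasure (chart i) A = emeasure (chart_area V \<phi>) (A \<inter> \<phi> ` V)"
          using chart_area_Int_image[OF lp A B] by (simp add: i_eq chart_def)
        also have "\<dots> = emeasure \<nu> (A \<inter> \<phi> ` V)" using A B by (intro chart_sum[OF lp]) auto
        also have "\<dots> \<le> emeasure \<nu> A" using A sets_\<nu> by (intro emeasure_mono) auto
        finally show "emeasure (chart i) A \<le> emeasure \<nu> A" .
      qed
    qed
  qed
  then have le: "emeasure (area_measure M) A \<le> emeasure \<nu> A" for A
    unfolding am[symmetric] by (intro le_measureD3) (simp_all add: sets sets_\<nu>)
  show "emeasure (area_measure M) A = emeasure (chart_area V \<phi>) A"
    if lp: "local_parametrization M V \<phi>" and A: "A \<in> sets borel" "A \<subseteq> \<phi> ` V" for V \<phi> A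
  proof (rule antisym)
    show "emeasure (area_measure M) A \<le> emeasure (chart_area V \<phi>) A" using le[of A] chart_sum[OF lp A] by simp
    have "chart (V, \<phi>) \<le> area_measure M" unfolding am by (rule SUP_upper) (simp add: I_def lp)
    then show "emeasure (chart_area V \<phi>) A \<le> emeasure (area_measure M) A"
      using le_measureD3[of "chart (V, \<phi>)" "area_measure M" A] sets by (simp add: chart_def)
  qed
  have "emeasure \<nu> UNIV < \<infinity>" unfolding em_\<nu>[OF space_in_borel] using chfin
    by (simp add: ennreal_sum_less_top)
  then have "emeasure (area_measure M) UNIV < \<infinity>" using le[of UNIV] by (rule order.strict_trans1[rotated])
  then show "finite_measure (area_measure M)"
    using sets_eq_imp_space_eq[OF sets] by (intro finite_measureI) auto
  have "- M \<inter> P i = {}" if "i < n" for i using MP that by blast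
  then have "emeasure \<nu> (- M) = 0" unfolding em_\<nu>[OF borel_comp[OF borelM]] by (intro sum.neutral) simp
  then show "emeasure (area_measure M) (- M) = 0" using le[of "- M"] by simp
qed

section \<open>Gaussian integrals over perturbed planar patches\<close>

lemma gaussian_even_moment:
  fixes t :: real
  assumes "t > 0"
  shows "has_bochner_integral lborel (\<lambda>x. exp (- t * x\<^sup>2) * x ^ (2 * k)) (sqrt (pi / t) * (fact (2 * k) / ((4 * t) ^ k * fact k)))"
proof -
  \<comment> \<open>With variance \<open>1 / (2 * t)\<close> the normal density is the Gaussian
    divided by \<open>sqrt (pi / t)\<close>, so its moments only have to be scaled back.\<close>
  define \<sigma> where "\<sigma> = 1 / sqrt (2 * t)"
  have s2: "\<sigma>\<^sup>2 = 1 / (2 * t)" and "\<sigma> > 0" using assms by (auto simp: \<sigma>_def power_divide)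
  have nd: "normal_density 0 \<sigma> x = exp (- t * x\<^sup>2) / sqrt (pi / t)" for x
    unfolding normal_density_def s2 using assms by (simp add: field_simps)
  have "has_bochner_integral lborel (\<lambda>x. sqrt (pi / t) * (normal_density 0 \<sigma> x * x ^ (2 * k))) (sqrt (pi / t) * (fact (2 * k) / ((2 / \<sigma>\<^sup>2)^k * fact k)))"
    using normal_moment_even[OF \<open>\<sigma> > 0\<close>, of 0 k] by (intro has_bochner_integral_mult_right) auto
  moreover have "2 / \<sigma>\<^sup>2 = 4 * t" using assms by (simp add: s2)
  moreover have "sqrt (pi / t) * (normal_density 0 \<sigma> x * x ^ (2 * k)) = exp (- t * x\<^sup>2) * x ^ (2 * k)" for x
    unfolding nd using assms by simp
  ultimately show ?thesis by simp
qed

lemma gaussian_odd_moment: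
  fixes t :: real
  assumes "t > 0"
  shows "has_bochner_integral lborel (\<lambda>x. exp (- t * x\<^sup>2) * x ^ (2 * k + 1)) 0"
proof -
  define \<sigma> where "\<sigma> = 1 / sqrt (2 * t)"
  have s2: "\<sigma>\<^sup>2 = 1 / (2 * t)" and "\<sigma> > 0" using assms by (auto simp: \<sigma>_def power_divide)
  have nd: "normal_density 0 \<sigma> x = exp (- t * x\<^sup>2) / sqrt (pi / t)" for x
    unfolding normal_density_def s2 using assms by (simp add: field_simps)
  have "has_bochner_integral lborel (\<lambda>x. sqrt (pi / t) * (normal_density 0 \<sigma> x * x ^ (2 * k + 1))) (sqrt (pi / t) * 0)"
    using normal_moment_odd[OF \<open>\<sigma> > 0\<close>, of 0 k] by (intro has_bochner_integral_mult_right) auto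
  moreover have "sqrt (pi / t) * (normal_density 0 \<sigma> x * x ^ (2 * k + 1)) = exp (- t * x\<^sup>2) * x ^ (2 * k + 1)" for x
    unfolding nd using assms by simp
  ultimately show ?thesis by (simp only: mult_zero_right)
qed

text \<open>Substituting \<open>sqrt t * x\<close> gives the exponent \<open>- k / 2\<close> from
  the power and \<open>- 1 / 2\<close> from the measure. These moments occur only in error terms, so
  the constant stays unspecified.\<close>

lemma gaussian_abs_moment:   "\<exists>C\<ge>0. \<forall>t>0. has_bochner_integral lborel (\<lambda>x :: real. exp (- t * x\<^sup>2) * \<bar>x\<bar> ^ k) (C * t powr (- (real k + 1) / 2))"
proof -
  define g where "g = (\<lambda>x :: real. exp (- x\<^sup>2) * \<bar>x\<bar> ^ k)"
  have nd: "normal_density 0 (1 / sqrt 2) x = exp (- x\<^sup>2) / sqrt pi" for x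
    unfolding normal_density_def by (simp add: power_divide)
  have "integrable lborel (\<lambda>x. sqrt pi * (normal_density 0 (1 / sqrt 2) x * \<bar>x\<bar> ^ k))"
    using integrable_normal_moment_abs[of "1 / sqrt 2" 0 k] by (intro integrable_mult_right) auto
  then have g: "integrable lborel g" unfolding g_def nd by simp
  have "has_bochner_integral lborel (\<lambda>x. exp (- t * x\<^sup>2) * \<bar>x\<bar> ^ k) (integral\<^sup>L lborel g * t powr (- (real k + 1) / 2))"
    if t: "t > 0" for t
  proof -
    have "has_bochner_integral lborel (\<lambda>x. g (0 + sqrt t * x)) (integral\<^sup>L lborel g /\<^sub>R \<bar>sqrt t\<bar>)"
      by (rule lborel_has_bochner_integral_real_affine_iff[THEN iffD1]) (use t g in \<open>auto simp: has_bochner_integral_integrable\<close>)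
    then have "has_bochner_integral lborel (\<lambda>x. (1 / sqrt t ^ k) * g (0 + sqrt t * x)) ((1 / sqrt t ^ k) * (integral\<^sup>L lborel g /\<^sub>R \<bar>sqrt t\<bar>))"
      by (rule has_bochner_integral_mult_right)
    moreover have "(1 / sqrt t ^ k) * g (0 + sqrt t * x) = exp (- t * x\<^sup>2) * \<bar>x\<bar> ^ k" for x
      using t by (simp add: g_def power_mult_distrib abs_mult)
    moreover have "(1 / sqrt t ^ k) * (integral\<^sup>L lborel g /\<^sub>R \<bar>sqrt t\<bar>) = integral\<^sup>L lborel g * t powr (- (real k + 1) / 2)"
    proof -
      have "sqrt t ^ k * sqrt t = t powr ((real k + 1) / 2)"
        using t by (simp add: powr_half_sqrt[symmetric] powr_power powr_realpow[symmetric] powr_powr flip: powr_add) (simp add: add_divide_distrib)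
      moreover have "t powr (- (real k + 1) / 2) = inverse (t powr ((real k + 1) / 2))"
        by (simp only: minus_divide_left[symmetric] powr_minus)
      ultimately show ?thesis using t by (simp add: field_simps)
    qed
    ultimately show ?thesis by simp
  qed
  moreover have "integral\<^sup>L lborel g \<ge> 0" unfolding g_def by (intro Bochner_Integration.integral_nonneg) auto
  ultimately show ?thesis by blast
qed

section \<open>Moments in the plane as products of moments on the line\<close>

lemma Basis_real_2: "(Basis :: (real^2) set) = {axis 1 1, axis 2 1}"
  by (auto simp: Basis_vec_def) (metis exhaust_2)

lemma axis_1_neq_2: "axis 1 (1::real) \<noteq> (axis 2 1 :: real^2)"
  by (simp add: axis_eq_axis)

lemma has_bochner_integral_lborel_2:
  fixes f g :: "real \<Rightarrow> real"
  assumes f: "has_bochner_integral lborel f a" and g: "has_bochner_integral lborel g b"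
  shows "has_bochner_integral lborel (\<lambda>x :: real^2. f (x $ 1) * g (x $ 2)) (a * b)"
proof -
  \<comment> \<open>\<open>lborel\<close> on the plane is the image of a product measure indexed by
    the basis vectors, so the two factors are arranged as a family over
    \<open>Basis\<close>.\<close>
  define h where "h = (\<lambda>b :: real^2. if b = axis 1 1 then f else g)"
  interpret P: product_sigma_finite "\<lambda>b :: real^2. lborel :: real measure" ..
  have [measurable]: "f \<in> borel_measurable borel" "g \<in> borel_measurable borel"
    using f g by (auto simp: has_bochner_integral_iff dest: borel_measurable_integrable)
  have fin: "finite (Basis :: (real^2) set)" by simp
  have int: "integrable lborel (h i)" for i using f g by (auto simp: h_def has_bochner_integral_iff)
  have prodeq: "(\<Prod>i\<in>Basis. h i (x i)) = f (x (axis 1 1)) * g (x (axis 2 1))" for x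
    using axis_1_neq_2 by (simp add: Basis_real_2 h_def)
  have comp: "(\<Sum>b\<in>Basis. x b *\<^sub>R b) $ 1 = x (axis 1 1)" "(\<Sum>b\<in>Basis. x b *\<^sub>R b) $ 2 = x (axis 2 1)" for x :: "real^2 \<Rightarrow> real"
    using axis_1_neq_2 by (simp_all add: Basis_real_2) (simp_all add: axis_def)
  have "integrable (\<Pi>\<^sub>M b\<in>Basis. lborel) (\<lambda>x. \<Prod>i\<in>(Basis::(real^2) set). h i (x i))"
    by (rule P.product_integrable_prod) (use int in auto)
  moreover have "integral\<^sup>L (\<Pi>\<^sub>M b\<in>Basis. lborel) (\<lambda>x. \<Prod>i\<in>(Basis::(real^2) set). h i (x i)) = (\<Prod>i\<in>(Basis::(real^2) set). integral\<^sup>L lborel (h i))"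
    by (rule P.product_integral_prod) (use int in auto)
  moreover have "(\<Prod>i\<in>(Basis::(real^2) set). integral\<^sup>L lborel (h i)) = a * b"
    using f g axis_1_neq_2 by (simp add: Basis_real_2 h_def has_bochner_integral_iff)
  ultimately have "has_bochner_integral (\<Pi>\<^sub>M b\<in>(Basis::(real^2) set). lborel) (\<lambda>x. f (x (axis 1 1)) * g (x (axis 2 1))) (a * b)"
    unfolding prodeq by (simp add: has_bochner_integral_iff)
  then have "has_bochner_integral (\<Pi>\<^sub>M b\<in>(Basis::(real^2) set). lborel) (\<lambda>x. (\<lambda>x :: real^2. f (x $ 1) * g (x $ 2)) (\<Sum>b\<in>Basis. x b *\<^sub>R b)) (a * b)"
    by (simp only: comp)
  moreover have "(\<lambda>f. \<Sum>b\<in>Basis. f b *\<^sub>R b) \<in> measurable (\<Pi>\<^sub>M b\<in>(Basis::(real^2) set). lborel) borel"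
    by measurable
  moreover have "(\<lambda>x :: real^2. f (x $ 1) * g (x $ 2)) \<in> borel_measurable borel" by measurable
  ultimately show ?thesis
    by (subst lborel_eq, subst has_bochner_integral_distr) auto
qed

lemma norm_sq_2: "(norm (x :: real^2))\<^sup>2 = (x $ 1)\<^sup>2 + (x $ 2)\<^sup>2"
  by (simp add: norm_vec_def L2_set_def sum_2)

lemma gaussian_split_2: "exp (- t * (norm (x :: real^2))\<^sup>2) = exp (- t * (x$1)\<^sup>2) * exp (- t * (x$2)\<^sup>2)"
  unfolding norm_sq_2 mult_exp_exp by (simp add: algebra_simps)

lemma norm_power_le_2: "norm (x :: real^2) ^ k \<le> 2 ^ k * (\<bar>x $ 1\<bar> ^ k + \<bar>x $ 2\<bar> ^ k)"
proof -
  define m where "m = max \<bar>x $ 1\<bar> \<bar>x $ 2\<bar>"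
  have "norm x \<le> \<bar>x $ 1\<bar> + \<bar>x $ 2\<bar>" using norm_le_l1_cart[of x] by (simp add: sum_2)
  then have "norm x ^ k \<le> (2 * m) ^ k" by (intro power_mono) (auto simp: m_def)
  moreover have "m ^ k \<le> \<bar>x $ 1\<bar> ^ k + \<bar>x $ 2\<bar> ^ k" by (auto simp: m_def max_def)
  then have "(2 * m) ^ k \<le> 2 ^ k * (\<bar>x $ 1\<bar> ^ k + \<bar>x $ 2\<bar> ^ k)"
    by (simp add: power_mult_distrib)
  ultimately show ?thesis by linarith
qed

text \<open>Bounding the norm by the two coordinates separates the integral at the price of a
  constant. For error terms only the order in \<open>t\<close> matters.\<close>

lemma gaussian_norm_moment_2:
  "\<exists>D\<ge>0. \<forall>t>0. integrable lborel (\<lambda>x :: real^2. exp (- t * (norm x)\<^sup>2) * norm x ^ k) \<and>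
     (\<integral>x. exp (- t * (norm (x :: real^2))\<^sup>2) * norm x ^ k \<partial>lborel) \<le> D * t powr (- real k / 2 - 1)"
proof -
  obtain C where C: "C \<ge> 0"
    "\<And>t. t > 0 \<Longrightarrow> has_bochner_integral lborel (\<lambda>x. exp (- t * x\<^sup>2) * \<bar>x\<bar> ^ k) (C * t powr (- (real k + 1) / 2))"
    using gaussian_abs_moment[of k] by blast
  obtain E where E: "E \<ge> 0"
    "\<And>t. t > 0 \<Longrightarrow> has_bochner_integral lborel (\<lambda>x. exp (- t * x\<^sup>2) * \<bar>x\<bar> ^ 0) (E * t powr (- (real 0 + 1) / 2))"
    using gaussian_abs_moment[of 0] by blast
  define G where "G = (\<lambda>t (x::real^2). 2 ^ k * (exp (- t * (x$1)\<^sup>2) * \<bar>x$1\<bar> ^ k * (exp (- t * (x$2)\<^sup>2) * \<bar>x$2\<bar> ^ 0) + exp (- t * (x$1)\<^sup>2) * \<bar>x$1\<bar> ^ 0 * (exp (- t * (x$2)\<^sup>2) * \<bar>x$2\<bar> ^ k)))"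
  have hb: "has_bochner_integral lborel (G t) (2^k * (C * t powr (- (real k + 1) / 2) * (E * t powr (- (real 0 + 1) / 2)) + E * t powr (- (real 0 + 1) / 2) * (C * t powr (- (real k + 1) / 2))))"
    if "t > 0" for t
    unfolding G_def
    by (rule has_bochner_integral_mult_right,
        rule has_bochner_integral_add[OF has_bochner_integral_lborel_2[OF C(2)[OF that] E(2)[OF that]] has_bochner_integral_lborel_2[OF E(2)[OF that] C(2)[OF that]]])
  have le: "exp (- t * (norm x)\<^sup>2) * norm x ^ k \<le> G t x" for t and x :: "real^2"
  proof -
    define u v where "u = exp (- t * (x$1)\<^sup>2)" and "v = exp (- t * (x$2)\<^sup>2)"
    have "u * v * norm x ^ k \<le> u * v * (2 ^ k * (\<bar>x $ 1\<bar> ^ k + \<bar>x $ 2\<bar> ^ k))"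
      by (rule mult_left_mono[OF norm_power_le_2]) (simp add: u_def v_def)
    also have "\<dots> = G t x"
      unfolding G_def u_def[symmetric] v_def[symmetric] by (simp add: algebra_simps)
    finally show ?thesis unfolding gaussian_split_2 u_def v_def .
  qed
  have nle: "norm (exp (- t * (norm x)\<^sup>2) * norm x ^ k) \<le> norm (G t x)" for t and x :: "real^2"
    using le[of t x] by simp
  have int: "integrable lborel (\<lambda>x :: real^2. exp (- t * (norm x)\<^sup>2) * norm x ^ k)" if "t > 0" for t
    by (rule Bochner_Integration.integrable_bound[OF integrable.intros[OF hb[OF that]]]) (use nle in auto)
  have "(\<integral>x. exp (- t * (norm (x :: real^2))\<^sup>2) * norm x ^ k \<partial>lborel) \<le> (2^k * (2 * C * E)) * t powr (- real k / 2 - 1)" if "t > 0" for t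
  proof -
    have pw: "t powr (- (real k + 1) / 2) * t powr (- (real 0 + 1) / 2) = t powr (- real k / 2 - 1)"
      by (subst powr_add[symmetric], rule arg_cong[where f = "\<lambda>e. t powr e"]) (simp add: field_simps)
    have "(\<integral>x. exp (- t * (norm (x :: real^2))\<^sup>2) * norm x ^ k \<partial>lborel) \<le> integral\<^sup>L lborel (G t)"
      by (intro integral_mono int that integrable.intros[OF hb] le)
    also have "\<dots> = (2^k * (2 * C * E)) * (t powr (- (real k + 1) / 2) * t powr (- (real 0 + 1) / 2))"
      using has_bochner_integral_integral_eq[OF hb[OF that]] by (simp add: algebra_simps)
    finally show ?thesis unfolding pw .
  qed
  then show ?thesis
    by (intro exI[of _ "2^k * (2 * C * E)"] conjI allI impI int) (simp_all add: C(1) E(1))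
qed

text \<open>For the graph of \<open>h = Q / 2\<close> the factor
  \<open>exp (- t * h\<^sup>2)\<close> contributes \<open>- t * Q\<^sup>2 / 4\<close> to leading
  order, and the area factor \<open>sqrt (1 + S)\<close> contributes \<open>S / 2\<close>, because
  \<open>S\<close> is the squared gradient of \<open>Q / 2\<close>. In units of pi / (16 t^2) the
  fourth moments give - (3 a^2 + 4 b^2 + 2 a c + 3 c^2) and the second moments give 4 (a^2 + 2 b^2 +
  c^2); the sum is (a - c)^2 + 4 b^2.\<close>

lemma gaussian_quartic_main_term:
  fixes a b c t :: real
  assumes t: "t > 0"
  defines "Q \<equiv> \<lambda>x :: real^2. a * (x$1)\<^sup>2 + 2 * b * (x$1) * (x$2) + c * (x$2)\<^sup>2"
    and "S \<equiv> \<lambda>x :: real^2. (a * x$1 + b * x$2)\<^sup>2 + (b * x$1 + c * x$2)\<^sup>2"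
  shows "has_bochner_integral lborel (\<lambda>x. exp (- t * (norm x)\<^sup>2) * (1 - t * (Q x)\<^sup>2 / 4 + S x / 2))
    (pi / t + pi / 16 * ((a - c)\<^sup>2 + 4 * b\<^sup>2) / t\<^sup>2)"
proof -
  define m where "m = (\<lambda>i j (x::real^2). (exp (- t * (x$1)\<^sup>2) * (x$1) ^ i) * (exp (- t * (x$2)\<^sup>2) * (x$2) ^ j))"
  define e where "e = (\<lambda>k :: nat. sqrt (pi / t) * (fact (2 * k) / ((4 * t) ^ k * fact k)))"
  have ev: "has_bochner_integral lborel (\<lambda>x. exp (- t * x\<^sup>2) * x ^ i) (e k)" if "i = 2 * k" for i k
    unfolding that e_def by (rule gaussian_even_moment[OF t])
  have od: "has_bochner_integral lborel (\<lambda>x. exp (- t * x\<^sup>2) * x ^ i) 0" if "i = 2 * k + 1" for i k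
    unfolding that by (rule gaussian_odd_moment[OF t])
  have mI: "has_bochner_integral lborel (m i j) (u * v)"
    if "has_bochner_integral lborel (\<lambda>x. exp (- t * x\<^sup>2) * x ^ i) u" "has_bochner_integral lborel (\<lambda>x. exp (- t * x\<^sup>2) * x ^ j) v" for i j u v
    unfolding m_def by (rule has_bochner_integral_lborel_2[OF that])
  have mm: "has_bochner_integral lborel (m 0 0) (e 0 * e 0)"
    "has_bochner_integral lborel (m 2 0) (e 1 * e 0)" "has_bochner_integral lborel (m 0 2) (e 0 * e 1)"
    "has_bochner_integral lborel (m 4 0) (e 2 * e 0)" "has_bochner_integral lborel (m 0 4) (e 0 * e 2)"
    "has_bochner_integral lborel (m 2 2) (e 1 * e 1)"
    "has_bochner_integral lborel (m 1 1) (0 * 0)" "has_bochner_integral lborel (m 3 1) (0 * 0)" "has_bochner_integral lborel (m 1 3) (0 * 0)"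
    by (rule mI; (rule ev od[where k = 0] od[where k = 1]; simp; fail))+
  have "has_bochner_integral lborel (\<lambda>x. m 0 0 x
     + (- t / 4 * (a\<^sup>2)) * m 4 0 x + (- t / 4 * (4 * a * b)) * m 3 1 x + (- t / 4 * (4 * b\<^sup>2 + 2 * a * c)) * m 2 2 x
     + (- t / 4 * (4 * b * c)) * m 1 3 x + (- t / 4 * c\<^sup>2) * m 0 4 x
     + ((a\<^sup>2 + b\<^sup>2) / 2) * m 2 0 x + (b * (a + c)) * m 1 1 x + ((b\<^sup>2 + c\<^sup>2) / 2) * m 0 2 x)
    (e 0 * e 0
     + (- t / 4 * (a\<^sup>2)) * (e 2 * e 0) + (- t / 4 * (4 * a * b)) * (0 * 0) + (- t / 4 * (4 * b\<^sup>2 + 2 * a * c)) * (e 1 * e 1)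
     + (- t / 4 * (4 * b * c)) * (0 * 0) + (- t / 4 * c\<^sup>2) * (e 0 * e 2)
     + ((a\<^sup>2 + b\<^sup>2) / 2) * (e 1 * e 0) + (b * (a + c)) * (0 * 0) + ((b\<^sup>2 + c\<^sup>2) / 2) * (e 0 * e 1))"
    by (intro has_bochner_integral_add has_bochner_integral_mult_right mm)
  moreover have "m 0 0 x
     + (- t / 4 * (a\<^sup>2)) * m 4 0 x + (- t / 4 * (4 * a * b)) * m 3 1 x + (- t / 4 * (4 * b\<^sup>2 + 2 * a * c)) * m 2 2 x
     + (- t / 4 * (4 * b * c)) * m 1 3 x + (- t / 4 * c\<^sup>2) * m 0 4 x
     + ((a\<^sup>2 + b\<^sup>2) / 2) * m 2 0 x + (b * (a + c)) * m 1 1 x + ((b\<^sup>2 + c\<^sup>2) / 2) * m 0 2 x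
     = exp (- t * (norm x)\<^sup>2) * (1 - t * (Q x)\<^sup>2 / 4 + S x / 2)" for x
    unfolding gaussian_split_2 Q_def S_def m_def by algebra
  moreover have "e 0 * e 0
     + (- t / 4 * (a\<^sup>2)) * (e 2 * e 0) + (- t / 4 * (4 * a * b)) * (0 * 0) + (- t / 4 * (4 * b\<^sup>2 + 2 * a * c)) * (e 1 * e 1)
     + (- t / 4 * (4 * b * c)) * (0 * 0) + (- t / 4 * c\<^sup>2) * (e 0 * e 2)
     + ((a\<^sup>2 + b\<^sup>2) / 2) * (e 1 * e 0) + (b * (a + c)) * (0 * 0) + ((b\<^sup>2 + c\<^sup>2) / 2) * (e 0 * e 1)
     = pi / t + pi / 16 * ((a - c)\<^sup>2 + 4 * b\<^sup>2) / t\<^sup>2"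
  proof -
    define s where "s = sqrt (pi / t)"
    have s: "s * s = pi / t" using t by (simp add: s_def)
    have e0: "e 0 = s" "e 1 = s / (2 * t)" "e 2 = 3 * s / (4 * t\<^sup>2)"
      by (simp_all add: e_def s_def power2_eq_square fact_numeral)
    have ee: "e 0 * e 0 = pi / t" "e 2 * e 0 = pi / t * 3 / (4 * t\<^sup>2)" "e 0 * e 2 = pi / t * 3 / (4 * t\<^sup>2)"
      "e 1 * e 1 = pi / t / (4 * t\<^sup>2)" "e 1 * e 0 = pi / t / (2 * t)" "e 0 * e 1 = pi / t / (2 * t)"
      unfolding s[symmetric] e0 by (simp_all add: power2_eq_square)
    show ?thesis unfolding ee using t by (simp add: field_simps power2_eq_square)
  qed
  ultimately show ?thesis by simp
qed


section \<open>Pointwise expansion of the Gaussian integrand\<close>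

lemma exp_minus_taylor_2:
  fixes y :: real
  assumes "y \<ge> 0"
  shows "\<bar>exp (- y) - 1 + y\<bar> \<le> y\<^sup>2"
proof -
  have 1: "1 - y \<le> exp (- y)" using exp_ge_add_one_self[of "- y"] by simp
  have "exp (- y) \<le> 1 - y + y\<^sup>2"
  proof -
    have "1 + y \<le> exp y" by (rule exp_ge_add_one_self)
    then have "exp (- y) \<le> 1 / (1 + y)" using assms by (simp add: exp_minus field_simps)
    also have "\<dots> \<le> 1 - y + y\<^sup>2" using assms by (simp add: field_simps power2_eq_square)
    finally show ?thesis .
  qed
  with 1 show ?thesis by simp
qed

lemma quadratic_form_bound_2:
  fixes x :: "real^2"
  assumes "\<bar>a\<bar> \<le> K" "\<bar>b\<bar> \<le> K" "\<bar>c\<bar> \<le> K"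
  shows "\<bar>a * (x$1)\<^sup>2 + 2 * b * (x$1) * (x$2) + c * (x$2)\<^sup>2\<bar> \<le> 2 * K * (norm x)\<^sup>2"
proof -
  have "2 * \<bar>x$1\<bar> * \<bar>x$2\<bar> \<le> (x$1)\<^sup>2 + (x$2)\<^sup>2"
    using zero_le_power2[of "\<bar>x$1\<bar> - \<bar>x$2\<bar>"] by (simp add: power2_diff)
  then have "\<bar>b\<bar> * (2 * \<bar>x$1\<bar> * \<bar>x$2\<bar>) \<le> K * ((x$1)\<^sup>2 + (x$2)\<^sup>2)"
    using assms by (intro mult_mono) auto
  moreover have "\<bar>a\<bar> * (x$1)\<^sup>2 \<le> K * (x$1)\<^sup>2" "\<bar>c\<bar> * (x$2)\<^sup>2 \<le> K * (x$2)\<^sup>2"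
    using assms by (auto intro!: mult_right_mono)
  moreover have "\<bar>a * (x$1)\<^sup>2 + 2 * b * (x$1) * (x$2) + c * (x$2)\<^sup>2\<bar> \<le> \<bar>a\<bar> * (x$1)\<^sup>2 + \<bar>b\<bar> * (2 * \<bar>x$1\<bar> * \<bar>x$2\<bar>) + \<bar>c\<bar> * (x$2)\<^sup>2"
    using abs_triangle_ineq[of "a * (x$1)\<^sup>2 + 2 * b * (x$1) * (x$2)" "c * (x$2)\<^sup>2"] abs_triangle_ineq[of "a * (x$1)\<^sup>2" "2 * b * (x$1) * (x$2)"]
    by (simp add: abs_mult mult_ac)
  ultimately show ?thesis unfolding norm_sq_2 by (simp add: algebra_simps)
qed

text \<open>The error monomials are chosen for their Gaussian integrals over the plane:
  \<open>x ^ 3\<close> and \<open>t * x ^ 5\<close> give the order \<open>t powr (-5/2)\<close>, and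
  \<open>t\<^sup>2 * x ^ 8\<close> gives \<open>t powr (-3)\<close>. The difference is telescoped
  into the exponential remainder times \<open>w\<close>, the remainder of \<open>w\<close>, the
  cross term \<open>t * h\<^sup>2 * (w - 1)\<close> and the replacement of \<open>h\<close> by
  \<open>q / 2\<close>; the constant is the sum of the four bounds.\<close>

lemma gaussian_integrand_expansion:
  fixes K x q S h w t :: real
  assumes K: "K \<ge> 0" and x: "0 \<le> x" "x \<le> 1" and t: "t \<ge> 0"
    and q: "\<bar>q\<bar> \<le> 2 * K * x\<^sup>2" and S: "\<bar>S\<bar> \<le> 4 * K\<^sup>2 * x\<^sup>2"
    and h: "\<bar>h - q / 2\<bar> \<le> K * x ^ 3" and w: "\<bar>w - 1 - S / 2\<bar> \<le> K * x ^ 3"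
  shows "\<bar>exp (- t * h\<^sup>2) * w - (1 - t * q\<^sup>2 / 4 + S / 2)\<bar> \<le>
    (16 * K ^ 4 * (1 + 2 * K\<^sup>2 + K) + K + 4 * K\<^sup>2 * (2 * K\<^sup>2 + K) + 3 * K\<^sup>2) * (x ^ 3 + t * x ^ 5 + t\<^sup>2 * x ^ 8)"
proof -
  have x32: "x ^ 3 \<le> x ^ 2" and x65: "x ^ 6 \<le> x ^ 5" using x by (auto intro: power_decreasing)
  have Kx: "K * x ^ 3 \<le> K * x\<^sup>2" using x32 K by (rule mult_left_mono)
  have h2: "\<bar>h\<bar> \<le> 2 * K * x\<^sup>2" using h q Kx by linarith
  have hh: "h\<^sup>2 \<le> 4 * K\<^sup>2 * x ^ 4"
  proof -
    have "\<bar>h\<bar>\<^sup>2 \<le> (2 * K * x\<^sup>2)\<^sup>2" using h2 by (intro power_mono) auto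
    then show ?thesis by (simp add: power_mult_distrib flip: power_mult)
  qed
  have w1: "\<bar>w - 1\<bar> \<le> (2 * K\<^sup>2 + K) * x\<^sup>2"
    using w S Kx by (simp add: distrib_right)
  have "(2 * K\<^sup>2 + K) * x\<^sup>2 \<le> (2 * K\<^sup>2 + K) * 1"
    using x K by (intro mult_left_mono) (auto simp: power_le_one)
  then have "\<bar>w - 1\<bar> \<le> 2 * K\<^sup>2 + K" using w1 by simp
  then have wb: "\<bar>w\<bar> \<le> 1 + 2 * K\<^sup>2 + K" by linarith
  have e: "\<bar>exp (- (t * h\<^sup>2)) - 1 + t * h\<^sup>2\<bar> \<le> 16 * K ^ 4 * (t\<^sup>2 * x ^ 8)"
  proof -
    have "\<bar>exp (- (t * h\<^sup>2)) - 1 + t * h\<^sup>2\<bar> \<le> (t * h\<^sup>2)\<^sup>2" using t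
      by (intro exp_minus_taylor_2) auto
    also have "\<dots> \<le> (t * (4 * K\<^sup>2 * x ^ 4))\<^sup>2" using hh t by (intro power_mono mult_left_mono) auto
    finally show ?thesis by (simp add: power_mult_distrib algebra_simps flip: power_mult)
  qed
  have p1: "\<bar>(exp (- (t * h\<^sup>2)) - 1 + t * h\<^sup>2) * w\<bar> \<le> 16 * K ^ 4 * (1 + 2 * K\<^sup>2 + K) * (t\<^sup>2 * x ^ 8)"
  proof -
    have "\<bar>(exp (- (t * h\<^sup>2)) - 1 + t * h\<^sup>2) * w\<bar> \<le> (16 * K ^ 4 * (t\<^sup>2 * x ^ 8)) * (1 + 2 * K\<^sup>2 + K)"
      unfolding abs_mult using e wb K by (intro mult_mono) auto
    then show ?thesis by (simp add: mult_ac)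
  qed
  have p3: "\<bar>t * h\<^sup>2 * (w - 1)\<bar> \<le> 4 * K\<^sup>2 * (2 * K\<^sup>2 + K) * (t * x ^ 5)"
  proof -
    have "\<bar>t * h\<^sup>2 * (w - 1)\<bar> \<le> (t * (4 * K\<^sup>2 * x ^ 4)) * ((2 * K\<^sup>2 + K) * x\<^sup>2)"
      unfolding abs_mult using hh w1 t by (intro mult_mono) auto
    also have "\<dots> = 4 * K\<^sup>2 * (2 * K\<^sup>2 + K) * t * x ^ 6" by (simp add: algebra_simps flip: power_add)
    also have "\<dots> \<le> 4 * K\<^sup>2 * (2 * K\<^sup>2 + K) * t * x ^ 5" using x65 K t
      by (intro mult_left_mono) auto
    finally show ?thesis by (simp add: mult_ac)
  qed
  have p4: "\<bar>t * (h\<^sup>2 - q\<^sup>2 / 4)\<bar> \<le> 3 * K\<^sup>2 * (t * x ^ 5)"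
  proof -
    have "\<bar>(h - q / 2) * (h + q / 2)\<bar> \<le> (K * x ^ 3) * (3 * K * x\<^sup>2)"
      unfolding abs_mult using h h2 q by (intro mult_mono) auto
    moreover have "(h - q / 2) * (h + q / 2) = h\<^sup>2 - q\<^sup>2 / 4" by (simp add: power2_eq_square algebra_simps)
    moreover have "(K * x ^ 3) * (3 * K * x\<^sup>2) = 3 * K\<^sup>2 * x ^ 5"
      by (simp add: power2_eq_square eval_nat_numeral algebra_simps)
    ultimately have "t * \<bar>h\<^sup>2 - q\<^sup>2 / 4\<bar> \<le> t * (3 * K\<^sup>2 * x ^ 5)" using t
      by (intro mult_left_mono) auto
    then show ?thesis using t by (simp add: abs_mult mult_ac)
  qed
  define X where "X = x ^ 3 + t * x ^ 5 + t\<^sup>2 * x ^ 8"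
  have X: "x ^ 3 \<le> X" "t * x ^ 5 \<le> X" "t\<^sup>2 * x ^ 8 \<le> X" using x t by (auto simp: X_def)
  define A where "A = (exp (- (t * h\<^sup>2)) - 1 + t * h\<^sup>2) * w"
  define B where "B = t * h\<^sup>2 * (w - 1)"
  define C where "C = t * (h\<^sup>2 - q\<^sup>2 / 4)"
  define D where "D = w - 1 - S / 2"
  have "exp (- t * h\<^sup>2) * w - (1 - t * q\<^sup>2 / 4 + S / 2) = A + D - B - C"
    by (simp add: A_def B_def C_def D_def algebra_simps)
  then have "\<bar>exp (- t * h\<^sup>2) * w - (1 - t * q\<^sup>2 / 4 + S / 2)\<bar> \<le> \<bar>A\<bar> + \<bar>D\<bar> + \<bar>B\<bar> + \<bar>C\<bar>"
    by arith
  also have "\<dots> \<le> 16 * K ^ 4 * (1 + 2 * K\<^sup>2 + K) * (t\<^sup>2 * x ^ 8) + K * x ^ 3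
      + 4 * K\<^sup>2 * (2 * K\<^sup>2 + K) * (t * x ^ 5) + 3 * K\<^sup>2 * (t * x ^ 5)"
    unfolding A_def B_def C_def D_def by (intro add_mono p1 w p3 p4)
  also have "\<dots> \<le> 16 * K ^ 4 * (1 + 2 * K\<^sup>2 + K) * X + K * X + 4 * K\<^sup>2 * (2 * K\<^sup>2 + K) * X + 3 * K\<^sup>2 * X"
    using X K by (intro add_mono mult_left_mono) auto
  also have "\<dots> = (16 * K ^ 4 * (1 + 2 * K\<^sup>2 + K) + K + 4 * K\<^sup>2 * (2 * K\<^sup>2 + K) + 3 * K\<^sup>2) * X"
    by (simp only: distrib_right)
  finally show ?thesis unfolding X_def .
qed

text \<open>Outside \<open>U\<close> we have \<open>norm x \<ge> \<rho>\<close>, so the main term is itself dominated by the error term there.\<close>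
lemma gaussian_graph_asymptotics:
  fixes K \<rho> :: real
  assumes \<rho>: "0 < \<rho>" and K: "0 \<le> K"
  shows "\<exists>C. \<forall>U h w a b c t. t \<ge> 1 \<longrightarrow> ball 0 \<rho> \<subseteq> U \<longrightarrow> U \<subseteq> ball (0 :: real^2) 1 \<longrightarrow>
     \<bar>a\<bar> \<le> K \<longrightarrow> \<bar>b\<bar> \<le> K \<longrightarrow> \<bar>c\<bar> \<le> K \<longrightarrow>
     (\<forall>x\<in>U. \<bar>h x - (a * (x$1)\<^sup>2 + 2 * b * (x$1) * (x$2) + c * (x$2)\<^sup>2) / 2\<bar> \<le> K * norm x ^ 3) \<longrightarrow>
     (\<forall>x\<in>U. \<bar>w x - 1 - ((a * x$1 + b * x$2)\<^sup>2 + (b * x$1 + c * x$2)\<^sup>2) / 2\<bar> \<le> K * norm x ^ 3) \<longrightarrow>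
     (\<lambda>x. indicator U x * (exp (- t * ((norm x)\<^sup>2 + (h x)\<^sup>2)) * w x)) \<in> borel_measurable lborel \<longrightarrow>
     \<bar>(\<integral>x. indicator U x * (exp (- t * ((norm x)\<^sup>2 + (h x)\<^sup>2)) * w x) \<partial>lborel) - (pi / t + pi / 16 * ((a - c)\<^sup>2 + 4 * b\<^sup>2) / t\<^sup>2)\<bar>
       \<le> C * t powr (-5/2)"
proof -
  define C1 where "C1 = 16 * K ^ 4 * (1 + 2 * K\<^sup>2 + K) + K + 4 * K\<^sup>2 * (2 * K\<^sup>2 + K) + 3 * K\<^sup>2"
  \<comment> \<open>The last three summands serve the region outside \<open>U\<close>, where
    \<open>norm x / \<rho>\<close> is at least 1: its cube bounds the constant 1, and a single
    factor raises \<open>Q\<^sup>2\<close> and \<open>S\<close> to the degrees of the error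
    monomials.\<close>
  define C2 where "C2 = C1 + 1 / \<rho> ^ 3 + K\<^sup>2 / \<rho> + 2 * K\<^sup>2 / \<rho>"
  have C1: "C1 \<ge> 0" unfolding C1_def using K by simp
  have C2: "C2 \<ge> 0" unfolding C2_def using K C1 \<rho> by simp
  obtain D3 where D3: "D3 \<ge> 0" "\<And>t. t > 0 \<Longrightarrow> integrable lborel (\<lambda>x :: real^2. exp (- t * (norm x)\<^sup>2) * norm x ^ 3)"
    "\<And>t. t > 0 \<Longrightarrow> (\<integral>x. exp (- t * (norm (x :: real^2))\<^sup>2) * norm x ^ 3 \<partial>lborel) \<le> D3 * t powr (- real 3 / 2 - 1)"
    using gaussian_norm_moment_2[of 3] by blast
  obtain D5 where D5: "D5 \<ge> 0" "\<And>t. t > 0 \<Longrightarrow> integrable lborel (\<lambda>x :: real^2. exp (- t * (norm x)\<^sup>2) * norm x ^ 5)"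
    "\<And>t. t > 0 \<Longrightarrow> (\<integral>x. exp (- t * (norm (x :: real^2))\<^sup>2) * norm x ^ 5 \<partial>lborel) \<le> D5 * t powr (- real 5 / 2 - 1)"
    using gaussian_norm_moment_2[of 5] by blast
  obtain D8 where D8: "D8 \<ge> 0" "\<And>t. t > 0 \<Longrightarrow> integrable lborel (\<lambda>x :: real^2. exp (- t * (norm x)\<^sup>2) * norm x ^ 8)"
    "\<And>t. t > 0 \<Longrightarrow> (\<integral>x. exp (- t * (norm (x :: real^2))\<^sup>2) * norm x ^ 8 \<partial>lborel) \<le> D8 * t powr (- real 8 / 2 - 1)"
    using gaussian_norm_moment_2[of 8] by blast
  show ?thesis
  proof (intro exI allI impI)
    fix U :: "(real^2) set" and h w :: "real^2 \<Rightarrow> real" and a b c t :: real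
    assume t: "t \<ge> 1" and U: "ball 0 \<rho> \<subseteq> U" "U \<subseteq> ball 0 1" and abc: "\<bar>a\<bar> \<le> K" "\<bar>b\<bar> \<le> K" "\<bar>c\<bar> \<le> K"
      and h: "\<forall>x\<in>U. \<bar>h x - (a * (x$1)\<^sup>2 + 2 * b * (x$1) * (x$2) + c * (x$2)\<^sup>2) / 2\<bar> \<le> K * norm x ^ 3"
      and w: "\<forall>x\<in>U. \<bar>w x - 1 - ((a * x$1 + b * x$2)\<^sup>2 + (b * x$1 + c * x$2)\<^sup>2) / 2\<bar> \<le> K * norm x ^ 3"
      and meas: "(\<lambda>x. indicator U x * (exp (- t * ((norm x)\<^sup>2 + (h x)\<^sup>2)) * w x)) \<in> borel_measurable lborel"
    define Q where "Q = (\<lambda>x :: real^2. a * (x$1)\<^sup>2 + 2 * b * (x$1) * (x$2) + c * (x$2)\<^sup>2)"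
    define S where "S = (\<lambda>x :: real^2. (a * x$1 + b * x$2)\<^sup>2 + (b * x$1 + c * x$2)\<^sup>2)"
    define F where "F = (\<lambda>x. indicator U x * (exp (- t * ((norm x)\<^sup>2 + (h x)\<^sup>2)) * w x))"
    define G where "G = (\<lambda>x :: real^2. exp (- t * (norm x)\<^sup>2) * (1 - t * (Q x)\<^sup>2 / 4 + S x / 2))"
    define E where "E = (\<lambda>x :: real^2. C2 * (exp (- t * (norm x)\<^sup>2) * norm x ^ 3 + t * (exp (- t * (norm x)\<^sup>2) * norm x ^ 5) + t\<^sup>2 * (exp (- t * (norm x)\<^sup>2) * norm x ^ 8)))"
    have t0: "t > 0" using t by simp
    have G: "has_bochner_integral lborel G (pi / t + pi / 16 * ((a - c)\<^sup>2 + 4 * b\<^sup>2) / t\<^sup>2)"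
      unfolding G_def Q_def S_def by (rule gaussian_quartic_main_term[OF t0])
    have E: "integrable lborel E" unfolding E_def
      by (intro integrable_mult_right Bochner_Integration.integrable_add D3(2) D5(2) D8(2) t0)
    have Qb: "\<bar>Q x\<bar> \<le> 2 * K * (norm x)\<^sup>2" for x unfolding Q_def
      by (rule quadratic_form_bound_2[OF abc])
    have Sb: "\<bar>S x\<bar> \<le> 4 * K\<^sup>2 * (norm x)\<^sup>2" for x
    proof -
      have lin: "(u * x$1 + v * x$2)\<^sup>2 \<le> 2 * K\<^sup>2 * (norm x)\<^sup>2" if "\<bar>u\<bar> \<le> K" "\<bar>v\<bar> \<le> K" for u v
      proof -
        have "(u * x$1 + v * x$2)\<^sup>2 \<le> 2 * (u\<^sup>2 * (x$1)\<^sup>2 + v\<^sup>2 * (x$2)\<^sup>2)"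
          using zero_le_power2[of "u * x$1 - v * x$2"] by (simp add: power2_eq_square algebra_simps)
        also have "\<dots> \<le> 2 * (K\<^sup>2 * (x$1)\<^sup>2 + K\<^sup>2 * (x$2)\<^sup>2)"
          using that by (intro mult_left_mono add_mono mult_right_mono) (use K in \<open>auto simp: abs_le_square_iff[symmetric]\<close>)
        finally show ?thesis unfolding norm_sq_2 by (simp add: algebra_simps)
      qed
      show ?thesis using lin[OF abc(1,2)] lin[OF abc(2,3)] by (simp add: S_def)
    qed
    have bound: "\<bar>F x - G x\<bar> \<le> E x" for x
    proof -
      define X where "X = norm x ^ 3 + t * norm x ^ 5 + t\<^sup>2 * norm x ^ 8"
      have X: "0 \<le> X" "norm x ^ 3 \<le> X" "t * norm x ^ 5 \<le> X" using t0 by (auto simp: X_def)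
      \<comment> \<open>Outside \<open>U\<close> the integrand is zero, so there \<open>Y\<close> is
        minus the whole main term; both cases are compared with the same multiple of
        \<open>X\<close>.\<close>
      define Y where "Y = (if x \<in> U then exp (- t * (h x)\<^sup>2) * w x else 0) - (1 - t * (Q x)\<^sup>2 / 4 + S x / 2)"
      have Y: "\<bar>Y\<bar> \<le> C2 * X"
      proof (cases "x \<in> U")
        case True
        then have "norm x \<le> 1" using U by auto
        then have "\<bar>exp (- t * (h x)\<^sup>2) * w x - (1 - t * (Q x)\<^sup>2 / 4 + S x / 2)\<bar> \<le> C1 * X"
          unfolding C1_def X_def using h w True t0
          by (intro gaussian_integrand_expansion K Qb Sb) (auto simp: Q_def S_def)
        also have "\<dots> \<le> C2 * X" using X \<rho> K by (intro mult_right_mono) (auto simp: C2_def)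
        finally show ?thesis using True by (simp add: Y_def)
      next
        case False
        then have x\<rho>: "\<rho> \<le> norm x" using U by (auto simp: not_less[symmetric])
        then have r: "1 \<le> norm x / \<rho>" using \<rho> by simp
        have "1 \<le> (norm x / \<rho>) ^ 3" using r by (rule one_le_power)
        then have a1: "1 \<le> 1 / \<rho> ^ 3 * norm x ^ 3" by (simp add: power_divide)
        have a2: "t * (Q x)\<^sup>2 / 4 \<le> K\<^sup>2 / \<rho> * (t * norm x ^ 5)"
        proof -
          have "(Q x)\<^sup>2 \<le> (2 * K * (norm x)\<^sup>2)\<^sup>2" using power_mono[OF Qb[of x], of 2] by simp
          then have "(Q x)\<^sup>2 / 4 \<le> K\<^sup>2 * norm x ^ 4" by (simp add: power_mult_distrib flip: power_mult)
          also have "\<dots> \<le> K\<^sup>2 * norm x ^ 4 * (norm x / \<rho>)"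
            using mult_left_mono[OF r, of "K\<^sup>2 * norm x ^ 4"] by simp
          finally have "t * ((Q x)\<^sup>2 / 4) \<le> t * (K\<^sup>2 * norm x ^ 4 * (norm x / \<rho>))" using t0
            by (intro mult_left_mono) auto
          then show ?thesis by (simp add: eval_nat_numeral mult_ac)
        qed
        have a3: "\<bar>S x / 2\<bar> \<le> 2 * K\<^sup>2 / \<rho> * norm x ^ 3"
        proof -
          have "\<bar>S x / 2\<bar> \<le> 2 * K\<^sup>2 * (norm x)\<^sup>2" using Sb[of x] by simp
          also have "\<dots> \<le> 2 * K\<^sup>2 * (norm x)\<^sup>2 * (norm x / \<rho>)"
            using mult_left_mono[OF r, of "2 * K\<^sup>2 * (norm x)\<^sup>2"] by simp
          finally show ?thesis by (simp add: eval_nat_numeral mult_ac)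
        qed
        have "\<bar>1 - t * (Q x)\<^sup>2 / 4 + S x / 2\<bar> \<le> 1 + t * (Q x)\<^sup>2 / 4 + \<bar>S x / 2\<bar>"
        proof -
          have "0 \<le> t * (Q x)\<^sup>2 / 4" using t0 by simp
          then show ?thesis by linarith
        qed
        also have "\<dots> \<le> 1 / \<rho> ^ 3 * norm x ^ 3 + K\<^sup>2 / \<rho> * (t * norm x ^ 5) + 2 * K\<^sup>2 / \<rho> * norm x ^ 3"
          by (intro add_mono a1 a2 a3)
        also have "\<dots> \<le> 1 / \<rho> ^ 3 * X + K\<^sup>2 / \<rho> * X + 2 * K\<^sup>2 / \<rho> * X"
          using X \<rho> by (intro add_mono mult_left_mono) auto
        also have "\<dots> = (C2 - C1) * X" unfolding C2_def by (simp add: distrib_right)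
        also have "\<dots> \<le> C2 * X" using C1 X by (intro mult_right_mono) auto
        finally show ?thesis using False unfolding Y_def by (simp add: abs_minus_commute)
      qed
      have ex: "exp (- t * ((norm x)\<^sup>2 + (h x)\<^sup>2)) = exp (- t * (norm x)\<^sup>2) * exp (- t * (h x)\<^sup>2)"
        by (simp add: mult_exp_exp ring_distribs)
      have "F x - G x = exp (- t * (norm x)\<^sup>2) * Y"
        unfolding F_def G_def ex Y_def by (simp add: indicator_def right_diff_distrib)
      then have "\<bar>F x - G x\<bar> = exp (- t * (norm x)\<^sup>2) * \<bar>Y\<bar>" by (simp add: abs_mult)
      also have "\<dots> \<le> exp (- t * (norm x)\<^sup>2) * (C2 * X)"
        using Y by (intro mult_left_mono) auto
      also have "\<dots> = E x" unfolding E_def X_def by (simp add: algebra_simps)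
      finally show ?thesis .
    qed
    have Fm: "F \<in> borel_measurable lborel" using meas unfolding F_def .
    have FG: "integrable lborel (\<lambda>x. F x - G x)"
    proof (rule Bochner_Integration.integrable_bound[OF E])
      show "(\<lambda>x. F x - G x) \<in> borel_measurable lborel"
        by (intro borel_measurable_diff Fm borel_measurable_has_bochner_integral[OF G])
      show "AE x in lborel. norm (F x - G x) \<le> norm (E x)"
        using order_trans[OF bound abs_ge_self] by (intro AE_I2) simp
    qed
    have Fi: "integrable lborel F"
      using Bochner_Integration.integrable_add[OF FG integrable.intros[OF G]] by simp
    have "\<bar>integral\<^sup>L lborel F - integral\<^sup>L lborel G\<bar> = \<bar>\<integral>x. F x - G x \<partial>lborel\<bar>"
      by (simp add: Bochner_Integration.integral_diff[OF Fi integrable.intros[OF G]])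
    also have "\<dots> \<le> (\<integral>x. \<bar>F x - G x\<bar> \<partial>lborel)" by (rule integral_abs_bound)
    also have "\<dots> \<le> integral\<^sup>L lborel E" by (intro integral_mono integrable_abs FG E bound)
    also have "\<dots> = C2 * ((\<integral>x. exp (- t * (norm (x :: real^2))\<^sup>2) * norm x ^ 3 \<partial>lborel) + t * (\<integral>x. exp (- t * (norm (x :: real^2))\<^sup>2) * norm x ^ 5 \<partial>lborel)
       + t\<^sup>2 * (\<integral>x. exp (- t * (norm (x :: real^2))\<^sup>2) * norm x ^ 8 \<partial>lborel))"
      unfolding E_def using D3(2)[OF t0] D5(2)[OF t0] D8(2)[OF t0]
      by (simp only: integral_mult_right_zero Bochner_Integration.integral_add integrable_mult_right Bochner_Integration.integrable_add)
    also have "\<dots> \<le> C2 * (D3 * t powr (- real 3 / 2 - 1) + t * (D5 * t powr (- real 5 / 2 - 1)) + t\<^sup>2 * (D8 * t powr (- real 8 / 2 - 1)))"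
      using t0 C2 by (intro mult_left_mono add_mono D3(3) D5(3) D8(3)) auto
    also have "\<dots> \<le> C2 * (D3 * t powr (-5/2) + D5 * t powr (-5/2) + D8 * t powr (-5/2))"
    proof (rule mult_left_mono[OF _ C2], intro add_mono)
      show "D3 * t powr (- real 3 / 2 - 1) \<le> D3 * t powr (- 5 / 2)" by simp
      have "t * t powr (- real 5 / 2 - 1) = t powr (-5/2)" using t0 powr_add[of t 1 "- real 5 / 2 - 1"] by simp
      then show "t * (D5 * t powr (- real 5 / 2 - 1)) \<le> D5 * t powr (- 5 / 2)" by (simp add: mult.left_commute)
      have "t\<^sup>2 * t powr (- real 8 / 2 - 1) = t powr (-3)" using t0 powr_add[of t 2 "- real 8 / 2 - 1"] by simp
      also have "\<dots> \<le> t powr (-5/2)" using t by (intro powr_mono) auto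
      finally have "D8 * (t\<^sup>2 * t powr (- real 8 / 2 - 1)) \<le> D8 * t powr (- 5 / 2)" using D8(1)
        by (rule mult_left_mono)
      then show "t\<^sup>2 * (D8 * t powr (- real 8 / 2 - 1)) \<le> D8 * t powr (- 5 / 2)"
        by (simp add: mult.left_commute)
    qed
    also have "\<dots> = C2 * (D3 + D5 + D8) * t powr (-5/2)" by (simp add: algebra_simps)
    finally show "\<bar>(\<integral>x. indicator U x * (exp (- t * ((norm x)\<^sup>2 + (h x)\<^sup>2)) * w x) \<partial>lborel) - (pi / t + pi / 16 * ((a - c)\<^sup>2 + 4 * b\<^sup>2) / t\<^sup>2)\<bar>
       \<le> C2 * (D3 + D5 + D8) * t powr (-5/2)"
      unfolding has_bochner_integral_integral_eq[OF G] F_def .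
  qed
qed

section \<open>Patches in normalized position\<close>

lemma norm_cross_le: "norm (cross3 x y) \<le> norm x * norm y"
proof -
  have "(norm (cross3 x y))\<^sup>2 \<le> (norm x * norm y)\<^sup>2" using norm_cross_dot[of x y]
    by (metis le_add_same_cancel1 zero_le_power2)
  then show ?thesis by (rule power2_le_imp_le) auto
qed

lemma cross_cross_left: "cross3 (cross3 a b) y = (a \<bullet> y) *\<^sub>R b - (b \<bullet> y) *\<^sub>R a"
  by (simp add: cross3_simps forall_3)

text \<open>Everything rests on |n x y|^2 + (n . y)^2 = |n|^2 |y|^2 with n the cross product of
  \<open>e\<close> and \<open>f\<close>: the double cross product expresses n x y by the two
  tangential coordinates of \<open>y\<close>. The last claim is polarization.\<close>

lemma orthonormal_frame:
  fixes e f :: "real^3"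
  assumes "norm e = 1" "norm f = 1" "e \<bullet> f = 0"
  shows "norm (cross3 e f) = 1"
    and "(norm y)\<^sup>2 = (y \<bullet> e)\<^sup>2 + (y \<bullet> f)\<^sup>2 + (y \<bullet> cross3 e f)\<^sup>2"
    and "x \<bullet> y = (x \<bullet> e) * (y \<bullet> e) + (x \<bullet> f) * (y \<bullet> f) + (x \<bullet> cross3 e f) * (y \<bullet> cross3 e f)"
proof -
  define n where "n = cross3 e f"
  have "(norm n)\<^sup>2 = 1" using norm_cross_dot[of e f] assms by (simp add: n_def)
  then show n1: "norm (cross3 e f) = 1" unfolding n_def
    by (simp add: power2_eq_1_iff) (metis norm_ge_zero not_one_le_zero neg_le_0_iff_le zero_le_one order.trans neg_0_le_iff_le)
  have pars: "(norm y)\<^sup>2 = (y \<bullet> e)\<^sup>2 + (y \<bullet> f)\<^sup>2 + (y \<bullet> n)\<^sup>2" for y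
  proof -
    have "(norm y)\<^sup>2 = (norm (cross3 n y))\<^sup>2 + (n \<bullet> y)\<^sup>2" using norm_cross_dot[of n y] n1
      by (simp add: n_def)
    also have "(norm (cross3 n y))\<^sup>2 = (y \<bullet> e)\<^sup>2 + (y \<bullet> f)\<^sup>2"
      unfolding n_def cross_cross_left power2_norm_eq_inner using assms
      by (simp add: inner_diff_left inner_diff_right inner_commute power2_eq_square norm_eq_1)
    finally show ?thesis by (simp add: inner_commute)
  qed
  then show "(norm y)\<^sup>2 = (y \<bullet> e)\<^sup>2 + (y \<bullet> f)\<^sup>2 + (y \<bullet> cross3 e f)\<^sup>2"
    by (simp add: n_def)
  have "2 * (x \<bullet> y) = (norm (x + y))\<^sup>2 - (norm x)\<^sup>2 - (norm y)\<^sup>2"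
    by (simp add: power2_norm_eq_inner inner_add_left inner_add_right inner_commute)
  also have "\<dots> = 2 * ((x \<bullet> e) * (y \<bullet> e) + (x \<bullet> f) * (y \<bullet> f) + (x \<bullet> n) * (y \<bullet> n))"
    unfolding pars by (simp add: inner_add_left power2_eq_square algebra_simps)
  finally show "x \<bullet> y = (x \<bullet> e) * (y \<bullet> e) + (x \<bullet> f) * (y \<bullet> f) + (x \<bullet> cross3 e f) * (y \<bullet> cross3 e f)"
    by (simp add: n_def)
qed

lemma sqrt_taylor_1: "s \<ge> 0 \<Longrightarrow> \<bar>sqrt (1 + s) - 1 - s / 2\<bar> \<le> s\<^sup>2"
proof -
  assume s: "s \<ge> 0"
  have "sqrt (1 + s) \<le> 1 + s / 2" using s by (intro real_le_lsqrt) (auto simp: power2_eq_square algebra_simps)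
  \<comment> \<open>For \<open>s > 1\<close> the left-hand side is at most 1, so squaring is needed
    only for small \<open>s\<close>.\<close>
  moreover have "1 + s / 2 - s\<^sup>2 \<le> sqrt (1 + s)"
  proof (cases "s \<le> 1")
    case True
    then have "s\<^sup>2 \<le> s" using s by (simp add: power2_eq_square mult_left_le)
    have "(1 + s / 2 - s\<^sup>2)\<^sup>2 = 1 + s - s\<^sup>2 * (7/4 + s - s\<^sup>2)"
      by (simp add: power2_eq_square algebra_simps)
    moreover have "s\<^sup>2 * (7/4 + s - s\<^sup>2) \<ge> 0" using \<open>s\<^sup>2 \<le> s\<close> s
      by (intro mult_nonneg_nonneg) auto
    ultimately have "(1 + s / 2 - s\<^sup>2)\<^sup>2 \<le> 1 + s" by linarith
    then show ?thesis by (rule real_le_rsqrt)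
  next
    case False
    then have "1 * s \<le> s * s" by (intro mult_right_mono) auto
    then have "1 + s / 2 - s\<^sup>2 \<le> 1" using s by (simp add: power2_eq_square)
    also have "1 \<le> sqrt (1 + s)" using s by simp
    finally show ?thesis .
  qed
  ultimately show ?thesis using zero_le_power2[of s] by linarith
qed

lemma axis_simps: "(axis 1 1 :: real^2) $ 1 = 1" "(axis 1 1 :: real^2) $ 2 = 0" "(axis 2 1 :: real^2) $ 1 = 0" "(axis 2 1 :: real^2) $ 2 = 1"
  by (simp_all add: axis_def)

text \<open>\<open>\<psi>\<close> models a chart moved so that the base point is 0 and the
  derivative there is isometric; \<open>D\<close> is its derivative and \<open>B\<close> its second
  derivative at 0. Instead of smoothness, estimates in terms of \<open>R\<close> and
  \<open>K\<close> are recorded, so that bounds can be made to depend on these two numbers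
  alone.\<close>

locale normalized_patch =
  fixes \<psi> :: "real^2 \<Rightarrow> real^3" and D B :: "real^2 \<Rightarrow> real^2 \<Rightarrow> real^3" and R K :: real
  assumes R: "0 < R" and K: "1 \<le> K" and psi0: "\<psi> 0 = 0"
    and der: "z \<in> ball 0 R \<Longrightarrow> (\<psi> has_derivative D z) (at z)"
    and cont: "continuous_on (ball 0 R) (\<lambda>z. D z v)"
    and D_taylor: "z \<in> ball 0 R \<Longrightarrow> norm (D z v - D 0 v - B z v) \<le> K * (norm z)\<^sup>2 * norm v"
    and bil: "bilinear B" and sym: "B v w = B w v" and Bb: "norm (B v w) \<le> K * norm v * norm w"
    and unit: "norm (D 0 (axis 1 1)) = 1" "norm (D 0 (axis 2 1)) = 1"
    and orth: "D 0 (axis 1 1) \<bullet> D 0 (axis 2 1) = 0"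
begin

definition "e1 = D 0 (axis 1 1)"
definition "e2 = D 0 (axis 2 1)"
definition "nu = cross3 e1 e2"
text \<open>On the ball of this radius \<open>K * norm z\<close> is at most 1/20, which keeps the
  tilt of the tangent plane and the distortion of the projection small.\<close>

definition "\<delta> = min R (1 / (20 * K))"
text \<open>The coordinates of the orthogonal projection onto the tangent plane at the base point;
  they become the new parameter of the patch.\<close>

definition P :: "real^3 \<Rightarrow> real^2" where "P y = (\<chi> i. if i = 1 then y \<bullet> e1 else y \<bullet> e2)"
definition "N z = cross3 (D z (axis 1 1)) (D z (axis 2 1))"

lemma frame: "norm e1 = 1" "norm e2 = 1" "e1 \<bullet> e2 = 0"
  using unit orth by (auto simp: e1_def e2_def)

lemma nu: "norm nu = 1" "e1 \<bullet> nu = 0" "e2 \<bullet> nu = 0"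
  using orthonormal_frame(1)[OF frame] by (auto simp: nu_def dot_cross_self)

lemma frame': "e1 \<bullet> e1 = 1" "e2 \<bullet> e2 = 1" "e2 \<bullet> e1 = 0" "nu \<bullet> e1 = 0" "nu \<bullet> e2 = 0" "nu \<bullet> nu = 1"
  using frame nu by (simp_all add: norm_eq_1) (simp_all add: inner_commute)

lemma pars: "(norm y)\<^sup>2 = (y \<bullet> e1)\<^sup>2 + (y \<bullet> e2)\<^sup>2 + (y \<bullet> nu)\<^sup>2"
  unfolding nu_def by (rule orthonormal_frame(2)[OF frame])

lemma inner_frame: "x \<bullet> y = (x \<bullet> e1) * (y \<bullet> e1) + (x \<bullet> e2) * (y \<bullet> e2) + (x \<bullet> nu) * (y \<bullet> nu)"
  unfolding nu_def by (rule orthonormal_frame(3)[OF frame])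

lemma P_simps [simp]: "P y $ 1 = y \<bullet> e1" "P y $ 2 = y \<bullet> e2"
  by (simp_all add: P_def)

lemma norm_P: "(norm (P y))\<^sup>2 = (y \<bullet> e1)\<^sup>2 + (y \<bullet> e2)\<^sup>2"
  by (simp add: norm_sq_2)

lemma norm_P_le: "norm (P y) \<le> norm y"
  by (rule power2_le_imp_le) (auto simp: norm_P pars[of y])

lemma linear_P: "linear P"
  by (rule linearI) (simp_all add: vec_eq_iff forall_2 inner_add_left)

lemma bounded_linear_P: "bounded_linear P"
  using linear_P by (simp add: linear_conv_bounded_linear)

lemma inner_e_le: "\<bar>y \<bullet> e1\<bar> \<le> norm y" "\<bar>y \<bullet> e2\<bar> \<le> norm y" "\<bar>y \<bullet> nu\<bar> \<le> norm y"
  using Cauchy_Schwarz_ineq2[of y e1] Cauchy_Schwarz_ineq2[of y e2] Cauchy_Schwarz_ineq2[of y nu] frame nu by auto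

lemma \<delta>: "\<delta> > 0" "\<delta> \<le> R" "20 * K * \<delta> \<le> 1" "\<delta> \<le> 1 / 20"
proof -
  show "\<delta> > 0" "\<delta> \<le> R" using R K by (auto simp: \<delta>_def)
  have "\<delta> \<le> 1 / (20 * K)" by (simp add: \<delta>_def)
  then show k: "20 * K * \<delta> \<le> 1" using K by (simp add: field_simps)
  have "\<delta> \<le> K * \<delta>" using K \<open>\<delta> > 0\<close> by simp
  then show "\<delta> \<le> 1 / 20" using k by linarith
qed

lemma in_ball_R: "z \<in> ball 0 \<delta> \<Longrightarrow> z \<in> ball 0 R"
  using \<delta>(2) by auto

lemma linear_D: "z \<in> ball 0 R \<Longrightarrow> linear (D z)"
  using der has_derivative_linear by blast

lemma D0: "D 0 v = (v$1) *\<^sub>R e1 + (v$2) *\<^sub>R e2"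
  unfolding e1_def e2_def by (rule linear_2) (rule linear_D, simp add: R)

lemma D0_inner: "D 0 v \<bullet> e1 = v$1" "D 0 v \<bullet> e2 = v$2" "D 0 v \<bullet> nu = 0"
  by (simp_all add: D0 inner_add_left frame frame' nu)

lemma P_D0: "P (D 0 v) = v"
  by (simp add: vec_eq_iff forall_2 D0_inner)

lemma norm_D0: "norm (D 0 v) = norm v"
proof -
  have "(norm (D 0 v))\<^sup>2 = (norm v)\<^sup>2" by (simp add: pars[of "D 0 v"] D0_inner norm_sq_2)
  then show ?thesis by simp
qed

text \<open>This is \<open>D_taylor\<close> integrated: by symmetry of \<open>B\<close> the
  derivative of \<open>B y y / 2\<close> in direction \<open>v\<close> is \<open>B y v\<close>, so
  \<open>D_taylor\<close> bounds the derivative of the remainder \<open>f\<close>.\<close>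

lemma psi_taylor:
  assumes z: "z \<in> ball 0 R"
  shows "norm (\<psi> z - D 0 z - (1/2) *\<^sub>R B z z) \<le> K * norm z ^ 3"
proof -
  define f where "f = (\<lambda>y. \<psi> y - D 0 y - (1/2) *\<^sub>R B y y)"
  define S where "S = cball (0 :: real^2) (norm z)"
  have S: "y \<in> ball 0 R" "norm y \<le> norm z" if "y \<in> S" for y using that z by (auto simp: S_def)
  have bb: "bounded_bilinear B" using bil by (simp add: bilinear_conv_bounded_bilinear)
  have b0: "bounded_linear (D 0)" using linear_D[of 0] R by (simp add: linear_conv_bounded_linear)
  have fd: "(f has_derivative (\<lambda>v. D y v - D 0 v - (1/2) *\<^sub>R (B y v + B v y))) (at y within S)" if "y \<in> S" for y
    unfolding f_def
    by (intro has_derivative_diff has_derivative_scaleR_right bounded_linear.has_derivative[OF b0] bounded_bilinear.FDERIV[OF bb]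
        has_derivative_at_withinI[OF der[OF S(1)[OF that]]] has_derivative_ident)
  have "norm (f z - f 0) \<le> (K * (norm z)\<^sup>2) * norm (z - 0)"
  proof (rule differentiable_bound[OF _ fd])
    fix y assume y: "y \<in> S"
    show "onorm (\<lambda>v. D y v - D 0 v - (1/2) *\<^sub>R (B y v + B v y)) \<le> K * (norm z)\<^sup>2"
    proof (rule onorm_le)
      fix v
      have "D y v - D 0 v - (1/2) *\<^sub>R (B y v + B v y) = D y v - D 0 v - B y v" using sym[of v y]
        by (simp add: scaleR_2[symmetric])
      then have "norm (D y v - D 0 v - (1/2) *\<^sub>R (B y v + B v y)) \<le> K * (norm y)\<^sup>2 * norm v"
        using D_taylor[OF S(1)[OF y], of v] by simp
      also have "\<dots> \<le> K * (norm z)\<^sup>2 * norm v" using S(2)[OF y] K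
        by (intro mult_right_mono mult_left_mono power_mono) auto
      finally show "norm (D y v - D 0 v - (1/2) *\<^sub>R (B y v + B v y)) \<le> K * (norm z)\<^sup>2 * norm v" .
    qed
  qed (auto simp: S_def)
  moreover have "f 0 = 0" using psi0 bilinear_lzero[OF bil, of 0] by (simp add: f_def D0)
  ultimately show ?thesis by (simp add: f_def power3_eq_cube power2_eq_square mult.assoc)
qed

context
  fixes z :: "real^2" assumes z: "z \<in> ball 0 \<delta>"
begin

lemma rz: "norm z \<le> 1 / 20" "20 * (K * norm z) \<le> 1" "K * (norm z)\<^sup>2 \<le> norm z / 20"
proof -
  have n: "norm z < \<delta>" using z by simp
  then show "norm z \<le> 1 / 20" using \<delta> by linarith
  have "K * norm z \<le> K * \<delta>" using n K by (intro mult_left_mono) auto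
  then show k: "20 * (K * norm z) \<le> 1" using \<delta>(3) by linarith
  have "K * norm z * norm z \<le> 1/20 * norm z" using k by (intro mult_right_mono) auto
  then show "K * (norm z)\<^sup>2 \<le> norm z / 20" by (simp add: power2_eq_square mult.assoc)
qed

lemma D_diff: "norm (D z v - D 0 v) \<le> 2 * K * norm z * norm v"
proof -
  have "norm (D z v - D 0 v) \<le> norm (D z v - D 0 v - B z v) + norm (B z v)"
    using norm_triangle_sub[of "D z v - D 0 v" "B z v"] by simp
  also have "\<dots> \<le> K * (norm z)\<^sup>2 * norm v + K * norm z * norm v"
    by (intro add_mono D_taylor in_ball_R z Bb)
  also have "\<dots> \<le> K * norm z * norm v + K * norm z * norm v"
  proof -
    have "(norm z)\<^sup>2 \<le> norm z" using rz(1) by (simp add: power2_eq_square mult_left_le)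
    then show ?thesis using K by (intro add_right_mono mult_right_mono mult_left_mono) auto
  qed
  finally show ?thesis by (simp add: mult_ac)
qed

lemma P_psi_diff: "norm (P (\<psi> z) - z) \<le> K * (norm z)\<^sup>2"
proof -
  have "P (\<psi> z) - z = P (\<psi> z - D 0 z)" by (simp add: linear_diff[OF linear_P] P_D0)
  then have "norm (P (\<psi> z) - z) \<le> norm (\<psi> z - D 0 z)" using norm_P_le[of "\<psi> z - D 0 z"] by simp
  also have "\<dots> \<le> norm (\<psi> z - D 0 z - (1/2) *\<^sub>R B z z) + norm ((1/2) *\<^sub>R B z z)"
    using norm_triangle_sub[of "\<psi> z - D 0 z" "(1/2) *\<^sub>R B z z"] by simp
  also have "\<dots> \<le> K * norm z ^ 3 + 1/2 * (K * norm z * norm z)"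
    using Bb[of z z] by (intro add_mono psi_taylor in_ball_R z) simp
  also have "\<dots> \<le> K * (norm z)\<^sup>2"
  proof -
    have "norm z ^ 3 \<le> 1/20 * (norm z)\<^sup>2" using rz(1) mult_right_mono[OF rz(1), of "(norm z)\<^sup>2"]
      by (simp add: power3_eq_cube power2_eq_square)
    then have "K * norm z ^ 3 \<le> K * (1/20 * (norm z)\<^sup>2)" using K by (intro mult_left_mono) auto
    moreover have "0 \<le> K * (norm z)\<^sup>2" using K by simp
    ultimately show ?thesis by (simp add: power2_eq_square mult.assoc)
  qed
  finally show ?thesis .
qed

lemma P_psi_norm: "norm z \<le> 2 * norm (P (\<psi> z))" "norm (P (\<psi> z)) \<le> 2 * norm z" "norm (P (\<psi> z)) < 1"
proof -
  have d: "norm (P (\<psi> z) - z) \<le> norm z / 20" using P_psi_diff rz(3) by linarith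
  then show "norm z \<le> 2 * norm (P (\<psi> z))" using norm_triangle_ineq3[of "P (\<psi> z)" z] by linarith
  show n: "norm (P (\<psi> z)) \<le> 2 * norm z" using d norm_triangle_ineq3[of "P (\<psi> z)" z] norm_ge_zero[of z]
    by linarith
  show "norm (P (\<psi> z)) < 1" using n rz(1) by linarith
qed

lemma N_diff: "norm (N z - nu) \<le> 5 * K * norm z"
proof -
  define d1 where "d1 = D z (axis 1 1) - e1"
  define d2 where "d2 = D z (axis 2 1) - e2"
  have d: "norm d1 \<le> 2 * K * norm z" "norm d2 \<le> 2 * K * norm z"
    using D_diff[of "axis 1 1"] D_diff[of "axis 2 1"] by (auto simp: d1_def d2_def e1_def e2_def)
  have nd2: "norm (D z (axis 2 1)) \<le> 3 / 2"
    using norm_triangle_sub[of "D z (axis 2 1)" e2] d(2) frame rz(2) by (simp add: d2_def)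
  have dN: "N z - nu = cross3 d1 (D z (axis 2 1)) + cross3 e1 d2"
    unfolding N_def nu_def d1_def d2_def by (simp add: Cross3.left_diff_distrib Cross3.right_diff_distrib)
  have "norm (N z - nu) \<le> norm d1 * norm (D z (axis 2 1)) + norm e1 * norm d2"
    using norm_cross_le[of d1 "D z (axis 2 1)"] norm_cross_le[of e1 d2] norm_triangle_ineq[of "cross3 d1 (D z (axis 2 1))" "cross3 e1 d2"]
    unfolding dN by linarith
  also have "\<dots> \<le> (2 * K * norm z) * (3 / 2) + 1 * (2 * K * norm z)"
    using d nd2 frame K by (intro add_mono mult_mono) auto
  finally show ?thesis by simp
qed

definition "\<beta> = N z \<bullet> nu"

lemma \<beta>: "\<beta> \<ge> 3 / 4"
proof -
  have "\<bar>(N z - nu) \<bullet> nu\<bar> \<le> 5 * K * norm z" using inner_e_le(3)[of "N z - nu"] N_diff by linarith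
  moreover have "nu \<bullet> nu = 1" using nu(1) by (simp add: norm_eq_1)
  ultimately show ?thesis using rz(2) by (simp add: \<beta>_def inner_diff_left)
qed

text \<open>Binet-Cauchy: the determinant of the inner products of two vectors with
  \<open>e1\<close> and \<open>e2\<close> is the inner product of the two cross products. So
  \<open>\<beta>\<close> is the Jacobian of the projected patch, and its lower bound 3/4 allows
  division by it.\<close>

lemma det_P_D: "det (matrix (\<lambda>v. P (D z v))) = \<beta>"
  by (simp add: det_2 matrix_def \<beta>_def N_def nu_def) (simp add: cross3_simps)

text \<open>Over the tangent plane the patch is a graph, and a normal of a graph is proportional to
  (- h_1, - h_2, 1); the two quotients are therefore the negative slopes. Orthogonality of
  \<open>D z v\<close> and \<open>N z\<close> determines the slopes up to second order, where they
  equal \<open>B z v \<bullet> nu\<close>.\<close>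

lemma slopes:
  shows "\<bar>N z \<bullet> e1 / \<beta>\<bar> \<le> 7 * K * norm z" "\<bar>N z \<bullet> e2 / \<beta>\<bar> \<le> 7 * K * norm z"
    "\<bar>N z \<bullet> e1 / \<beta> + B z (axis 1 1) \<bullet> nu\<bar> \<le> 29 * K\<^sup>2 * (norm z)\<^sup>2"
    "\<bar>N z \<bullet> e2 / \<beta> + B z (axis 2 1) \<bullet> nu\<bar> \<le> 29 * K\<^sup>2 * (norm z)\<^sup>2"
proof -
  define r where "r = norm z"
  have r: "r \<ge> 0" by (simp add: r_def)
  have sl: "\<bar>x / \<beta>\<bar> \<le> 7 * K * r" if "\<bar>x\<bar> \<le> 5 * K * r" for x
  proof -
    have "\<bar>x / \<beta>\<bar> = \<bar>x\<bar> / \<beta>" using \<beta> by simp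
    also have "\<dots> \<le> (5 * K * r) / (3 / 4)" using that \<beta> by (intro frac_le) auto
    also have "\<dots> \<le> 7 * K * r" using K r by simp
    finally show ?thesis .
  qed
  have "(N z - nu) \<bullet> e1 = N z \<bullet> e1" "(N z - nu) \<bullet> e2 = N z \<bullet> e2"
    by (simp_all add: inner_diff_left frame')
  then have "\<bar>N z \<bullet> e1\<bar> \<le> 5 * K * r" "\<bar>N z \<bullet> e2\<bar> \<le> 5 * K * r"
    using inner_e_le(1,2)[of "N z - nu"] N_diff unfolding r_def by (auto intro: order_trans)
  then show s: "\<bar>N z \<bullet> e1 / \<beta>\<bar> \<le> 7 * K * norm z" "\<bar>N z \<bullet> e2 / \<beta>\<bar> \<le> 7 * K * norm z"
    using sl unfolding r_def by auto
  define p where "p = N z \<bullet> e1 / \<beta>"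
  define q where "q = N z \<bullet> e2 / \<beta>"
  have pq: "\<bar>p\<bar> \<le> 7 * K * r" "\<bar>q\<bar> \<le> 7 * K * r" using s by (auto simp: p_def q_def r_def)
  \<comment> \<open>Orthogonality to \<open>N z\<close>, divided by \<open>\<beta>\<close>, is
    linear in \<open>p\<close> and \<open>q\<close>. The constant is 29 = 14 + 14 + 1: two products
    of a tilt \<open>2 * K * r\<close> with a slope \<open>7 * K * r\<close>, and the remainder of
    \<open>D_taylor\<close>.\<close>
  have main: "\<bar>v$1 * p + v$2 * q + B z v \<bullet> nu\<bar> \<le> 29 * K\<^sup>2 * r\<^sup>2" if v: "norm v = 1" "D z v \<bullet> N z = 0" for v
  proof -
    define d where "d = D z v - D 0 v"
    have d: "norm d \<le> 2 * K * r" using D_diff[of v] v by (simp add: d_def r_def)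
    have "(D z v \<bullet> e1) * (N z \<bullet> e1) + (D z v \<bullet> e2) * (N z \<bullet> e2) + (D z v \<bullet> nu) * \<beta> = 0"
      using inner_frame[of "D z v" "N z"] v(2) by (simp add: \<beta>_def)
    then have "(D z v \<bullet> e1) * p + (D z v \<bullet> e2) * q + D z v \<bullet> nu = 0"
      using \<beta> by (simp add: p_def q_def field_simps)
    moreover have "D z v \<bullet> e1 = v$1 + d \<bullet> e1" "D z v \<bullet> e2 = v$2 + d \<bullet> e2" "D z v \<bullet> nu = d \<bullet> nu"
      by (simp_all add: d_def inner_diff_left D0_inner)
    ultimately have "v$1 * p + v$2 * q + B z v \<bullet> nu = - (d \<bullet> e1) * p - (d \<bullet> e2) * q - (d - B z v) \<bullet> nu"
      by (simp add: inner_diff_left algebra_simps)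
    moreover have "\<bar>(d \<bullet> e1) * p\<bar> \<le> (2 * K * r) * (7 * K * r)" "\<bar>(d \<bullet> e2) * q\<bar> \<le> (2 * K * r) * (7 * K * r)"
      unfolding abs_mult using inner_e_le[of d] d pq K r by (intro mult_mono; linarith | simp)+
    moreover have "\<bar>(d - B z v) \<bullet> nu\<bar> \<le> K\<^sup>2 * r\<^sup>2"
    proof -
      have "\<bar>(d - B z v) \<bullet> nu\<bar> \<le> norm (d - B z v)" by (rule inner_e_le)
      also have "\<dots> \<le> K * r\<^sup>2" using D_taylor[OF in_ball_R[OF z], of v] v by (simp add: d_def r_def)
      also have "\<dots> \<le> K\<^sup>2 * r\<^sup>2" using K by (intro mult_right_mono) (auto simp: power2_eq_square)
      finally show ?thesis .
    qed
    ultimately have "\<bar>v$1 * p + v$2 * q + B z v \<bullet> nu\<bar> \<le> (2 * K * r) * (7 * K * r) + (2 * K * r) * (7 * K * r) + K\<^sup>2 * r\<^sup>2"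
      by (smt (verit) mult_minus_left)
    also have "\<dots> = 29 * K\<^sup>2 * r\<^sup>2" by (simp add: power2_eq_square)
    finally show ?thesis .
  qed
  show "\<bar>N z \<bullet> e1 / \<beta> + B z (axis 1 1) \<bullet> nu\<bar> \<le> 29 * K\<^sup>2 * (norm z)\<^sup>2"
    using main[of "axis 1 1"] by (simp add: p_def r_def N_def dot_cross_self axis_simps)
  show "\<bar>N z \<bullet> e2 / \<beta> + B z (axis 2 1) \<bullet> nu\<bar> \<le> 29 * K\<^sup>2 * (norm z)\<^sup>2"
    using main[of "axis 2 1"] by (simp add: q_def r_def N_def dot_cross_self axis_simps)
qed

text \<open>The area element of the patch relative to that of its projection is the area factor of a
  graph; it comes from Pythagoras for \<open>N z\<close> in the frame.\<close>

lemma area_ratio: "norm (N z) / \<beta> = sqrt (1 + ((N z \<bullet> e1 / \<beta>)\<^sup>2 + (N z \<bullet> e2 / \<beta>)\<^sup>2))"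
proof -
  have "(norm (N z) / \<beta>)\<^sup>2 = 1 + ((N z \<bullet> e1 / \<beta>)\<^sup>2 + (N z \<bullet> e2 / \<beta>)\<^sup>2)"
    unfolding power_divide pars[of "N z"] \<beta>_def[symmetric] using \<beta> by (simp add: field_simps)
  then show ?thesis using \<beta> real_sqrt_unique[of "norm (N z) / \<beta>"] by simp
qed

text \<open>The expansion is known in \<open>z\<close> and wanted in
  \<open>x = P (\<psi> z)\<close>. The two differ only to second order, so passing from
  \<open>B z z\<close> to \<open>B x x\<close> costs a cubic error, visible in the factorization
  \<open>B (x - z) (x + z)\<close>. The constant is the one of \<open>density_estimate\<close>, so
  that a single number serves for both; the computation here yields 3 * 8.\<close>

lemma height_estimate:
  "\<bar>\<psi> z \<bullet> nu - B (P (\<psi> z)) (P (\<psi> z)) \<bullet> nu / 2\<bar> \<le> 6008 * K ^ 4 * norm (P (\<psi> z)) ^ 3"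
proof -
  define x where "x = P (\<psi> z)"
  define r where "r = norm z"
  have r: "r \<ge> 0" by (simp add: r_def)
  have "(\<psi> z - D 0 z - (1/2) *\<^sub>R B z z) \<bullet> nu = \<psi> z \<bullet> nu - B z z \<bullet> nu / 2"
    by (simp add: inner_diff_left D0_inner)
  then have a: "\<bar>\<psi> z \<bullet> nu - B z z \<bullet> nu / 2\<bar> \<le> K * r ^ 3"
    using inner_e_le(3)[of "\<psi> z - D 0 z - (1/2) *\<^sub>R B z z"] psi_taylor[OF in_ball_R[OF z]]
    by (simp add: r_def)
  have "B x x - B z z = B (x - z) (x + z)"
    using sym[of x z] by (simp add: bilinear_lsub[OF bil] bilinear_radd[OF bil])
  then have "\<bar>B x x \<bullet> nu - B z z \<bullet> nu\<bar> \<le> norm (B (x - z) (x + z))"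
    using inner_e_le(3)[of "B (x - z) (x + z)"] by (metis inner_diff_left)
  also have "\<dots> \<le> K * (K * r\<^sup>2) * (3 * r)"
  proof -
    have "norm (x + z) \<le> 3 * r" using norm_triangle_ineq[of x z] P_psi_norm(2) by (simp add: x_def r_def)
    then show ?thesis using Bb[of "x - z" "x + z"] P_psi_diff K r
      by (elim order_trans) (intro mult_mono; auto simp: x_def r_def)
  qed
  also have "\<dots> = 3 * K\<^sup>2 * r ^ 3" by (simp add: power2_eq_square power3_eq_cube)
  finally have b: "\<bar>B x x \<bullet> nu - B z z \<bullet> nu\<bar> \<le> 3 * K\<^sup>2 * r ^ 3" .
  have "K * r ^ 3 \<le> K\<^sup>2 * r ^ 3" using K r by (intro mult_right_mono) (auto simp: power2_eq_square)
  then have "\<bar>\<psi> z \<bullet> nu - B x x \<bullet> nu / 2\<bar> \<le> 3 * K\<^sup>2 * r ^ 3" using a b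
    by linarith
  also have "\<dots> \<le> 3 * K ^ 4 * (2 * norm x) ^ 3"
    using P_psi_norm(1) K r by (intro mult_mono power_mono) (auto simp: x_def r_def power_increasing)
  also have "\<dots> \<le> 6008 * K ^ 4 * norm x ^ 3" using K by (simp add: power_mult_distrib)
  finally show ?thesis unfolding x_def .
qed

text \<open>By \<open>area_ratio\<close> the factor is \<open>sqrt (1 + s)\<close> with
  \<open>s\<close> the squared slope, and \<open>slopes\<close> compares the slopes with the
  gradient of the quadratic part. The constant is 8 * (481 + 270): 481 bounds 98^2 / 20 from
  \<open>s\<^sup>2\<close>, 270 = 30 * 9 comes from a difference of squares, and 8 from
  \<open>norm z \<le> 2 * norm x\<close>.\<close>

lemma density_estimate:
  "\<bar>norm (N z) / \<beta> - 1 - ((B (P (\<psi> z)) (axis 1 1) \<bullet> nu)\<^sup>2 + (B (P (\<psi> z)) (axis 2 1) \<bullet> nu)\<^sup>2) / 2\<bar> \<le> 6008 * K ^ 4 * norm (P (\<psi> z)) ^ 3"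
proof -
  define x where "x = P (\<psi> z)"
  define r where "r = norm z"
  have r: "r \<ge> 0" "r \<le> 1 / 20" "K * r\<^sup>2 \<le> r / 20" using rz by (auto simp: r_def)
  have sq: "\<bar>p\<^sup>2 - (B x v \<bullet> nu)\<^sup>2\<bar> \<le> 270 * K ^ 3 * r ^ 3" "p\<^sup>2 \<le> 49 * K\<^sup>2 * r\<^sup>2"
    if v: "norm v = 1" and p: "\<bar>p\<bar> \<le> 7 * K * norm z" "\<bar>p + B z v \<bullet> nu\<bar> \<le> 29 * K\<^sup>2 * (norm z)\<^sup>2" for p v
  proof -
    have "\<bar>B x v \<bullet> nu - B z v \<bullet> nu\<bar> \<le> norm (B (x - z) v)"
      using inner_e_le(3)[of "B (x - z) v"] by (simp add: bilinear_lsub[OF bil] inner_diff_left)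
    also have "\<dots> \<le> K * (K * r\<^sup>2) * 1" using Bb[of "x - z" v] P_psi_diff K v
      by (elim order_trans) (intro mult_mono; auto simp: x_def r_def)
    finally have 1: "\<bar>p + B x v \<bullet> nu\<bar> \<le> 30 * K\<^sup>2 * r\<^sup>2" using p(2)
      by (simp add: r_def power2_eq_square)
    have "\<bar>B x v \<bullet> nu\<bar> \<le> norm (B x v)" by (rule inner_e_le)
    also have "\<dots> \<le> K * (2 * r) * 1" using Bb[of x v] P_psi_norm(2) K v
      by (elim order_trans) (intro mult_mono; auto simp: x_def r_def)
    finally have 2: "\<bar>p - B x v \<bullet> nu\<bar> \<le> 9 * K * r" using p(1) unfolding r_def by linarith
    have "\<bar>(p + B x v \<bullet> nu) * (p - B x v \<bullet> nu)\<bar> \<le> (30 * K\<^sup>2 * r\<^sup>2) * (9 * K * r)"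
      unfolding abs_mult using 1 2 K r by (intro mult_mono) auto
    then show "\<bar>p\<^sup>2 - (B x v \<bullet> nu)\<^sup>2\<bar> \<le> 270 * K ^ 3 * r ^ 3"
      by (simp add: power2_eq_square power3_eq_cube algebra_simps)
    have "\<bar>p\<bar>\<^sup>2 \<le> (7 * K * r)\<^sup>2" using p(1) unfolding r_def by (intro power_mono) auto
    then show "p\<^sup>2 \<le> 49 * K\<^sup>2 * r\<^sup>2" by (simp add: power_mult_distrib)
  qed
  define p where "p = N z \<bullet> e1 / \<beta>"
  define q where "q = N z \<bullet> e2 / \<beta>"
  note p = sq[of "axis 1 1" p, OF norm_axis_1 slopes(1,3)[folded p_def]] and q = sq[of "axis 2 1" q, OF norm_axis_1 slopes(2,4)[folded q_def]]
  define s where "s = p\<^sup>2 + q\<^sup>2"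
  have s0: "s \<ge> 0" by (simp add: s_def)
  have "s\<^sup>2 \<le> (98 * K\<^sup>2 * r\<^sup>2)\<^sup>2" using p(2) q(2) s0
    by (intro power_mono) (auto simp: s_def)
  also have "\<dots> = 9604 * K ^ 4 * (r * r ^ 3)"
    by (simp add: power_mult_distrib power2_eq_square power3_eq_cube eval_nat_numeral)
  also have "\<dots> \<le> 9604 * K ^ 4 * (1/20 * r ^ 3)" using r K by (intro mult_left_mono mult_right_mono) auto
  also have "\<dots> \<le> 481 * K ^ 4 * r ^ 3" using r K by simp
  finally have s2: "s\<^sup>2 \<le> 481 * K ^ 4 * r ^ 3" .
  have k3: "270 * K ^ 3 * r ^ 3 \<le> 270 * K ^ 4 * r ^ 3" using K r
    by (intro mult_right_mono mult_left_mono power_increasing) auto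
  have "norm (N z) / \<beta> = sqrt (1 + s)" unfolding area_ratio s_def p_def q_def ..
  then have "\<bar>norm (N z) / \<beta> - 1 - s / 2\<bar> \<le> s\<^sup>2" using sqrt_taylor_1[OF s0] by simp
  moreover have gen: "\<bar>X - 1 - (u' + v') / 2\<bar> \<le> b1 + b3"
    if "\<bar>X - 1 - (u + v) / 2\<bar> \<le> y" "\<bar>u - u'\<bar> \<le> b2" "\<bar>v - v'\<bar> \<le> b2" "y \<le> b1" "b2 \<le> b3" for X u v u' v' y b1 b2 b3 :: real
    using that by (simp add: abs_le_iff field_simps)
  ultimately have "\<bar>norm (N z) / \<beta> - 1 - ((B x (axis 1 1) \<bullet> nu)\<^sup>2 + (B x (axis 2 1) \<bullet> nu)\<^sup>2) / 2\<bar> \<le> 481 * K ^ 4 * r ^ 3 + 270 * K ^ 4 * r ^ 3"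
    using gen[OF _ p(1) q(1) s2 k3] unfolding s_def by blast
  also have "\<dots> = 751 * K ^ 4 * r ^ 3" by simp
  finally have "\<bar>norm (N z) / \<beta> - 1 - ((B x (axis 1 1) \<bullet> nu)\<^sup>2 + (B x (axis 2 1) \<bullet> nu)\<^sup>2) / 2\<bar> \<le> 751 * K ^ 4 * r ^ 3" .
  also have "\<dots> \<le> 751 * K ^ 4 * (2 * norm x) ^ 3"
    using P_psi_norm(1) K r by (intro mult_left_mono power_mono) (auto simp: x_def r_def)
  also have "\<dots> = 6008 * K ^ 4 * norm x ^ 3" by (simp add: power_mult_distrib)
  finally show ?thesis unfolding x_def .
qed

end

section \<open>The projection to the tangent plane as a change of parameter\<close>

lemma P_psi_deriv: "z \<in> ball 0 R \<Longrightarrow> ((\<lambda>z. P (\<psi> z)) has_derivative (\<lambda>v. P (D z v))) (at z)"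
  by (rule bounded_linear.has_derivative[OF bounded_linear_P der])

text \<open>The projected patch is the identity plus a contraction. Injectivity and the covering of
  a ball both follow from this, with a factor that does not depend on the patch.\<close>

lemma P_psi_lipschitz:
  assumes "x \<in> ball 0 \<delta>" "y \<in> ball 0 \<delta>"
  shows "norm ((P (\<psi> x) - x) - (P (\<psi> y) - y)) \<le> 1 / 10 * norm (x - y)"
proof (rule differentiable_bound[OF convex_ball _ _ assms])
  fix z :: "real^2" assume z: "z \<in> ball 0 \<delta>"
  show "((\<lambda>x. P (\<psi> x) - x) has_derivative (\<lambda>v. P (D z v) - v)) (at z within ball 0 \<delta>)"
    by (intro has_derivative_diff has_derivative_ident has_derivative_at_withinI[OF P_psi_deriv] in_ball_R z)
  show "onorm (\<lambda>v. P (D z v) - v) \<le> 1 / 10"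
  proof (rule onorm_le)
    fix v
    have "P (D z v) - v = P (D z v - D 0 v)" by (simp add: linear_diff[OF linear_P] P_D0)
    then have "norm (P (D z v) - v) \<le> norm (D z v - D 0 v)" using norm_P_le by simp
    also have "\<dots> \<le> 2 * K * norm z * norm v" by (rule D_diff[OF z])
    also have "\<dots> \<le> 1 / 10 * norm v" using rz(2)[OF z] by (intro mult_right_mono) auto
    finally show "norm (P (D z v) - v) \<le> 1 / 10 * norm v" .
  qed
qed

lemma inj_P_psi: "inj_on (\<lambda>z. P (\<psi> z)) (ball 0 \<delta>)"
proof (rule inj_onI)
  fix x y assume xy: "x \<in> ball 0 \<delta>" "y \<in> ball 0 \<delta>" "P (\<psi> x) = P (\<psi> y)"
  then have "norm (y - x) \<le> 1 / 10 * norm (x - y)" using P_psi_lipschitz[OF xy(1,2)] by simp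
  then show "x = y" by (simp add: norm_minus_commute)
qed

text \<open>Solving \<open>P (\<psi> z) = \<xi>\<close> means finding a fixed point of a
  contraction. The argument replaces the inverse function theorem because the radius has to be
  explicit, hence common to all patches with the same \<open>R\<close> and \<open>K\<close>.\<close>

lemma ball_subset_P_psi: "ball 0 (\<delta> / 4) \<subseteq> (\<lambda>z. P (\<psi> z)) ` ball 0 \<delta>"
proof
  fix \<xi> :: "real^2" assume \<xi>: "\<xi> \<in> ball 0 (\<delta> / 4)"
  have sub: "cball 0 (\<delta> / 2) \<subseteq> ball (0::real^2) \<delta>" using \<delta>(1) by auto
  have "\<exists>!z\<in>cball 0 (\<delta> / 2). \<xi> - (P (\<psi> z) - z) = z"
  proof (rule Banach_fix[OF compact_imp_complete[OF compact_cball]])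
    show "cball (0::real^2) (\<delta> / 2) \<noteq> {}" using \<delta>(1) by simp
    show "(\<lambda>z. \<xi> - (P (\<psi> z) - z)) ` cball 0 (\<delta> / 2) \<subseteq> cball 0 (\<delta> / 2)"
    proof safe
      fix z :: "real^2" assume z: "z \<in> cball 0 (\<delta> / 2)"
      then have zb: "z \<in> ball 0 \<delta>" using sub by blast
      have "norm (P (\<psi> z) - z) \<le> norm z / 20" using P_psi_diff[OF zb] rz(3)[OF zb] by linarith
      then have "norm (\<xi> - (P (\<psi> z) - z)) \<le> \<delta> / 2"
        using \<xi> z norm_triangle_ineq4[of \<xi> "P (\<psi> z) - z"] \<delta>(1) by simp
      then show "\<xi> - (P (\<psi> z) - z) \<in> cball 0 (\<delta> / 2)" by simp
    qed
    show "\<And>x y. x \<in> cball 0 (\<delta> / 2) \<Longrightarrow> y \<in> cball 0 (\<delta> / 2) \<Longrightarrow> dist (\<xi> - (P (\<psi> x) - x)) (\<xi> - (P (\<psi> y) - y)) \<le> 1 / 10 * dist x y"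
    proof -
      fix x y :: "real^2" assume "x \<in> cball 0 (\<delta> / 2)" "y \<in> cball 0 (\<delta> / 2)"
      then have xy: "x \<in> ball 0 \<delta>" "y \<in> ball 0 \<delta>" using sub by auto
      have "dist (\<xi> - (P (\<psi> x) - x)) (\<xi> - (P (\<psi> y) - y)) = norm ((P (\<psi> x) - x) - (P (\<psi> y) - y))"
        unfolding dist_norm by (subst norm_minus_commute) (rule arg_cong[where f = norm], simp)
      then show "dist (\<xi> - (P (\<psi> x) - x)) (\<xi> - (P (\<psi> y) - y)) \<le> 1 / 10 * dist x y"
        using P_psi_lipschitz[OF xy] by (simp add: dist_norm)
    qed
  qed simp_all
  then obtain z where z: "z \<in> cball 0 (\<delta> / 2)" "\<xi> - (P (\<psi> z) - z) = z" by blast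
  then have "P (\<psi> z) = \<xi>" by (simp add: algebra_simps)
  then show "\<xi> \<in> (\<lambda>z. P (\<psi> z)) ` ball 0 \<delta>" using z(1) sub by blast
qed

lemma cont_psi: "continuous_on (ball 0 \<delta>) \<psi>"
  using der in_ball_R has_derivative_continuous by (meson continuous_at_imp_continuous_on)

lemma cont_N: "continuous_on (ball 0 \<delta>) N"
  unfolding N_def by (intro continuous_on_cross continuous_on_subset[OF cont]) (use \<delta>(2) in auto)

lemma B_nu_quadratic:
  "B x x \<bullet> nu = (B (axis 1 1) (axis 1 1) \<bullet> nu) * (x$1)\<^sup>2 + 2 * (B (axis 1 1) (axis 2 1) \<bullet> nu) * (x$1) * (x$2) + (B (axis 2 1) (axis 2 1) \<bullet> nu) * (x$2)\<^sup>2"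
  "B x (axis 1 1) \<bullet> nu = (B (axis 1 1) (axis 1 1) \<bullet> nu) * x$1 + (B (axis 1 1) (axis 2 1) \<bullet> nu) * x$2"
  "B x (axis 2 1) \<bullet> nu = (B (axis 1 1) (axis 2 1) \<bullet> nu) * x$1 + (B (axis 2 1) (axis 2 1) \<bullet> nu) * x$2"
proof -
  have l: "linear (\<lambda>x. B x v)" "linear (B v)" for v using bil by (auto simp: bilinear_def)
  have e: "B x v = (x$1) *\<^sub>R B (axis 1 1) v + (x$2) *\<^sub>R B (axis 2 1) v" for x v using linear_2[OF l(1)] .
  show e1': "B x (axis 1 1) \<bullet> nu = (B (axis 1 1) (axis 1 1) \<bullet> nu) * x$1 + (B (axis 1 1) (axis 2 1) \<bullet> nu) * x$2"
    unfolding e[of x] by (simp add: inner_add_left sym[of "axis 2 1" "axis 1 1"])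
  show e2': "B x (axis 2 1) \<bullet> nu = (B (axis 1 1) (axis 2 1) \<bullet> nu) * x$1 + (B (axis 2 1) (axis 2 1) \<bullet> nu) * x$2"
    unfolding e[of x] by (simp add: inner_add_left)
  show "B x x \<bullet> nu = (B (axis 1 1) (axis 1 1) \<bullet> nu) * (x$1)\<^sup>2 + 2 * (B (axis 1 1) (axis 2 1) \<bullet> nu) * (x$1) * (x$2) + (B (axis 2 1) (axis 2 1) \<bullet> nu) * (x$2)\<^sup>2"
  proof -
    have "B x x = (x$1) *\<^sub>R B x (axis 1 1) + (x$2) *\<^sub>R B x (axis 2 1)" by (rule linear_2[OF l(2)])
    then have "B x x \<bullet> nu = (x$1) * (B x (axis 1 1) \<bullet> nu) + (x$2) * (B x (axis 2 1) \<bullet> nu)"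
      by (simp add: inner_add_left)
    then show ?thesis unfolding e1' e2' by (simp add: power2_eq_square algebra_simps)
  qed
qed

text \<open>In the parameter \<open>x = P (\<psi> z)\<close> the squared norm splits by Pythagoras
  into \<open>(norm x)\<^sup>2 + (h x)\<^sup>2\<close>, so that a pure Gaussian times a perturbation
  remains. Here \<open>h\<close> is the height of the graph over the tangent plane and
  \<open>w\<close> its area factor.\<close>

lemma gaussian_change_of_variables:
  assumes t: "t > 0"
  obtains U h w where "ball 0 (\<delta> / 4) \<subseteq> U" "U \<subseteq> ball 0 1"
    "\<And>x. x \<in> U \<Longrightarrow> \<bar>h x - B x x \<bullet> nu / 2\<bar> \<le> 6008 * K ^ 4 * norm x ^ 3"
    "\<And>x. x \<in> U \<Longrightarrow> \<bar>w x - 1 - ((B x (axis 1 1) \<bullet> nu)\<^sup>2 + (B x (axis 2 1) \<bullet> nu)\<^sup>2) / 2\<bar> \<le> 6008 * K ^ 4 * norm x ^ 3"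
    "(\<lambda>x. indicator U x * (exp (- t * ((norm x)\<^sup>2 + (h x)\<^sup>2)) * w x)) \<in> borel_measurable lborel"
    "(\<integral>z. indicator (ball 0 \<delta>) z * (exp (- t * (norm (\<psi> z))\<^sup>2) * norm (N z)) \<partial>lborel) =
     (\<integral>x. indicator U x * (exp (- t * ((norm x)\<^sup>2 + (h x)\<^sup>2)) * w x) \<partial>lborel)"
proof -
  define g where "g = (\<lambda>z. P (\<psi> z))"
  define S where "S = ball (0 :: real^2) \<delta>"
  define U where "U = g ` S"
  have contg: "continuous_on S g"
    unfolding g_def S_def by (rule linear_continuous_on_compose[OF cont_psi linear_P])
  have injg: "inj_on g S" unfolding g_def S_def by (rule inj_P_psi)
  have openS: "open S" by (simp add: S_def)
  have openU: "open U" unfolding U_def by (rule invariance_of_domain[OF contg openS injg])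
  obtain k where "homeomorphism S (g ` S) g k"
    by (rule invariance_of_domain_homeomorphism[OF openS contg order_refl injg]) (rule that)
  then have k: "homeomorphism S U g k" by (simp add: U_def)
  have contk: "continuous_on U k" and kg: "\<And>z. z \<in> S \<Longrightarrow> k (g z) = z" and kU: "k ` U = S"
    using homeomorphism_cont2[OF k] homeomorphism_apply1[OF k] homeomorphism_image2[OF k] by blast+
  have kS: "k x \<in> ball 0 \<delta>" if "x \<in> U" for x using kU that S_def by blast
  have gk: "P (\<psi> (k x)) = x" if "x \<in> U" for x using homeomorphism_apply2[OF k that] by (simp add: g_def)
  define h where "h = (\<lambda>x. \<psi> (k x) \<bullet> nu)"
  define w where "w = (\<lambda>x. norm (N (k x)) / (N (k x) \<bullet> nu))"
  define F where "F = (\<lambda>x. exp (- t * ((norm x)\<^sup>2 + (h x)\<^sup>2)) * w x)"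
  have \<beta>': "N (k x) \<bullet> nu \<ge> 3 / 4" if "x \<in> U" for x using \<beta>[OF kS[OF that]]
    by (simp add: \<beta>_def[OF kS[OF that]])
  have contF: "continuous_on U F"
  proof -
    have c1: "continuous_on U (\<lambda>x. \<psi> (k x))"
      by (rule continuous_on_compose2[OF cont_psi contk]) (use kS in auto)
    have c2: "continuous_on U (\<lambda>x. N (k x))"
      by (rule continuous_on_compose2[OF cont_N contk]) (use kS in auto)
    have nz: "N (k x) \<bullet> nu \<noteq> 0" if "x \<in> U" for x using \<beta>'[OF that] by auto
    show ?thesis unfolding F_def h_def w_def by (intro continuous_intros c1 c2 ballI nz)
  qed
  have measF: "(\<lambda>x. indicator U x * F x) \<in> borel_measurable borel"
    using borel_measurable_continuous_on_indicator[OF _ contF] openU by simp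
  have U1: "U \<subseteq> ball 0 1" using P_psi_norm(3) by (auto simp: U_def g_def S_def)
  have wb: "\<bar>w x\<bar> \<le> 2" if x: "x \<in> U" for x
  proof -
    have "norm (N (k x)) \<le> norm nu + norm (N (k x) - nu)" by (rule norm_triangle_sub)
    also have "\<dots> \<le> 1 + 1/4" using N_diff[OF kS[OF x]] rz(2)[OF kS[OF x]] nu(1) by simp
    finally have "norm (N (k x)) \<le> 2 * (N (k x) \<bullet> nu)" using \<beta>'[OF x] by linarith
    then show ?thesis using \<beta>'[OF x] by (simp add: w_def divide_le_eq)
  qed
  have intF: "integrable lborel (\<lambda>x. indicator U x * F x)"
  proof (rule Bochner_Integration.integrable_bound)
    show "integrable lborel (\<lambda>x :: real^2. 2 * indicator (ball 0 1) x :: real)"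
      using emeasure_lborel_ball_finite[of "0 :: real^2" 1]
      by (intro integrable_mult_right integrable_real_indicator) auto
    show "AE x in lborel. norm (indicator U x * F x) \<le> norm (2 * indicator (ball 0 1) x :: real)"
    proof (rule AE_I2)
      fix x
      have "\<bar>exp (- t * ((norm x)\<^sup>2 + (h x)\<^sup>2)) * w x\<bar> \<le> 1 * 2" if "x \<in> U"
        unfolding abs_mult using wb[OF that] t by (intro mult_mono) auto
      then show "norm (indicator U x * F x) \<le> norm (2 * indicator (ball 0 1) x :: real)"
        using U1 by (auto simp: F_def indicator_def)
    qed
  qed (use measF in simp)
  have ai: "F absolutely_integrable_on (g ` S)"
    using absolutely_integrable_indicator_lborel(1)[OF measF] intF by (simp add: U_def)
  have derg: "(g has_derivative (\<lambda>v. P (D z v))) (at z within S)" if "z \<in> S" for z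
    unfolding g_def by (rule has_derivative_at_withinI, rule P_psi_deriv) (use that in_ball_R S_def in blast)
  have Sleb: "S \<in> sets lebesgue" by (simp add: S_def)
  have cov: "(\<lambda>z. \<bar>det (matrix (\<lambda>v. P (D z v)))\<bar> * F (g z)) absolutely_integrable_on S"
    "integral S (\<lambda>z. \<bar>det (matrix (\<lambda>v. P (D z v)))\<bar> * F (g z)) = integral (g ` S) F"
    by (rule absolutely_integrable_change_of_variables_real[OF Sleb _ injg ai], rule derg, assumption)+
  define G where "G = (\<lambda>z. exp (- t * (norm (\<psi> z))\<^sup>2) * norm (N z))"
  have eqS: "\<bar>det (matrix (\<lambda>v. P (D z v)))\<bar> * F (g z) = G z" if z: "z \<in> S" for z
  proof -
    have zb: "z \<in> ball 0 \<delta>" using z by (simp add: S_def)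
    have "(norm (g z))\<^sup>2 + (h (g z))\<^sup>2 = (norm (\<psi> z))\<^sup>2"
      unfolding h_def kg[OF z] by (simp add: g_def norm_P pars[of "\<psi> z"])
    then show ?thesis using det_P_D[OF zb] \<beta>[OF zb] by (simp add: F_def G_def w_def kg[OF z] \<beta>_def[OF zb])
  qed
  have "continuous_on S G"
    unfolding G_def S_def by (intro continuous_intros cont_psi cont_N)
  then have measG: "(\<lambda>z. indicator S z * G z) \<in> borel_measurable borel"
    using borel_measurable_continuous_on_indicator[OF _ \<open>continuous_on S G\<close>] openS by simp
  have aiG: "G absolutely_integrable_on S"
    by (subst set_integrable_cong[OF refl refl eqS[symmetric]]) (auto intro: cov(1))
  have "integral S G = integral U F"
    unfolding U_def cov(2)[symmetric] by (rule integral_cong) (simp add: eqS)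
  then have main: "(\<integral>z. indicator S z * G z \<partial>lborel) = (\<integral>x. indicator U x * F x \<partial>lborel)"
    using absolutely_integrable_indicator_lborel(2)[OF measG aiG] absolutely_integrable_indicator_lborel(2)[OF measF] ai
    by (simp add: U_def)
  show thesis
  proof (rule that[of U h w])
    show "ball 0 (\<delta> / 4) \<subseteq> U" unfolding U_def g_def S_def by (rule ball_subset_P_psi)
    show "U \<subseteq> ball 0 1" by (rule U1)
    show "\<bar>h x - B x x \<bullet> nu / 2\<bar> \<le> 6008 * K ^ 4 * norm x ^ 3" if "x \<in> U" for x
      using height_estimate[OF kS[OF that]] by (simp add: h_def gk[OF that])
    show "\<bar>w x - 1 - ((B x (axis 1 1) \<bullet> nu)\<^sup>2 + (B x (axis 2 1) \<bullet> nu)\<^sup>2) / 2\<bar> \<le> 6008 * K ^ 4 * norm x ^ 3" if "x \<in> U" for x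
      using density_estimate[OF kS[OF that]] by (simp add: w_def gk[OF that] \<beta>_def[OF kS[OF that]])
    show "(\<lambda>x. indicator U x * (exp (- t * ((norm x)\<^sup>2 + (h x)\<^sup>2)) * w x)) \<in> borel_measurable lborel"
      using measF by (simp add: F_def)
    show "(\<integral>z. indicator (ball 0 \<delta>) z * (exp (- t * (norm (\<psi> z))\<^sup>2) * norm (N z)) \<partial>lborel) =
     (\<integral>x. indicator U x * (exp (- t * ((norm x)\<^sup>2 + (h x)\<^sup>2)) * w x) \<partial>lborel)"
      using main by (simp add: F_def G_def S_def)
  qed
qed

end

text \<open>\<open>C\<close> is chosen before the patch: this uniformity is what later permits
  integration of the expansion over the base point. The graph inherits the radius
  \<open>\<delta> / 4\<close>, and \<open>K\<close> grows to \<open>6008 * K ^ 4\<close>.\<close>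

lemma normalized_patch_gaussian:
  assumes R: "0 < R" and K: "1 \<le> K"
  shows "\<exists>C. \<forall>\<psi> D B t. normalized_patch \<psi> D B R K \<longrightarrow> t \<ge> 1 \<longrightarrow>
    (let n = cross3 (D 0 (axis 1 1)) (D 0 (axis 2 1)); a = B (axis 1 1) (axis 1 1) \<bullet> n;
         b = B (axis 1 1) (axis 2 1) \<bullet> n; c = B (axis 2 1) (axis 2 1) \<bullet> n in
     \<bar>(\<integral>z. indicator (ball 0 (min R (1 / (20 * K)))) z * (exp (- t * (norm (\<psi> z))\<^sup>2) * norm (cross3 (D z (axis 1 1)) (D z (axis 2 1)))) \<partial>lborel)
       - (pi / t + pi / 16 * ((a - c)\<^sup>2 + 4 * b\<^sup>2) / t\<^sup>2)\<bar> \<le> C * t powr (-5/2))"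
proof -
  define \<rho> where "\<rho> = min R (1 / (20 * K)) / 4"
  define K2 where "K2 = 6008 * K ^ 4"
  have \<rho>: "0 < \<rho>" using R K by (simp add: \<rho>_def)
  have K2: "0 \<le> K2" "K \<le> K2"
    using K self_le_power[of K 4] by (auto simp: K2_def)
  obtain C where C: "\<And>U h w a b c t. t \<ge> 1 \<Longrightarrow> ball 0 \<rho> \<subseteq> U \<Longrightarrow> U \<subseteq> ball (0 :: real^2) 1 \<Longrightarrow>
     \<bar>a\<bar> \<le> K2 \<Longrightarrow> \<bar>b\<bar> \<le> K2 \<Longrightarrow> \<bar>c\<bar> \<le> K2 \<Longrightarrow>
     (\<forall>x\<in>U. \<bar>h x - (a * (x$1)\<^sup>2 + 2 * b * (x$1) * (x$2) + c * (x$2)\<^sup>2) / 2\<bar> \<le> K2 * norm x ^ 3) \<Longrightarrow>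
     (\<forall>x\<in>U. \<bar>w x - 1 - ((a * x$1 + b * x$2)\<^sup>2 + (b * x$1 + c * x$2)\<^sup>2) / 2\<bar> \<le> K2 * norm x ^ 3) \<Longrightarrow>
     (\<lambda>x. indicator U x * (exp (- t * ((norm x)\<^sup>2 + (h x)\<^sup>2)) * w x)) \<in> borel_measurable lborel \<Longrightarrow>
     \<bar>(\<integral>x. indicator U x * (exp (- t * ((norm x)\<^sup>2 + (h x)\<^sup>2)) * w x) \<partial>lborel) - (pi / t + pi / 16 * ((a - c)\<^sup>2 + 4 * b\<^sup>2) / t\<^sup>2)\<bar>
       \<le> C * t powr (-5/2)"
    using gaussian_graph_asymptotics[OF \<rho> K2(1)] by blast
  show ?thesis
  proof (intro exI[of _ C] allI impI)
    fix \<psi> D B and t :: real assume np: "normalized_patch \<psi> D B R K" and t: "t \<ge> 1"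
    interpret normalized_patch \<psi> D B R K by (rule np)
    define a where "a = B (axis 1 1) (axis 1 1) \<bullet> nu"
    define b where "b = B (axis 1 1) (axis 2 1) \<bullet> nu"
    define c where "c = B (axis 2 1) (axis 2 1) \<bullet> nu"
    have bd: "\<bar>B v v' \<bullet> nu\<bar> \<le> K2" if "norm v = 1" "norm v' = 1" for v v'
      using order_trans[OF inner_e_le(3)[of "B v v'"] Bb[of v v']] that K2 by simp
    obtain U h w where U: "ball 0 (\<delta> / 4) \<subseteq> U" "U \<subseteq> ball 0 1"
      and h: "\<And>x. x \<in> U \<Longrightarrow> \<bar>h x - B x x \<bullet> nu / 2\<bar> \<le> 6008 * K ^ 4 * norm x ^ 3"
      and w: "\<And>x. x \<in> U \<Longrightarrow> \<bar>w x - 1 - ((B x (axis 1 1) \<bullet> nu)\<^sup>2 + (B x (axis 2 1) \<bullet> nu)\<^sup>2) / 2\<bar> \<le> 6008 * K ^ 4 * norm x ^ 3"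
      and meas: "(\<lambda>x. indicator U x * (exp (- t * ((norm x)\<^sup>2 + (h x)\<^sup>2)) * w x)) \<in> borel_measurable lborel"
      and eq: "(\<integral>z. indicator (ball 0 \<delta>) z * (exp (- t * (norm (\<psi> z))\<^sup>2) * norm (N z)) \<partial>lborel) =
       (\<integral>x. indicator U x * (exp (- t * ((norm x)\<^sup>2 + (h x)\<^sup>2)) * w x) \<partial>lborel)"
      using gaussian_change_of_variables[of t] t by auto
    have "\<bar>(\<integral>x. indicator U x * (exp (- t * ((norm x)\<^sup>2 + (h x)\<^sup>2)) * w x) \<partial>lborel) - (pi / t + pi / 16 * ((a - c)\<^sup>2 + 4 * b\<^sup>2) / t\<^sup>2)\<bar> \<le> C * t powr (-5/2)"
    proof (rule C[OF t _ U(2) _ _ _ _ _ meas])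
      show "ball 0 \<rho> \<subseteq> U" using U(1) by (simp add: \<rho>_def \<delta>_def)
      show "\<bar>a\<bar> \<le> K2" "\<bar>b\<bar> \<le> K2" "\<bar>c\<bar> \<le> K2" unfolding a_def b_def c_def
        by (intro bd norm_axis_1)+
      show "\<forall>x\<in>U. \<bar>h x - (a * (x$1)\<^sup>2 + 2 * b * (x$1) * (x$2) + c * (x$2)\<^sup>2) / 2\<bar> \<le> K2 * norm x ^ 3"
      proof
        fix x assume "x \<in> U"
        from h[OF this, unfolded B_nu_quadratic(1)[of x]]
        show "\<bar>h x - (a * (x$1)\<^sup>2 + 2 * b * (x$1) * (x$2) + c * (x$2)\<^sup>2) / 2\<bar> \<le> K2 * norm x ^ 3"
          unfolding a_def b_def c_def K2_def .
      qed
      show "\<forall>x\<in>U. \<bar>w x - 1 - ((a * x$1 + b * x$2)\<^sup>2 + (b * x$1 + c * x$2)\<^sup>2) / 2\<bar> \<le> K2 * norm x ^ 3"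
      proof
        fix x assume "x \<in> U"
        from w[OF this, unfolded B_nu_quadratic(2,3)[of x]]
        show "\<bar>w x - 1 - ((a * x$1 + b * x$2)\<^sup>2 + (b * x$1 + c * x$2)\<^sup>2) / 2\<bar> \<le> K2 * norm x ^ 3"
          unfolding a_def b_def c_def K2_def .
      qed
    qed
    then show "let n = cross3 (D 0 (axis 1 1)) (D 0 (axis 2 1)); a = B (axis 1 1) (axis 1 1) \<bullet> n;
         b = B (axis 1 1) (axis 2 1) \<bullet> n; c = B (axis 2 1) (axis 2 1) \<bullet> n in
     \<bar>(\<integral>z. indicator (ball 0 (min R (1 / (20 * K)))) z * (exp (- t * (norm (\<psi> z))\<^sup>2) * norm (cross3 (D z (axis 1 1)) (D z (axis 2 1)))) \<partial>lborel)
       - (pi / t + pi / 16 * ((a - c)\<^sup>2 + 4 * b\<^sup>2) / t\<^sup>2)\<bar> \<le> C * t powr (-5/2)"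
      unfolding Let_def eq[symmetric] a_def b_def c_def N_def \<delta>_def nu_def e1_def e2_def .
  qed
qed

section \<open>Taylor estimates in a chart\<close>

lemma smooth_on_dir_deriv_bound:
  fixes g :: "real^2 \<Rightarrow> 'b::real_normed_vector"
  assumes g: "smooth_on g V" and C: "compact C" "C \<subseteq> V"
  shows "\<exists>M\<ge>0. \<forall>y\<in>C. \<forall>v. norm (dir_deriv v g y) \<le> M * norm v"
proof -
  have "\<exists>m. \<forall>y\<in>C. norm (dir_deriv e g y) \<le> m" for e
  proof -
    have "compact (dir_deriv e g ` C)"
      using continuous_on_subset[OF smooth_on_continuous[OF smooth_on_dir_deriv[OF g]] C(2)] C(1)
      by (rule compact_continuous_image)
    then show ?thesis using compact_imp_bounded bounded_iff by (metis imageI)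
  qed
  then obtain m1 m2 where m: "\<And>y. y \<in> C \<Longrightarrow> norm (dir_deriv (axis 1 1) g y) \<le> m1" "\<And>y. y \<in> C \<Longrightarrow> norm (dir_deriv (axis 2 1) g y) \<le> m2"
    by metis
  have "norm (dir_deriv v g y) \<le> (\<bar>m1\<bar> + \<bar>m2\<bar>) * norm v" if y: "y \<in> C" for y v
  proof -
    have "dir_deriv v g y = (v$1) *\<^sub>R dir_deriv (axis 1 1) g y + (v$2) *\<^sub>R dir_deriv (axis 2 1) g y"
      by (rule linear_2[OF linear_dir_deriv[OF g]]) (use y C in auto)
    then have "norm (dir_deriv v g y) \<le> \<bar>v$1\<bar> * norm (dir_deriv (axis 1 1) g y) + \<bar>v$2\<bar> * norm (dir_deriv (axis 2 1) g y)"
      using norm_triangle_ineq[of "(v$1) *\<^sub>R dir_deriv (axis 1 1) g y" "(v$2) *\<^sub>R dir_deriv (axis 2 1) g y"]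
      by simp
    also have "\<dots> \<le> norm v * \<bar>m1\<bar> + norm v * \<bar>m2\<bar>"
      using m[OF y] component_le_norm_cart[of v]
      by (intro add_mono mult_mono) (auto intro: order_trans[OF _ abs_ge_self])
    finally show ?thesis by (simp add: algebra_simps)
  qed
  then show ?thesis by (intro exI[of _ "\<bar>m1\<bar> + \<bar>m2\<bar>"]) auto
qed

text \<open>Linearity in the inner direction \<open>w\<close> is not formal:
  \<open>dir_deriv w g\<close> is linear in \<open>w\<close> at the points of \<open>V\<close>, and
  openness of \<open>V\<close> lets this identity be differentiated at \<open>x\<close>.\<close>

lemma dir_deriv_second_linear:
  fixes g :: "real^2 \<Rightarrow> 'b::real_normed_vector"
  assumes g: "smooth_on g V" and V: "open V" "x \<in> V"
  shows "dir_deriv v (dir_deriv w g) x = (w$1) *\<^sub>R dir_deriv v (dir_deriv (axis 1 1) g) x + (w$2) *\<^sub>R dir_deriv v (dir_deriv (axis 2 1) g) x"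
proof -
  have d: "(dir_deriv e g has_derivative (\<lambda>v. dir_deriv v (dir_deriv e g) x)) (at x)" for e
    by (rule smooth_on_has_derivative[OF smooth_on_dir_deriv[OF g] V(2)])
  have "((\<lambda>y. (w$1) *\<^sub>R dir_deriv (axis 1 1) g y + (w$2) *\<^sub>R dir_deriv (axis 2 1) g y) has_derivative
      (\<lambda>v. (w$1) *\<^sub>R dir_deriv v (dir_deriv (axis 1 1) g) x + (w$2) *\<^sub>R dir_deriv v (dir_deriv (axis 2 1) g) x)) (at x)"
    by (intro has_derivative_add has_derivative_scaleR_right d)
  then have "(dir_deriv w g has_derivative
      (\<lambda>v. (w$1) *\<^sub>R dir_deriv v (dir_deriv (axis 1 1) g) x + (w$2) *\<^sub>R dir_deriv v (dir_deriv (axis 2 1) g) x)) (at x)"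
    by (rule has_derivative_transform_within_open[OF _ V]) (simp add: linear_2[OF linear_dir_deriv[OF g], symmetric])
  then show ?thesis using fun_cong[OF has_derivative_unique[OF d[of w]], of _ v] by simp
qed

lemma bilinear_dir_deriv_second:
  fixes g :: "real^2 \<Rightarrow> 'b::real_normed_vector"
  assumes g: "smooth_on g V" and V: "open V" "x \<in> V"
  shows "bilinear (\<lambda>v w. dir_deriv v (dir_deriv w g) x)"
  unfolding bilinear_def
proof (intro conjI allI)
  show "linear (\<lambda>w. dir_deriv v (dir_deriv w g) x)" for v
  proof -
    have "(\<lambda>w. dir_deriv v (dir_deriv w g) x) = (\<lambda>w. (w$1) *\<^sub>R dir_deriv v (dir_deriv (axis 1 1) g) x + (w$2) *\<^sub>R dir_deriv v (dir_deriv (axis 2 1) g) x)"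
      by (rule ext) (rule dir_deriv_second_linear[OF assms])
    moreover have "linear (\<lambda>w :: real^2. (w$1) *\<^sub>R a + (w$2) *\<^sub>R b)" for a b :: 'b
      by (rule linearI) (simp_all add: algebra_simps)
    ultimately show ?thesis by simp
  qed
  show "linear (\<lambda>v. dir_deriv v (dir_deriv w g) x)" for w
    by (rule linear_dir_deriv[OF smooth_on_dir_deriv[OF g] V(2)])
qed

text \<open>Both mixed derivatives are limits of the same second difference quotient; total differentiability
  of the two first derivatives at the single point \<open>x\<close> is enough.\<close>
lemma second_difference_bound:
  fixes f :: "'a::real_normed_vector \<Rightarrow> real"
  assumes S: "open S" "x \<in> S" and f: "\<And>y. y \<in> S \<Longrightarrow> (f has_derivative f' y) (at y)"
    and F: "((\<lambda>y. f' y v) has_derivative F) (at x)" and e: "e > 0"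
  shows "\<exists>d>0. \<forall>h. 0 < h \<and> h < d \<longrightarrow>
    \<bar>f (x + h *\<^sub>R v + h *\<^sub>R w) - f (x + h *\<^sub>R v) - f (x + h *\<^sub>R w) + f x - h\<^sup>2 * F w\<bar> \<le> e * h\<^sup>2"
proof -
  \<comment> \<open>The summand 1 keeps \<open>m\<close> positive when \<open>v\<close> and
    \<open>w\<close> vanish; the factor 2 anticipates that the remainder is used at two
    points.\<close>
  define m where "m = 2 * (norm v + norm w) + 1"
  have m: "m > 0" by (simp add: m_def add_nonneg_pos)
  have linF: "linear F" using F has_derivative_linear by blast
  obtain r where r: "r > 0" "ball x r \<subseteq> S" using S openE by blast
  obtain d0 where d0: "d0 > 0" "\<And>y. norm (y - x) < d0 \<Longrightarrow> \<bar>f' y v - f' x v - F (y - x)\<bar> \<le> e / m * norm (y - x)"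
    using F e m unfolding has_derivative_at_alt by (metis divide_pos_pos real_norm_def)
  define d where "d = min r d0 / m"
  have d: "d > 0" using r d0 m by (simp add: d_def)
  have "\<bar>f (x + h *\<^sub>R v + h *\<^sub>R w) - f (x + h *\<^sub>R v) - f (x + h *\<^sub>R w) + f x - h\<^sup>2 * F w\<bar> \<le> e * h\<^sup>2" if h: "0 < h" "h < d" for h
  proof -
    have hm: "h * m < min r d0" using h m by (simp add: d_def pos_less_divide_eq)
    have near: "norm (s *\<^sub>R v + k *\<^sub>R w) \<le> h * (norm v + norm w)" if "0 \<le> s" "s \<le> h" "0 \<le> k" "k \<le> h" for s k
    proof -
      have "norm (s *\<^sub>R v + k *\<^sub>R w) \<le> s * norm v + k * norm w"
        using norm_triangle_ineq[of "s *\<^sub>R v" "k *\<^sub>R w"] that by simp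
      also have "\<dots> \<le> h * norm v + h * norm w" using that by (intro add_mono mult_right_mono) auto
      finally show ?thesis by (simp add: algebra_simps)
    qed
    have hvw: "h * (norm v + norm w) < min r d0"
    proof -
      have "h * (norm v + norm w) \<le> h * m" using h by (intro mult_left_mono) (auto simp: m_def)
      then show ?thesis using hm by linarith
    qed
    have inS: "x + (s *\<^sub>R v + k *\<^sub>R w) \<in> S" if "0 \<le> s" "s \<le> h" "0 \<le> k" "k \<le> h" for s k
    proof -
      have "dist x (x + y) = norm y" for y by (simp add: dist_norm)
      then show ?thesis using near[OF that] hvw by (intro subsetD[OF r(2)]) (simp only: mem_ball)
    qed
    have d1: "((\<lambda>s. f (x + (s *\<^sub>R v + k *\<^sub>R w))) has_derivative (\<lambda>t. f' (x + (s *\<^sub>R v + k *\<^sub>R w)) (t *\<^sub>R v))) (at s)"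
      if "0 \<le> s" "s \<le> h" "0 \<le> k" "k \<le> h" for s k
    proof -
      have "((\<lambda>s. x + (s *\<^sub>R v + k *\<^sub>R w)) has_derivative (\<lambda>t. t *\<^sub>R v)) (at s)"
        by (auto intro!: derivative_eq_intros)
      from diff_chain_at[OF this f[OF inS[OF that]]] show ?thesis by (simp add: o_def)
    qed
    \<comment> \<open>The second difference is the increment over \<open>[0, h]\<close> of a first
      difference in direction \<open>w\<close>. The mean value theorem in direction \<open>v\<close>
      leaves a difference of \<open>f'\<close> at two points, which \<open>F\<close>
      controls.\<close>
    define g where "g = (\<lambda>s. f (x + (s *\<^sub>R v + h *\<^sub>R w)) - f (x + (s *\<^sub>R v + 0 *\<^sub>R w)))"
    have lin: "f' y (t *\<^sub>R v) = t * f' y v" if "y \<in> S" for y t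
      using has_derivative_linear[OF f[OF that]] by (simp add: linear_scale)
    have dg: "(g has_derivative (\<lambda>t. t * (f' (x + (s *\<^sub>R v + h *\<^sub>R w)) v - f' (x + (s *\<^sub>R v + 0 *\<^sub>R w)) v))) (at s)" if s: "0 \<le> s" "s \<le> h" for s
    proof -
      have "(g has_derivative (\<lambda>t. f' (x + (s *\<^sub>R v + h *\<^sub>R w)) (t *\<^sub>R v) - f' (x + (s *\<^sub>R v + 0 *\<^sub>R w)) (t *\<^sub>R v))) (at s)"
        unfolding g_def using d1[OF s, of h] d1[OF s, of 0] h by (intro has_derivative_diff) auto
      moreover have "f' (x + (s *\<^sub>R v + h *\<^sub>R w)) (t *\<^sub>R v) - f' (x + (s *\<^sub>R v + 0 *\<^sub>R w)) (t *\<^sub>R v) =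
         t * (f' (x + (s *\<^sub>R v + h *\<^sub>R w)) v - f' (x + (s *\<^sub>R v + 0 *\<^sub>R w)) v)" for t
        using lin[OF inS[of s h]] lin[OF inS[of s 0]] s h by (simp add: right_diff_distrib)
      ultimately show ?thesis by simp
    qed
    have contg: "continuous_on {0..h} g"
      using dg by (intro continuous_at_imp_continuous_on ballI has_derivative_continuous) auto
    obtain s where s: "0 < s" "s < h" and gs: "g h - g 0 = (h - 0) * (f' (x + (s *\<^sub>R v + h *\<^sub>R w)) v - f' (x + (s *\<^sub>R v + 0 *\<^sub>R w)) v)"
      using mvt[OF h(1) contg, of "\<lambda>s t. t * (f' (x + (s *\<^sub>R v + h *\<^sub>R w)) v - f' (x + (s *\<^sub>R v + 0 *\<^sub>R w)) v)"] dg
      by auto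
    have est: "\<bar>f' (x + (s *\<^sub>R v + k *\<^sub>R w)) v - f' x v - F (s *\<^sub>R v + k *\<^sub>R w)\<bar> \<le> e / m * (h * (norm v + norm w))" if "0 \<le> k" "k \<le> h" for k
    proof -
      have "\<bar>f' (x + (s *\<^sub>R v + k *\<^sub>R w)) v - f' x v - F (s *\<^sub>R v + k *\<^sub>R w)\<bar> \<le> e / m * norm (s *\<^sub>R v + k *\<^sub>R w)"
        using d0(2)[of "x + (s *\<^sub>R v + k *\<^sub>R w)"] near[of s k] hvw s that by simp
      also have "\<dots> \<le> e / m * (h * (norm v + norm w))" using near[of s k] s that e m
        by (intro mult_left_mono) auto
      finally show ?thesis .
    qed
    have Fd: "F (s *\<^sub>R v + h *\<^sub>R w) - F (s *\<^sub>R v + 0 *\<^sub>R w) = h * F w"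
      by (simp add: linear_add[OF linF] linear_scale[OF linF])
    define A where "A = f' (x + (s *\<^sub>R v + h *\<^sub>R w)) v - f' (x + (s *\<^sub>R v + 0 *\<^sub>R w)) v"
    have A: "\<bar>A - h * F w\<bar> \<le> e * h"
    proof -
      have "\<bar>A - h * F w\<bar> \<le> 2 * (e / m * (h * (norm v + norm w)))"
        using est[of h] est[of 0] h Fd unfolding A_def by linarith
      also have "\<dots> = e * h * (2 * (norm v + norm w) / m)" by simp
      also have "\<dots> \<le> e * h * 1" using e h m by (intro mult_left_mono) (auto simp: m_def)
      finally show ?thesis by simp
    qed
    have "f (x + h *\<^sub>R v + h *\<^sub>R w) - f (x + h *\<^sub>R v) - f (x + h *\<^sub>R w) + f x = g h - g 0"
      by (simp add: g_def add.assoc)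
    also have "\<dots> = h * A" using gs by (simp add: A_def)
    finally have "f (x + h *\<^sub>R v + h *\<^sub>R w) - f (x + h *\<^sub>R v) - f (x + h *\<^sub>R w) + f x - h\<^sup>2 * F w = h * (A - h * F w)"
      by (simp add: power2_eq_square right_diff_distrib)
    then have "\<bar>f (x + h *\<^sub>R v + h *\<^sub>R w) - f (x + h *\<^sub>R v) - f (x + h *\<^sub>R w) + f x - h\<^sup>2 * F w\<bar> = h * \<bar>A - h * F w\<bar>"
      using h by (simp add: abs_mult)
    also have "\<dots> \<le> h * (e * h)" using A h by (intro mult_left_mono) auto
    finally show ?thesis by (simp add: power2_eq_square mult_ac)
  qed
  then show ?thesis using d by blast
qed

lemma second_derivative_symmetric_real:
  fixes f :: "'a::real_normed_vector \<Rightarrow> real"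
  assumes S: "open S" "x \<in> S" and f: "\<And>y. y \<in> S \<Longrightarrow> (f has_derivative f' y) (at y)"
    and F: "((\<lambda>y. f' y v) has_derivative F) (at x)" and G: "((\<lambda>y. f' y w) has_derivative G) (at x)"
  shows "F w = G v"
proof (rule ccontr)
  assume ne: "F w \<noteq> G v"
  define e where "e = \<bar>F w - G v\<bar> / 4"
  have e: "e > 0" using ne by (simp add: e_def)
  obtain d1 where d1: "d1 > 0" "\<And>h. 0 < h \<and> h < d1 \<Longrightarrow> \<bar>f (x + h *\<^sub>R v + h *\<^sub>R w) - f (x + h *\<^sub>R v) - f (x + h *\<^sub>R w) + f x - h\<^sup>2 * F w\<bar> \<le> e * h\<^sup>2"
    using second_difference_bound[OF S f F e, of w] by blast
  obtain d2 where d2: "d2 > 0" "\<And>h. 0 < h \<and> h < d2 \<Longrightarrow> \<bar>f (x + h *\<^sub>R w + h *\<^sub>R v) - f (x + h *\<^sub>R w) - f (x + h *\<^sub>R v) + f x - h\<^sup>2 * G v\<bar> \<le> e * h\<^sup>2"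
    using second_difference_bound[OF S f G e, of v] by blast
  define h where "h = min d1 d2 / 2"
  have h: "0 < h" "h < d1" "h < d2" using d1 d2 by (auto simp: h_def)
  define \<Delta> where "\<Delta> = f (x + h *\<^sub>R v + h *\<^sub>R w) - f (x + h *\<^sub>R v) - f (x + h *\<^sub>R w) + f x"
  have "\<Delta> = f (x + h *\<^sub>R w + h *\<^sub>R v) - f (x + h *\<^sub>R w) - f (x + h *\<^sub>R v) + f x"
    by (simp add: \<Delta>_def add.assoc add.commute[of "h *\<^sub>R v"])
  then have "\<bar>h\<^sup>2 * F w - h\<^sup>2 * G v\<bar> \<le> 2 * (e * h\<^sup>2)"
    using d1(2)[of h] d2(2)[of h] h unfolding \<Delta>_def by linarith
  moreover have "\<bar>h\<^sup>2 * F w - h\<^sup>2 * G v\<bar> = h\<^sup>2 * \<bar>F w - G v\<bar>"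
    by (simp add: right_diff_distrib[symmetric] abs_mult)
  ultimately have "h\<^sup>2 * \<bar>F w - G v\<bar> \<le> h\<^sup>2 * (2 * e)" by (simp add: mult_ac)
  then have "\<bar>F w - G v\<bar> \<le> 2 * e" using h by simp
  then show False using e by (simp add: e_def)
qed

lemma second_derivative_symmetric:
  fixes f :: "'a::real_normed_vector \<Rightarrow> 'b::euclidean_space"
  assumes S: "open S" "x \<in> S" and f: "\<And>y. y \<in> S \<Longrightarrow> (f has_derivative f' y) (at y)"
    and F: "((\<lambda>y. f' y v) has_derivative F) (at x)" and G: "((\<lambda>y. f' y w) has_derivative G) (at x)"
  shows "F w = G v"
proof (rule euclidean_eqI)
  fix b :: 'b
  show "F w \<bullet> b = G v \<bullet> b"
    by (rule second_derivative_symmetric_real[OF S, of "\<lambda>y. f y \<bullet> b" "\<lambda>y u. f' y u \<bullet> b" v "\<lambda>u. F u \<bullet> b" w "\<lambda>u. G u \<bullet> b"])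
      (intro has_derivative_inner_left f F G; assumption)+
qed

lemma dir_deriv_commute:
  fixes g :: "real^2 \<Rightarrow> 'b::euclidean_space"
  assumes g: "smooth_on g V" and V: "open V" "x \<in> V"
  shows "dir_deriv v (dir_deriv w g) x = dir_deriv w (dir_deriv v g) x"
  using second_derivative_symmetric[OF V smooth_on_has_derivative[OF g]
    smooth_on_has_derivative[OF smooth_on_dir_deriv[OF g] V(2)] smooth_on_has_derivative[OF smooth_on_dir_deriv[OF g] V(2)], of w v]
  by simp

section \<open>Taylor bounds that are uniform on a compact set\<close>

lemma taylor_first_order:
  fixes g :: "real^2 \<Rightarrow> 'b::euclidean_space"
  assumes g: "smooth_on g V" and C: "compact C" "convex C" "C \<subseteq> V" and V: "open V"
  shows "\<exists>M\<ge>0. \<forall>x\<in>C. \<forall>y\<in>C. norm (g y - g x - dir_deriv (y - x) g x) \<le> M * (norm (y - x))\<^sup>2"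
proof -
  obtain M1 where M1: "M1 \<ge> 0" "\<And>y v. y \<in> C \<Longrightarrow> norm (dir_deriv v (dir_deriv (axis 1 1) g) y) \<le> M1 * norm v"
    using smooth_on_dir_deriv_bound[OF smooth_on_dir_deriv[OF g] C(1,3)] by blast
  obtain M2 where M2: "M2 \<ge> 0" "\<And>y v. y \<in> C \<Longrightarrow> norm (dir_deriv v (dir_deriv (axis 2 1) g) y) \<le> M2 * norm v"
    using smooth_on_dir_deriv_bound[OF smooth_on_dir_deriv[OF g] C(1,3)] by blast
  have lip: "norm (dir_deriv w g y - dir_deriv w g x) \<le> (M1 + M2) * norm w * norm (y - x)" if xy: "x \<in> C" "y \<in> C" for x y w
  proof (rule differentiable_bound[OF C(2) _ _ xy(2,1)])
    fix z assume z: "z \<in> C"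
    then have zV: "z \<in> V" using C by auto
    show "(dir_deriv w g has_derivative (\<lambda>v. dir_deriv v (dir_deriv w g) z)) (at z within C)"
      by (rule has_derivative_at_withinI[OF smooth_on_has_derivative[OF smooth_on_dir_deriv[OF g] zV]])
    show "onorm (\<lambda>v. dir_deriv v (dir_deriv w g) z) \<le> (M1 + M2) * norm w"
    proof (rule onorm_le)
      fix v
      have "norm (dir_deriv v (dir_deriv w g) z) \<le> \<bar>w$1\<bar> * norm (dir_deriv v (dir_deriv (axis 1 1) g) z) + \<bar>w$2\<bar> * norm (dir_deriv v (dir_deriv (axis 2 1) g) z)"
        unfolding dir_deriv_second_linear[OF g V zV, of v w]
        by (rule order_trans[OF norm_triangle_ineq]) simp
      also have "\<dots> \<le> norm w * (M1 * norm v) + norm w * (M2 * norm v)"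
        using M1 M2 z component_le_norm_cart[of w] by (intro add_mono mult_mono) auto
      finally show "norm (dir_deriv v (dir_deriv w g) z) \<le> (M1 + M2) * norm w * norm v" by (simp add: algebra_simps)
    qed
  qed
  have "norm (g y - g x - dir_deriv (y - x) g x) \<le> (M1 + M2) * (norm (y - x))\<^sup>2" if xy: "x \<in> C" "y \<in> C" for x y
  proof -
    define S where "S = closed_segment x y"
    have S: "S \<subseteq> C" "x \<in> S" "y \<in> S" "convex S" using xy C(2)
      by (auto simp: S_def closed_segment_subset)
    have xV: "x \<in> V" using xy C by auto
    have lin: "linear (\<lambda>v. dir_deriv v g x)" by (rule linear_dir_deriv[OF g xV])
    \<comment> \<open>Subtracting the linear part at \<open>x\<close> makes the derivative vanish at
      \<open>x\<close>, so its Lipschitz bound gives a quadratic bound along the segment.\<close>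
    define h where "h = (\<lambda>z. g z - dir_deriv z g x)"
    have "norm (h y - h x) \<le> ((M1 + M2) * norm (y - x)) * norm (y - x)"
    proof (rule differentiable_bound[OF S(4) _ _ S(3,2)])
      fix z :: "real^2" assume z: "z \<in> S"
      then have zC: "z \<in> C" and zV: "z \<in> V" using S C by auto
      show "(h has_derivative (\<lambda>v. dir_deriv v g z - dir_deriv v g x)) (at z within S)"
        unfolding h_def using lin
        by (intro has_derivative_diff has_derivative_at_withinI[OF smooth_on_has_derivative[OF g zV]] bounded_linear_imp_has_derivative)
          (simp add: linear_conv_bounded_linear)
      show "onorm (\<lambda>v. dir_deriv v g z - dir_deriv v g x) \<le> (M1 + M2) * norm (y - x)"
      proof (rule onorm_le)
        fix v :: "real^2"
        have "norm (z - x) \<le> norm (y - x)" using z segment_bound(1)[of z x y]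
          by (simp add: S_def norm_minus_commute)
        then have "(M1 + M2) * norm v * norm (z - x) \<le> (M1 + M2) * norm v * norm (y - x)" using M1 M2
          by (intro mult_left_mono) auto
        then show "norm (dir_deriv v g z - dir_deriv v g x) \<le> (M1 + M2) * norm (y - x) * norm v"
          using lip[OF xy(1) zC, of v] by (simp add: mult_ac)
      qed
    qed
    then show ?thesis by (simp add: h_def linear_diff[OF lin] power2_eq_square algebra_simps)
  qed
  then show ?thesis using M1 M2 by (intro exI[of _ "M1 + M2"]) auto
qed

lemma area_density_pos:
  assumes \<phi>: "smooth_on \<phi> V" and x: "x \<in> V" and inj: "inj (\<lambda>v. dir_deriv v \<phi> x)"
  shows "area_density \<phi> x > 0"
proof -
  have lin: "linear (\<lambda>v. dir_deriv v \<phi> x)" by (rule linear_dir_deriv[OF \<phi> x])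
  have i: "a = b" if "dir_deriv a \<phi> x = dir_deriv b \<phi> x" for a b
    using injD[OF inj] that by blast
  have "cross3 (dir_deriv (axis 1 1) \<phi> x) (dir_deriv (axis 2 1) \<phi> x) \<noteq> 0"
  proof
    define u where "u = dir_deriv (axis 1 1) \<phi> x"
    define v where "v = dir_deriv (axis 2 1) \<phi> x"
    assume "cross3 (dir_deriv (axis 1 1) \<phi> x) (dir_deriv (axis 2 1) \<phi> x) = 0"
    then have c: "cross3 u v = 0" by (simp add: u_def v_def)
    \<comment> \<open>The double cross product turns \<open>cross3 u v = 0\<close> into an explicit
      linear relation between \<open>u\<close> and \<open>v\<close>, that is, into a vector in the
      kernel of the derivative.\<close>
    have "cross3 (cross3 u v) u = (u \<bullet> u) *\<^sub>R v - (v \<bullet> u) *\<^sub>R u" by (rule cross_cross_left)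
    then have "(u \<bullet> u) *\<^sub>R v - (v \<bullet> u) *\<^sub>R u = 0" using c by simp
    then have "dir_deriv (vector [- (v \<bullet> u), u \<bullet> u]) \<phi> x = dir_deriv 0 \<phi> x"
      unfolding linear_2[OF lin, of "vector [- (v \<bullet> u), u \<bullet> u]"] linear_0[OF lin]
      by (simp add: vector_2 u_def v_def algebra_simps)
    then have "(vector [- (v \<bullet> u), u \<bullet> u] :: real^2) = 0" by (rule i)
    then have "(vector [- (v \<bullet> u), u \<bullet> u] :: real^2) $ 2 = 0" by simp
    then have "u = 0" by (simp add: vector_2)
    then have "dir_deriv (axis 1 1) \<phi> x = dir_deriv 0 \<phi> x" using linear_0[OF lin] by (simp add: u_def)
    then have "axis 1 1 = (0 :: real^2)" by (rule i)
    then show False by (simp add: axis_eq_0_iff)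
  qed
  then show ?thesis by (simp add: area_density_dir_deriv)
qed

text \<open>Continuity on the compact \<open>C\<close> yields one constant for all base points. The
  last bound keeps the area density away from 0, so that the linear maps which orthonormalize the
  derivative are bounded as well.\<close>

lemma chart_taylor_bounds:
  fixes \<phi> :: "real^2 \<Rightarrow> real^3"
  assumes \<phi>: "smooth_on \<phi> V" and V: "open V" and inj: "\<And>x. x \<in> V \<Longrightarrow> inj (\<lambda>v. dir_deriv v \<phi> x)" and C: "compact C" "convex C" "C \<subseteq> V"
  shows "\<exists>K\<ge>1. \<forall>x\<in>C. (\<forall>v. norm (dir_deriv v \<phi> x) \<le> K * norm v) \<and>
      (\<forall>v w. norm (dir_deriv v (dir_deriv w \<phi>) x) \<le> K * norm v * norm w) \<and>
      (\<forall>w. \<forall>y\<in>C. norm (dir_deriv w \<phi> y - dir_deriv w \<phi> x - dir_deriv (y - x) (dir_deriv w \<phi>) x) \<le> K * (norm (y - x))\<^sup>2 * norm w) \<and>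
      1 \<le> K * area_density \<phi> x"
proof -
  obtain M0 where M0: "M0 \<ge> 0" "\<And>y v. y \<in> C \<Longrightarrow> norm (dir_deriv v \<phi> y) \<le> M0 * norm v"
    using smooth_on_dir_deriv_bound[OF \<phi> C(1,3)] by blast
  obtain M1 where M1: "M1 \<ge> 0" "\<And>y v. y \<in> C \<Longrightarrow> norm (dir_deriv v (dir_deriv (axis 1 1) \<phi>) y) \<le> M1 * norm v"
    using smooth_on_dir_deriv_bound[OF smooth_on_dir_deriv[OF \<phi>] C(1,3)] by blast
  obtain M2 where M2: "M2 \<ge> 0" "\<And>y v. y \<in> C \<Longrightarrow> norm (dir_deriv v (dir_deriv (axis 2 1) \<phi>) y) \<le> M2 * norm v"
    using smooth_on_dir_deriv_bound[OF smooth_on_dir_deriv[OF \<phi>] C(1,3)] by blast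
  obtain T1 where T1: "T1 \<ge> 0" "\<And>x y. x \<in> C \<Longrightarrow> y \<in> C \<Longrightarrow> norm (dir_deriv (axis 1 1) \<phi> y - dir_deriv (axis 1 1) \<phi> x - dir_deriv (y - x) (dir_deriv (axis 1 1) \<phi>) x) \<le> T1 * (norm (y - x))\<^sup>2"
    using taylor_first_order[OF smooth_on_dir_deriv[OF \<phi>] C V] by blast
  obtain T2 where T2: "T2 \<ge> 0" "\<And>x y. x \<in> C \<Longrightarrow> y \<in> C \<Longrightarrow> norm (dir_deriv (axis 2 1) \<phi> y - dir_deriv (axis 2 1) \<phi> x - dir_deriv (y - x) (dir_deriv (axis 2 1) \<phi>) x) \<le> T2 * (norm (y - x))\<^sup>2"
    using taylor_first_order[OF smooth_on_dir_deriv[OF \<phi>] C V] by blast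
  have pos: "area_density \<phi> x > 0" if "x \<in> V" for x by (rule area_density_pos[OF \<phi> that inj[OF that]])
  have "\<exists>m>0. \<forall>x\<in>C. m \<le> area_density \<phi> x"
  proof (cases "C = {}")
    case False
    obtain x where "x \<in> C" "\<forall>y\<in>C. area_density \<phi> x \<le> area_density \<phi> y"
      using continuous_attains_inf[OF C(1) False continuous_on_subset[OF continuous_on_area_density[OF \<phi>] C(3)]]
      by blast
    then show ?thesis using pos C(3) by (intro exI[of _ "area_density \<phi> x"]) auto
  qed (auto intro: exI[of _ 1])
  then obtain m where m: "m > 0" "\<And>x. x \<in> C \<Longrightarrow> m \<le> area_density \<phi> x" by blast
  define K where "K = 1 + M0 + M1 + M2 + T1 + T2 + 1 / m"
  have K: "K \<ge> 1" "M0 \<le> K" "M1 + M2 \<le> K" "T1 + T2 \<le> K" "1 / m \<le> K"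
    using M0 M1 M2 T1 T2 m by (auto simp: K_def)
  show ?thesis
  proof (intro exI[of _ K] conjI K(1) ballI allI)
    fix x v assume x: "x \<in> C"
    show "norm (dir_deriv v \<phi> x) \<le> K * norm v"
      using M0(2)[OF x, of v] K(2) by (elim order_trans) (auto intro: mult_right_mono)
  next
    fix x v w assume x: "x \<in> C"
    then have xV: "x \<in> V" using C by auto
    have "norm (dir_deriv v (dir_deriv w \<phi>) x) \<le> \<bar>w$1\<bar> * norm (dir_deriv v (dir_deriv (axis 1 1) \<phi>) x) + \<bar>w$2\<bar> * norm (dir_deriv v (dir_deriv (axis 2 1) \<phi>) x)"
      unfolding dir_deriv_second_linear[OF \<phi> V xV, of v w]
      by (rule order_trans[OF norm_triangle_ineq]) simp
    also have "\<dots> \<le> norm w * (M1 * norm v) + norm w * (M2 * norm v)"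
      using M1 M2 x component_le_norm_cart[of w] by (intro add_mono mult_mono) auto
    also have "\<dots> = (M1 + M2) * (norm v * norm w)" by (simp add: algebra_simps)
    also have "\<dots> \<le> K * (norm v * norm w)" using K(3) by (intro mult_right_mono) auto
    finally show "norm (dir_deriv v (dir_deriv w \<phi>) x) \<le> K * norm v * norm w" by (simp add: mult.assoc)
  next
    fix x w y assume x: "x \<in> C" and y: "y \<in> C"
    then have xV: "x \<in> V" "y \<in> V" using C by auto
    define R where "R = (\<lambda>e. dir_deriv e \<phi> y - dir_deriv e \<phi> x - dir_deriv (y - x) (dir_deriv e \<phi>) x)"
    have "R w = (w$1) *\<^sub>R R (axis 1 1) + (w$2) *\<^sub>R R (axis 2 1)"
      unfolding R_def dir_deriv_second_linear[OF \<phi> V xV(1), of "y - x" w] linear_2[OF linear_dir_deriv[OF \<phi> xV(1)], of w] linear_2[OF linear_dir_deriv[OF \<phi> xV(2)], of w]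
      by (simp add: algebra_simps)
    then have "norm (R w) \<le> \<bar>w$1\<bar> * norm (R (axis 1 1)) + \<bar>w$2\<bar> * norm (R (axis 2 1))"
      using norm_triangle_ineq[of "(w$1) *\<^sub>R R (axis 1 1)" "(w$2) *\<^sub>R R (axis 2 1)"] by simp
    also have "\<dots> \<le> norm w * (T1 * (norm (y - x))\<^sup>2) + norm w * (T2 * (norm (y - x))\<^sup>2)"
      using T1(2)[OF x y] T2(2)[OF x y] component_le_norm_cart[of w] unfolding R_def by (intro add_mono mult_mono) auto
    also have "\<dots> = (T1 + T2) * ((norm (y - x))\<^sup>2 * norm w)" by (simp add: algebra_simps)
    also have "\<dots> \<le> K * ((norm (y - x))\<^sup>2 * norm w)" using K(4) by (intro mult_right_mono) auto
    finally show "norm (dir_deriv w \<phi> y - dir_deriv w \<phi> x - dir_deriv (y - x) (dir_deriv w \<phi>) x) \<le> K * (norm (y - x))\<^sup>2 * norm w"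
      by (simp add: R_def mult.assoc)
  next
    fix x assume x: "x \<in> C"
    have "1 = 1 / m * m" using m by simp
    also have "\<dots> \<le> K * area_density \<phi> x" using m x K by (intro mult_mono) auto
    finally show "1 \<le> K * area_density \<phi> x" .
  qed
qed

section \<open>Local expansion of the Gaussian potential\<close>

text \<open>Gram-Schmidt for the two columns of \<open>A\<close>, written as an upper triangular
  change of parameter. With \<open>c\<close> the area of the parallelogram, the denominators
  \<open>norm u\<close> and \<open>c\<close> are bounded below in terms of \<open>K\<close>, and
  each entry of \<open>L\<close> is at most \<open>K\<^sup>2\<close> in absolute value.\<close>

lemma orthonormalizing_map:
  fixes A :: "real^2 \<Rightarrow> real^3"
  assumes A: "linear A" and K: "K \<ge> 1" and Ab: "\<And>v. norm (A v) \<le> K * norm v"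
    and c: "1 \<le> K * norm (cross3 (A (axis 1 1)) (A (axis 2 1)))"
  obtains L where "linear L" "norm (A (L (axis 1 1))) = 1" "norm (A (L (axis 2 1))) = 1"
    "A (L (axis 1 1)) \<bullet> A (L (axis 2 1)) = 0" "\<And>z. norm (L z) \<le> 4 * K\<^sup>2 * norm z" "det (matrix L) > 0"
proof -
  define u where "u = A (axis 1 1)"
  define v where "v = A (axis 2 1)"
  define c where "c = norm (cross3 u v)"
  define L :: "real^2 \<Rightarrow> real^2" where "L = (\<lambda>z. (\<chi> i. if i = 1 then z$1 / norm u - z$2 * ((u \<bullet> v) / (norm u * c)) else z$2 * (norm u / c)))"
  have L1: "L z $ 1 = z$1 / norm u - z$2 * ((u \<bullet> v) / (norm u * c))" and L2: "L z $ 2 = z$2 * (norm u / c)" for z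
    by (simp_all add: L_def)
  have uv: "norm u \<le> K" "norm v \<le> K" using Ab[of "axis 1 1"] Ab[of "axis 2 1"] by (auto simp: u_def v_def)
  have Kc: "1 \<le> K * c" using c by (simp add: c_def u_def v_def)
  then have c0: "c > 0" using K by (smt (verit) c_def mult_nonneg_nonpos norm_ge_zero)
  then have u0: "norm u > 0" by (auto simp: c_def)
  have cu: "c \<le> norm u * K" unfolding c_def using norm_cross_le[of u v] uv
    by (meson mult_left_mono norm_ge_zero order_trans)
  have invc: "1 / c \<le> K" using Kc c0 by (simp add: field_simps)
  have invu: "1 / norm u \<le> K\<^sup>2"
  proof -
    have "1 \<le> K * (norm u * K)" using Kc cu K by (meson mult_left_mono order_trans zero_le_one)
    then show ?thesis using u0 by (simp add: field_simps power2_eq_square)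
  qed
  have linL: "linear L"
    by (rule linearI) (simp_all add: vec_eq_iff forall_2 L1 L2 add_divide_distrib ring_distribs)
  have AL: "A (L z) = (L z $ 1) *\<^sub>R u + (L z $ 2) *\<^sub>R v" for z
    unfolding u_def v_def by (rule linear_2[OF A])
  have AL1: "A (L (axis 1 1)) = (1 / norm u) *\<^sub>R u" by (simp add: AL L1 L2 axis_simps)
  have AL2: "A (L (axis 2 1)) = (norm u / c) *\<^sub>R v - ((u \<bullet> v) / (norm u * c)) *\<^sub>R u"
    by (simp add: AL L1 L2 axis_simps)
  have uu: "u \<bullet> u = (norm u)\<^sup>2" and vv: "v \<bullet> v = (norm v)\<^sup>2"
    by (simp_all add: power2_norm_eq_inner)
  have cc: "c\<^sup>2 = (norm u)\<^sup>2 * (norm v)\<^sup>2 - (u \<bullet> v)\<^sup>2" unfolding c_def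
    by (rule norm_cross)
  have n1: "norm (A (L (axis 1 1))) = 1" using u0 by (simp add: AL1)
  have ip: "A (L (axis 1 1)) \<bullet> A (L (axis 2 1)) = 0"
    unfolding AL1 AL2 using u0 c0 by (simp add: inner_diff_right uu power2_eq_square field_simps)
  have "(norm (A (L (axis 2 1))))\<^sup>2 = 1"
  proof -
    define p where "p = u \<bullet> v"
    have "(norm (A (L (axis 2 1))))\<^sup>2 = (norm u / c)\<^sup>2 * (norm v)\<^sup>2 - 2 * (norm u / c) * (p / (norm u * c)) * p + (p / (norm u * c))\<^sup>2 * (norm u)\<^sup>2"
      unfolding AL2 power2_norm_eq_inner
      by (simp add: inner_diff_left inner_diff_right uu vv p_def[symmetric] inner_commute[of v u] power2_eq_square algebra_simps)
    also have "\<dots> = ((norm u)\<^sup>2 * (norm v)\<^sup>2 - p\<^sup>2) / c\<^sup>2"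
      using u0 c0 by (simp add: field_simps power2_eq_square)
    also have "\<dots> = 1" unfolding p_def cc[symmetric] using c0 by simp
    finally show ?thesis .
  qed
  then have n2: "norm (A (L (axis 2 1))) = 1"
    by (simp add: power2_eq_1_iff) (use norm_ge_zero[of "A (L (axis 2 1))"] in linarith)
  have Lb: "norm (L z) \<le> 4 * K\<^sup>2 * norm z" for z
  proof -
    have "\<bar>(u \<bullet> v) / (norm u * c)\<bar> \<le> K\<^sup>2"
    proof -
      have "\<bar>(u \<bullet> v) / (norm u * c)\<bar> = \<bar>u \<bullet> v\<bar> / (norm u * c)" using c0 by simp
      also have "\<dots> \<le> (norm u * norm v) / (norm u * c)" using c0 u0
        by (intro divide_right_mono Cauchy_Schwarz_ineq2) auto
      also have "\<dots> = norm v * (1 / c)" using u0 by simp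
      also have "\<dots> \<le> K * K" using uv invc c0 K by (intro mult_mono) auto
      finally show ?thesis by (simp add: power2_eq_square)
    qed
    moreover have "norm u / c \<le> K\<^sup>2"
    proof -
      have "norm u * (1 / c) \<le> K * K" using uv invc c0 K by (intro mult_mono) auto
      then show ?thesis by (simp add: power2_eq_square)
    qed
    moreover have "norm (L z) \<le> \<bar>L z $ 1\<bar> + \<bar>L z $ 2\<bar>" using norm_le_l1_cart[of "L z"]
      by (simp add: sum_2)
    moreover have "\<bar>L z $ 1\<bar> \<le> \<bar>z$1\<bar> * (1 / norm u) + \<bar>z$2\<bar> * \<bar>(u \<bullet> v) / (norm u * c)\<bar>"
      unfolding L1 using abs_triangle_ineq4[of "z$1 / norm u" "z$2 * ((u \<bullet> v) / (norm u * c))"]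
      by (simp add: abs_mult)
    moreover have "\<bar>L z $ 2\<bar> = \<bar>z$2\<bar> * (norm u / c)" unfolding L2 using c0 by (simp add: abs_mult)
    moreover have "\<bar>z$1\<bar> * (1 / norm u) \<le> norm z * K\<^sup>2" using component_le_norm_cart[of z 1] invu
      by (intro mult_mono) auto
    moreover have "\<bar>z$2\<bar> * \<bar>(u \<bullet> v) / (norm u * c)\<bar> \<le> norm z * K\<^sup>2"
      using component_le_norm_cart[of z 2] calculation(1) by (intro mult_mono) auto
    moreover have "\<bar>z$2\<bar> * (norm u / c) \<le> norm z * K\<^sup>2"
      using component_le_norm_cart[of z 2] calculation(2) c0 by (intro mult_mono) auto
    ultimately have "norm (L z) \<le> 3 * (norm z * K\<^sup>2)" by linarith
    also have "\<dots> \<le> 4 * K\<^sup>2 * norm z" by simp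
    finally show ?thesis .
  qed
  have "det (matrix L) = 1 / c"
    using u0 by (simp add: det_2 matrix_def L1 L2 axis_simps)
  then have "det (matrix L) > 0" using c0 by simp
  then show thesis using that[of L] linL n1 n2 ip Lb by blast
qed

text \<open>The normal is not normalized here; this only rescales the factor \<open>l\<close>.\<close>
definition umbilic_at :: "(real^2 \<Rightarrow> real^3) \<Rightarrow> real^2 \<Rightarrow> bool" where
  "umbilic_at \<phi> x \<longleftrightarrow> (\<exists>l. \<forall>v w. dir_deriv v (dir_deriv w \<phi>) x \<bullet> cross3 (dir_deriv (axis 1 1) \<phi> x) (dir_deriv (axis 2 1) \<phi> x) =
     l * (dir_deriv v \<phi> x \<bullet> dir_deriv w \<phi> x))"

text \<open>In orthonormal tangent coordinates the first fundamental form is the unit matrix, so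
  proportionality of the two forms means \<open>a = c\<close> and \<open>b = 0\<close>, i.e. both
  squares vanish. Passing to these coordinates changes the normal only by the factor
  \<open>det (matrix L)\<close>, which is absorbed in \<open>l\<close>.\<close>

lemma umbilic_at_orthonormal:
  fixes \<phi> :: "real^2 \<Rightarrow> real^3" and L :: "real^2 \<Rightarrow> real^2"
  assumes \<phi>: "smooth_on \<phi> V" and V: "open V" "x \<in> V"
    and L: "linear L" "det (matrix L) > 0" "norm (dir_deriv (L (axis 1 1)) \<phi> x) = 1" "norm (dir_deriv (L (axis 2 1)) \<phi> x) = 1"
      "dir_deriv (L (axis 1 1)) \<phi> x \<bullet> dir_deriv (L (axis 2 1)) \<phi> x = 0"
  defines "n \<equiv> cross3 (dir_deriv (L (axis 1 1)) \<phi> x) (dir_deriv (L (axis 2 1)) \<phi> x)"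
  defines "B \<equiv> \<lambda>v w. dir_deriv (L v) (dir_deriv (L w) \<phi>) x"
  shows "(B (axis 1 1) (axis 1 1) \<bullet> n - B (axis 2 1) (axis 2 1) \<bullet> n)\<^sup>2 + 4 * (B (axis 1 1) (axis 2 1) \<bullet> n)\<^sup>2 = 0 \<longleftrightarrow> umbilic_at \<phi> x"
proof -
  define N where "N = cross3 (dir_deriv (axis 1 1) \<phi> x) (dir_deriv (axis 2 1) \<phi> x)"
  have linA: "linear (\<lambda>v. dir_deriv v \<phi> x)" by (rule linear_dir_deriv[OF \<phi> V(2)])
  have n: "n = det (matrix L) *\<^sub>R N"
    unfolding n_def N_def by (rule cross_linear_2[OF linA L(1)])
  have bil: "bilinear (\<lambda>v w. dir_deriv v (dir_deriv w \<phi>) x)"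
    by (rule bilinear_dir_deriv_second[OF \<phi> V])
  have l1: "linear (\<lambda>v. dir_deriv (L v) \<phi> x)" using linear_compose[OF L(1) linA] by (simp add: o_def)
  have l2: "linear (\<lambda>v. B v w)" "linear (\<lambda>w. B v w)" for v w
    using bil linear_compose[OF L(1)] unfolding B_def bilinear_def o_def by blast+
  have symB: "B v w = B w v" for v w unfolding B_def by (rule dir_deriv_commute[OF \<phi> V])
  define a where "a = B (axis 1 1) (axis 1 1) \<bullet> n"
  define b where "b = B (axis 1 1) (axis 2 1) \<bullet> n"
  define c where "c = B (axis 2 1) (axis 2 1) \<bullet> n"
  have Bexp: "B v w \<bullet> n = v$1 * w$1 * a + (v$1 * w$2 + v$2 * w$1) * b + v$2 * w$2 * c" for v w
  proof -
    have "B v w = (v$1) *\<^sub>R B (axis 1 1) w + (v$2) *\<^sub>R B (axis 2 1) w" by (rule linear_2[OF l2(1)])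
    moreover have "B u w = (w$1) *\<^sub>R B u (axis 1 1) + (w$2) *\<^sub>R B u (axis 2 1)" for u
      by (rule linear_2[OF l2(2)])
    ultimately have "B v w = (v$1) *\<^sub>R ((w$1) *\<^sub>R B (axis 1 1) (axis 1 1) + (w$2) *\<^sub>R B (axis 1 1) (axis 2 1)) +
      (v$2) *\<^sub>R ((w$1) *\<^sub>R B (axis 1 1) (axis 2 1) + (w$2) *\<^sub>R B (axis 2 1) (axis 2 1))"
      using symB[of "axis 2 1" "axis 1 1"] by metis
    then show ?thesis by (simp add: inner_add_left a_def b_def c_def algebra_simps)
  qed
  have gexp: "dir_deriv (L v) \<phi> x \<bullet> dir_deriv (L w) \<phi> x = v$1 * w$1 + v$2 * w$2" for v w
  proof -
    have "dir_deriv (L v) \<phi> x = (v$1) *\<^sub>R dir_deriv (L (axis 1 1)) \<phi> x + (v$2) *\<^sub>R dir_deriv (L (axis 2 1)) \<phi> x" for v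
      by (rule linear_2[OF l1])
    note e = this[of v] this[of w]
    show ?thesis unfolding e using L(3-5)
      by (simp add: inner_add_left inner_add_right norm_eq_1 inner_commute[of "dir_deriv (L (axis 2 1)) \<phi> x" "dir_deriv (L (axis 1 1)) \<phi> x"])
  qed
  have surj: "\<exists>z. L z = v" for v
  proof -
    have "inj L" using det_nz_iff_inj[OF L(1)] L(2) by simp
    then show ?thesis using linear_injective_imp_surjective[OF L(1)] by (metis surj_def)
  qed
  have "(a - c)\<^sup>2 + 4 * b\<^sup>2 = 0 \<longleftrightarrow> a = c \<and> b = 0"
    using zero_le_power2[of "a - c"] zero_le_power2[of b] by (auto simp: add_nonneg_eq_0_iff)
  moreover have "a = c \<and> b = 0 \<longleftrightarrow> umbilic_at \<phi> x"
  proof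
    assume ab: "a = c \<and> b = 0"
    show "umbilic_at \<phi> x"
      unfolding umbilic_at_def N_def[symmetric]
    proof (intro exI[of _ "a / det (matrix L)"] allI)
      fix v w
      obtain v' w' where vw: "L v' = v" "L w' = w" using surj by metis
      have "det (matrix L) * (dir_deriv v (dir_deriv w \<phi>) x \<bullet> N) = a * (dir_deriv v \<phi> x \<bullet> dir_deriv w \<phi> x)"
        using Bexp[of v' w'] gexp[of v' w'] ab by (simp add: B_def vw n algebra_simps)
      then show "dir_deriv v (dir_deriv w \<phi>) x \<bullet> N = a / det (matrix L) * (dir_deriv v \<phi> x \<bullet> dir_deriv w \<phi> x)"
        using L(2) by (simp add: field_simps)
    qed
  next
    assume "umbilic_at \<phi> x"
    then obtain l where l: "\<And>v w. dir_deriv v (dir_deriv w \<phi>) x \<bullet> N = l * (dir_deriv v \<phi> x \<bullet> dir_deriv w \<phi> x)"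
      unfolding umbilic_at_def N_def[symmetric] by blast
    have "B v w \<bullet> n = det (matrix L) * l * (v$1 * w$1 + v$2 * w$2)" for v w
      by (simp add: B_def n l gexp)
    then show "a = c \<and> b = 0" by (simp add: a_def b_def c_def axis_simps)
  qed
  ultimately show ?thesis by (simp add: a_def b_def c_def)
qed

text \<open>The remainder of the derivative is quadratic in \<open>L z\<close> and linear in
  \<open>L v\<close>, hence the factor \<open>\<Lambda> ^ 3\<close>; the radius shrinks by
  \<open>\<Lambda>\<close>. Neither constant depends on \<open>x\<close> or on the choice of
  \<open>L\<close>.\<close>

lemma normalized_patch_chart:
  fixes \<phi> :: "real^2 \<Rightarrow> real^3"
  assumes \<phi>: "smooth_on \<phi> V" and V: "open V" "x \<in> C" "C \<subseteq> V" and r: "r > 0" "cball x r \<subseteq> C"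
    and K: "K \<ge> 1" "\<And>y v w. y \<in> C \<Longrightarrow> norm (dir_deriv v (dir_deriv w \<phi>) y) \<le> K * norm v * norm w"
      "\<And>w y. y \<in> C \<Longrightarrow> norm (dir_deriv w \<phi> y - dir_deriv w \<phi> x - dir_deriv (y - x) (dir_deriv w \<phi>) x) \<le> K * (norm (y - x))\<^sup>2 * norm w"
    and L: "linear L" "norm (dir_deriv (L (axis 1 1)) \<phi> x) = 1" "norm (dir_deriv (L (axis 2 1)) \<phi> x) = 1"
      "dir_deriv (L (axis 1 1)) \<phi> x \<bullet> dir_deriv (L (axis 2 1)) \<phi> x = 0"
    and \<Lambda>: "\<Lambda> \<ge> 1" "\<And>z. norm (L z) \<le> \<Lambda> * norm z"
  shows "normalized_patch (\<lambda>z. \<phi> (x + L z) - \<phi> x) (\<lambda>z v. dir_deriv (L v) \<phi> (x + L z)) (\<lambda>z v. dir_deriv (L z) (dir_deriv (L v) \<phi>) x) (r / \<Lambda>) (K * \<Lambda> ^ 3)"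
proof
  have xV: "x \<in> V" using V by auto
  have bl: "bounded_linear L" using L(1) by (simp add: linear_conv_bounded_linear)
  have inC: "x + L z \<in> C" if "z \<in> ball 0 (r / \<Lambda>)" for z
  proof -
    have "norm (L z) \<le> \<Lambda> * norm z" by (rule \<Lambda>)
    also have "\<dots> \<le> r" using that \<Lambda>(1) by (simp add: field_simps)
    finally show ?thesis using r(2) by (auto simp: dist_norm)
  qed
  have inV: "x + L z \<in> V" if "z \<in> ball 0 (r / \<Lambda>)" for z using inC[OF that] V by auto
  show "0 < r / \<Lambda>" using r \<Lambda> by simp
  show "1 \<le> K * \<Lambda> ^ 3" using K(1) \<Lambda>(1)
    by (metis mult_mono one_le_power mult_1 zero_le_one order_trans)
  show "\<phi> (x + L 0) - \<phi> x = 0" by (simp add: linear_0[OF L(1)])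
  have dL: "((\<lambda>z. x + L z) has_derivative L) (at z)" for z
    using has_derivative_add[OF has_derivative_const bounded_linear_imp_has_derivative[OF bl]] by simp
  show "((\<lambda>z. \<phi> (x + L z) - \<phi> x) has_derivative (\<lambda>v. dir_deriv (L v) \<phi> (x + L z))) (at z)" if z: "z \<in> ball 0 (r / \<Lambda>)" for z
  proof -
    have "((\<lambda>z. \<phi> (x + L z)) has_derivative (\<lambda>v. dir_deriv (L v) \<phi> (x + L z))) (at z)"
      using diff_chain_at[OF dL smooth_on_has_derivative[OF \<phi> inV[OF z]]] by (simp add: o_def)
    then show ?thesis using has_derivative_diff[OF _ has_derivative_const] by fastforce
  qed
  show "continuous_on (ball 0 (r / \<Lambda>)) (\<lambda>z. dir_deriv (L v) \<phi> (x + L z))" for v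
    by (rule continuous_on_compose2[OF smooth_on_continuous[OF smooth_on_dir_deriv[OF \<phi>]]])
      (use inV in \<open>auto intro!: continuous_intros linear_continuous_on[OF bl]\<close>)
  show "norm (dir_deriv (L v) \<phi> (x + L z) - dir_deriv (L v) \<phi> (x + L 0) - dir_deriv (L z) (dir_deriv (L v) \<phi>) x) \<le> K * \<Lambda> ^ 3 * (norm z)\<^sup>2 * norm v"
    if z: "z \<in> ball 0 (r / \<Lambda>)" for z v
  proof -
    have "norm (dir_deriv (L v) \<phi> (x + L z) - dir_deriv (L v) \<phi> x - dir_deriv (L z) (dir_deriv (L v) \<phi>) x) \<le> K * (norm (L z))\<^sup>2 * norm (L v)"
      using K(3)[OF inC[OF z], of "L v"] by simp
    also have "\<dots> \<le> K * (\<Lambda> * norm z)\<^sup>2 * (\<Lambda> * norm v)"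
      using K(1) \<Lambda> by (intro mult_mono power_mono mult_nonneg_nonneg) auto
    also have "\<dots> = K * \<Lambda> ^ 3 * (norm z)\<^sup>2 * norm v"
      by (simp add: power_mult_distrib power2_eq_square power3_eq_cube)
    finally show ?thesis by (simp add: linear_0[OF L(1)])
  qed
  have bil: "bilinear (\<lambda>v w. dir_deriv v (dir_deriv w \<phi>) x)"
    by (rule bilinear_dir_deriv_second[OF \<phi> V(1) xV])
  show "bilinear (\<lambda>z v. dir_deriv (L z) (dir_deriv (L v) \<phi>) x)"
    using bil linear_compose[OF L(1)] unfolding bilinear_def o_def by blast
  show "dir_deriv (L v) (dir_deriv (L w) \<phi>) x = dir_deriv (L w) (dir_deriv (L v) \<phi>) x" for v w
    by (rule dir_deriv_commute[OF \<phi> V(1) xV])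
  show "norm (dir_deriv (L v) (dir_deriv (L w) \<phi>) x) \<le> K * \<Lambda> ^ 3 * norm v * norm w" for v w
  proof -
    have "norm (dir_deriv (L v) (dir_deriv (L w) \<phi>) x) \<le> K * norm (L v) * norm (L w)" by (rule K(2)[OF V(2)])
    also have "\<dots> \<le> K * (\<Lambda> * norm v) * (\<Lambda> * norm w)" using K(1) \<Lambda>
      by (intro mult_mono mult_nonneg_nonneg) auto
    also have "\<dots> = K * \<Lambda> ^ 2 * (norm v * norm w)" by (simp add: power2_eq_square)
    also have "\<dots> \<le> K * \<Lambda> ^ 3 * (norm v * norm w)" using K(1) \<Lambda>(1)
      by (intro mult_right_mono mult_left_mono power_increasing) auto
    finally show ?thesis by (simp add: mult.assoc)
  qed
  show "norm (dir_deriv (L (axis 1 1)) \<phi> (x + L 0)) = 1" "norm (dir_deriv (L (axis 2 1)) \<phi> (x + L 0)) = 1"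
    "dir_deriv (L (axis 1 1)) \<phi> (x + L 0) \<bullet> dir_deriv (L (axis 2 1)) \<phi> (x + L 0) = 0"
    using L by (simp_all add: linear_0)
qed

lemma chart_uniform_neighbourhood:
  assumes lp: "local_parametrization M V \<phi>" and C: "compact C" "C \<subseteq> V" and \<rho>: "\<rho> > 0"
  shows "\<exists>e>0. \<forall>x\<in>C. \<forall>v\<in>M. norm (v - \<phi> x) < e \<longrightarrow> v \<in> \<phi> ` (ball x \<rho> \<inter> V)"
proof -
  have V: "open V" "smooth_on \<phi> V" using lp by (auto simp: local_parametrization_def)
  obtain k where k: "homeomorphism V (\<phi> ` V) \<phi> k" using lp by (auto simp: local_parametrization_def)
  have inj: "x = y" if "x \<in> V" "y \<in> V" "\<phi> x = \<phi> y" for x y using homeomorphism_apply1[OF k] that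
    by metis
  have "\<exists>T. open T \<and> \<phi> ` (ball x (\<rho> / 2) \<inter> V) = M \<inter> T" for x
  proof -
    have "local_parametrization M (ball x (\<rho> / 2) \<inter> V) \<phi>"
      by (rule local_parametrization_restrict[OF lp]) (use V in auto)
    then have "openin (top_of_set M) (\<phi> ` (ball x (\<rho> / 2) \<inter> V))"
      by (simp add: local_parametrization_def)
    then show ?thesis unfolding openin_open by blast
  qed
  then obtain T where T: "\<And>x. open (T x)" "\<And>x. \<phi> ` (ball x (\<rho> / 2) \<inter> V) = M \<inter> T x"
    by metis
  have "compact (\<phi> ` C)" using C V(2)
    by (intro compact_continuous_image continuous_on_subset[OF smooth_on_continuous]) auto
  moreover have "\<phi> ` C \<subseteq> \<Union> (T ` C)"
  proof
    fix p assume "p \<in> \<phi> ` C"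
    then obtain x where x: "x \<in> C" "p = \<phi> x" by auto
    then have "p \<in> \<phi> ` (ball x (\<rho> / 2) \<inter> V)" using C \<rho> by auto
    then show "p \<in> \<Union> (T ` C)" using T(2)[of x] x by auto
  qed
  ultimately obtain e where e: "e > 0" "\<And>p. p \<in> \<phi> ` C \<Longrightarrow> \<exists>G\<in>T ` C. ball p e \<subseteq> G"
    using Heine_Borel_lemma[of "\<phi> ` C" "T ` C"] T(1) by blast
  have "v \<in> \<phi> ` (ball x \<rho> \<inter> V)" if x: "x \<in> C" and v: "v \<in> M" "norm (v - \<phi> x) < e" for x v
  proof -
    obtain y where y: "y \<in> C" "ball (\<phi> x) e \<subseteq> T y" using e(2)[of "\<phi> x"] x by auto
    have "v \<in> T y" using y(2) v(2) by (auto simp: dist_norm norm_minus_commute)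
    then obtain z where z: "z \<in> ball y (\<rho> / 2) \<inter> V" "v = \<phi> z" using T(2)[of y] v(1) by blast
    have "\<phi> x \<in> T y" using y(2) e(1) by auto
    moreover have "\<phi> x \<in> M" using x C local_parametrization_image_subset[OF lp] by auto
    ultimately obtain x' where x': "x' \<in> ball y (\<rho> / 2) \<inter> V" "\<phi> x = \<phi> x'" using T(2)[of y]
      by blast
    then have "x = x'" using inj[of x x'] x C by auto
    then have "dist x z < \<rho>" using x'(1) z(1) dist_triangle2[of x z y] by (auto simp: dist_commute)
    then show ?thesis using z by auto
  qed
  then show ?thesis using e(1) by blast
qed

section \<open>Integration over the surface in a chart\<close>

lemma nn_integral_area_chart:
  assumes M: "smooth_surface M" "compact M" "M \<noteq> {}" and lp: "local_parametrization M E \<phi>" and f [measurable]: "f \<in> borel_measurable borel"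
  shows "(\<integral>\<^sup>+v. f v * indicator (\<phi> ` E) v \<partial>area_measure M) = (\<integral>\<^sup>+y. ennreal (indicator E y * area_density \<phi> y) * f (\<phi> y) \<partial>lborel)"
    and "\<phi> ` E \<in> sets borel"
proof -
  have E: "open E" "smooth_on \<phi> E" using lp by (auto simp: local_parametrization_def)
  note s [simp, measurable_cong] = sets_area_measure[OF M]
  have "openin (top_of_set M) (\<phi> ` E)" using lp by (simp add: local_parametrization_def)
  then obtain T where "open T" "\<phi> ` E = M \<inter> T" unfolding openin_open by blast
  then show im [measurable]: "\<phi> ` E \<in> sets borel" using M(2) by (auto simp: compact_imp_closed borel_closed)
  \<comment> \<open>Cut down to the image of the chart, the area measure is the chart measure; after
    that only the formulas for image measures and densities are needed.\<close>
  have eq: "density (area_measure M) (indicator (\<phi> ` E)) = chart_area E \<phi>"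
  proof (rule measure_eqI)
    fix A assume "A \<in> sets (density (area_measure M) (indicator (\<phi> ` E)))"
    then have A: "A \<in> sets borel" by simp
    then have "emeasure (density (area_measure M) (indicator (\<phi> ` E))) A = (\<integral>\<^sup>+v. indicator (\<phi> ` E) v * indicator A v \<partial>area_measure M)"
      by (intro emeasure_density) auto
    also have "\<dots> = (\<integral>\<^sup>+v. indicator (A \<inter> \<phi> ` E) v \<partial>area_measure M)"
      by (intro nn_integral_cong) (auto simp: indicator_def)
    also have "\<dots> = emeasure (area_measure M) (A \<inter> \<phi> ` E)" using A im
      by (intro nn_integral_indicator) auto
    also have "\<dots> = emeasure (chart_area E \<phi>) (A \<inter> \<phi> ` E)" using A im
      by (intro emeasure_area_chart[OF M lp]) auto
    also have "\<dots> = emeasure (chart_area E \<phi>) A" by (rule chart_area_Int_image[OF lp A im]) simp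
    finally show "emeasure (density (area_measure M) (indicator (\<phi> ` E))) A = emeasure (chart_area E \<phi>) A" .
  qed simp
  have m: "\<phi> \<in> borel_measurable (restrict_space lborel E)"
    using borel_measurable_continuous_on_restrict[OF smooth_on_continuous[OF E(2)]]
    by (simp cong: measurable_cong_sets sets_restrict_space_cong)
  have ad: "area_density \<phi> \<in> borel_measurable (restrict_space lborel E)"
    using borel_measurable_continuous_on_restrict[OF continuous_on_area_density[OF E(2)]]
    by (simp cong: measurable_cong_sets sets_restrict_space_cong)
  have "(\<integral>\<^sup>+v. f v * indicator (\<phi> ` E) v \<partial>area_measure M) = (\<integral>\<^sup>+v. f v \<partial>density (area_measure M) (indicator (\<phi> ` E)))"
    by (subst nn_integral_density) (auto simp: mult.commute)
  also have "\<dots> = (\<integral>\<^sup>+y. f (\<phi> y) \<partial>density (restrict_space lborel E) (\<lambda>x. ennreal (area_density \<phi> x)))"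
    unfolding eq chart_area_def using m by (subst nn_integral_distr) auto
  also have "\<dots> = (\<integral>\<^sup>+y. ennreal (area_density \<phi> y) * f (\<phi> y) \<partial>restrict_space lborel E)"
    using m ad by (subst nn_integral_density) auto
  also have "\<dots> = (\<integral>\<^sup>+y. ennreal (area_density \<phi> y) * f (\<phi> y) * indicator E y \<partial>lborel)"
    using E by (intro nn_integral_restrict_space) auto
  also have "\<dots> = (\<integral>\<^sup>+y. ennreal (indicator E y * area_density \<phi> y) * f (\<phi> y) \<partial>lborel)"
    by (intro nn_integral_cong) (auto simp: indicator_def)
  finally show "(\<integral>\<^sup>+v. f v * indicator (\<phi> ` E) v \<partial>area_measure M) = (\<integral>\<^sup>+y. ennreal (indicator E y * area_density \<phi> y) * f (\<phi> y) \<partial>lborel)" .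
qed

lemma integral_area_chart:
  fixes f :: "real^3 \<Rightarrow> real"
  assumes M: "smooth_surface M" "compact M" "M \<noteq> {}" and lp: "local_parametrization M E \<phi>"
    and f [measurable]: "f \<in> borel_measurable borel" and nn: "\<And>v. f v \<ge> 0"
  shows "(\<integral>v. indicator (\<phi> ` E) v * f v \<partial>area_measure M) = (\<integral>y. indicator E y * (f (\<phi> y) * area_density \<phi> y) \<partial>lborel)"
proof -
  have E: "open E" "smooth_on \<phi> E" using lp by (auto simp: local_parametrization_def)
  note s [simp, measurable_cong] = sets_area_measure[OF M]
  note im [measurable] = nn_integral_area_chart(2)[OF M lp f[THEN measurable_compose, OF measurable_ennreal]]
  have ad0: "area_density \<phi> y \<ge> 0" for y by (simp add: area_density_def)
  have "continuous_on E \<phi>" using smooth_on_continuous[OF E(2)] .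
  then have mphi: "(\<lambda>y. indicator E y *\<^sub>R \<phi> y) \<in> borel_measurable borel" using E(1)
    by (intro borel_measurable_continuous_on_indicator) auto
  have mad: "(\<lambda>y. indicator E y *\<^sub>R area_density \<phi> y) \<in> borel_measurable borel"
    using E continuous_on_area_density[OF E(2)] by (intro borel_measurable_continuous_on_indicator) auto
  have "(\<lambda>y. f (indicator E y *\<^sub>R \<phi> y) * (indicator E y *\<^sub>R area_density \<phi> y)) \<in> borel_measurable borel"
    using mphi mad by measurable
  moreover have "(\<lambda>y. f (indicator E y *\<^sub>R \<phi> y) * (indicator E y *\<^sub>R area_density \<phi> y)) = (\<lambda>y. indicator E y * (f (\<phi> y) * area_density \<phi> y))"
    by (auto simp: indicator_def)
  ultimately have mR: "(\<lambda>y. indicator E y * (f (\<phi> y) * area_density \<phi> y)) \<in> borel_measurable lborel"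
    by simp
  have "(\<integral>v. indicator (\<phi> ` E) v * f v \<partial>area_measure M) = enn2real (\<integral>\<^sup>+v. ennreal (indicator (\<phi> ` E) v * f v) \<partial>area_measure M)"
    by (rule integral_eq_nn_integral) (use nn in auto)
  also have "(\<integral>\<^sup>+v. ennreal (indicator (\<phi> ` E) v * f v) \<partial>area_measure M) = (\<integral>\<^sup>+v. ennreal (f v) * indicator (\<phi> ` E) v \<partial>area_measure M)"
    by (intro nn_integral_cong) (auto simp: indicator_def)
  also have "\<dots> = (\<integral>\<^sup>+y. ennreal (indicator E y * area_density \<phi> y) * ennreal (f (\<phi> y)) \<partial>lborel)"
    by (rule nn_integral_area_chart(1)[OF M lp]) auto
  also have "\<dots> = (\<integral>\<^sup>+y. ennreal (indicator E y * (f (\<phi> y) * area_density \<phi> y)) \<partial>lborel)"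
    using nn ad0 by (intro nn_integral_cong) (auto simp: indicator_def ennreal_mult' mult.commute)
  also have "enn2real \<dots> = (\<integral>y. indicator E y * (f (\<phi> y) * area_density \<phi> y) \<partial>lborel)"
    by (rule integral_eq_nn_integral[symmetric]) (use nn ad0 mR in auto)
  finally show ?thesis .
qed


text \<open>The part of the surface away from the base point contributes an exponentially small
  amount; this gives it the form of the other error terms. The number 27 comes from
  \<open>(y / 3) ^ 3 \<le> exp y\<close>.\<close>

lemma exp_minus_le_powr:
  fixes e t :: real
  assumes "e > 0" "t \<ge> 1"
  shows "exp (- t * e\<^sup>2) \<le> 27 / e ^ 6 * t powr (-5/2)"
proof -
  define y where "y = t * e\<^sup>2"
  have y: "y > 0" using assms by (simp add: y_def)
  have "(y / 3) ^ 3 \<le> exp (y / 3) ^ 3"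
  proof (rule power_mono)
    show "y / 3 \<le> exp (y / 3)" using exp_ge_add_one_self[of "y / 3"] by linarith
  qed (use y in simp)
  also have "\<dots> = exp y" using exp_of_nat_mult[of 3 "y / 3"] by simp
  finally have "exp (- y) \<le> 1 / (y / 3) ^ 3" using y by (simp add: exp_minus field_simps)
  also have "\<dots> = 27 / e ^ 6 * (1 / t ^ 3)" using assms
    by (simp add: y_def power_divide power_mult_distrib flip: power_mult)
  also have "1 / t ^ 3 = t powr (-3)" using assms by (simp add: powr_minus powr_numeral field_simps)
  also have "27 / e ^ 6 * t powr (-3) \<le> 27 / e ^ 6 * t powr (-5/2)"
    using assms by (intro mult_left_mono powr_mono) auto
  finally show ?thesis by (simp add: y_def)
qed

text \<open>Near the base point the integral is pulled back along \<open>x + L z\<close> to a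
  normalized patch; the rest of the surface has distance at least \<open>e\<close>. Of the
  coefficient only its sign and its zeros are recorded, since the residue criterion uses nothing
  else.\<close>

lemma local_expansion:
  assumes M: "smooth_surface M" "compact M" "M \<noteq> {}" and lp: "local_parametrization M V \<phi>" and x0: "x0 \<in> V"
  shows "\<exists>r>0. \<exists>A. ball x0 r \<subseteq> V \<and> (\<forall>x\<in>ball x0 r. \<exists>q\<ge>0. (q = 0 \<longleftrightarrow> umbilic_at \<phi> x) \<and>
     (\<forall>t\<ge>1. \<bar>(\<integral>v. exp (- t * (norm (v - \<phi> x))\<^sup>2) \<partial>area_measure M) - pi / t - q / t\<^sup>2\<bar> \<le> A * t powr (-5/2)))"
proof -
  define \<mu> where "\<mu> = area_measure M"
  have sets\<mu> [simp, measurable_cong]: "sets \<mu> = sets borel" unfolding \<mu>_def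
    by (rule sets_area_measure[OF M])
  interpret \<mu>: finite_measure \<mu> unfolding \<mu>_def by (rule finite_measure_area[OF M])
  have V: "open V" "smooth_on \<phi> V" using lp by (auto simp: local_parametrization_def)
  obtain r' where r': "r' > 0" "cball x0 r' \<subseteq> V" using V(1) x0 open_contains_cball by blast
  \<comment> \<open>Half of the radius, so that the ball of radius \<open>r\<close> about any point
    \<open>x\<close> under consideration still lies in \<open>C\<close>.\<close>
  define r where "r = r' / 2"
  have r: "r > 0" using r' by (simp add: r_def)
  define C where "C = cball x0 r'"
  have C: "compact C" "convex C" "C \<subseteq> V" using r' by (auto simp: C_def)
  obtain K where K: "K \<ge> 1" "\<And>x v. x \<in> C \<Longrightarrow> norm (dir_deriv v \<phi> x) \<le> K * norm v"
    "\<And>x v w. x \<in> C \<Longrightarrow> norm (dir_deriv v (dir_deriv w \<phi>) x) \<le> K * norm v * norm w"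
    "\<And>x w y. x \<in> C \<Longrightarrow> y \<in> C \<Longrightarrow> norm (dir_deriv w \<phi> y - dir_deriv w \<phi> x - dir_deriv (y - x) (dir_deriv w \<phi>) x) \<le> K * (norm (y - x))\<^sup>2 * norm w"
    "\<And>x. x \<in> C \<Longrightarrow> 1 \<le> K * area_density \<phi> x"
    using chart_taylor_bounds[OF V(2,1) inj_dir_deriv[OF lp] C] by blast
  define \<Lambda> where "\<Lambda> = 4 * K\<^sup>2"
  have \<Lambda>: "\<Lambda> \<ge> 1" using one_le_power[OF K(1), of 2] unfolding \<Lambda>_def by linarith
  define R where "R = r / \<Lambda>"
  define K' where "K' = K * \<Lambda> ^ 3"
  define \<delta> where "\<delta> = min R (1 / (20 * K'))"
  have R: "R > 0" using r \<Lambda> by (simp add: R_def)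
  have K': "K' \<ge> 1" unfolding K'_def using K(1) \<Lambda>
    by (metis mult_mono one_le_power mult_1 zero_le_one order_trans)
  have \<delta>: "\<delta> > 0" "\<delta> \<le> R" using R K' by (auto simp: \<delta>_def)
  obtain A1 where A1: "\<And>\<psi> D B t. normalized_patch \<psi> D B R K' \<Longrightarrow> t \<ge> 1 \<Longrightarrow>
    (let n = cross3 (D 0 (axis 1 1)) (D 0 (axis 2 1)); a = B (axis 1 1) (axis 1 1) \<bullet> n;
         b = B (axis 1 1) (axis 2 1) \<bullet> n; c = B (axis 2 1) (axis 2 1) \<bullet> n in
     \<bar>(\<integral>z. indicator (ball 0 \<delta>) z * (exp (- t * (norm (\<psi> z))\<^sup>2) * norm (cross3 (D z (axis 1 1)) (D z (axis 2 1)))) \<partial>lborel)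
       - (pi / t + pi / 16 * ((a - c)\<^sup>2 + 4 * b\<^sup>2) / t\<^sup>2)\<bar> \<le> A1 * t powr (-5/2))"
    using normalized_patch_gaussian[OF R K'] unfolding \<delta>_def by blast
  \<comment> \<open>The image \<open>E\<close> of the small ball under \<open>x + L z\<close> will
    contain a ball of this radius, since \<open>dir_deriv (L z) \<phi> x\<close> has the norm of
    \<open>z\<close> and the derivative of \<open>\<phi>\<close> is bounded by \<open>K\<close>.
    Therefore \<open>e\<close> can be fixed before \<open>x\<close> and \<open>L\<close>.\<close>
  define \<rho> where "\<rho> = \<delta> / K"
  have \<rho>: "\<rho> > 0" using \<delta> K(1) by (simp add: \<rho>_def)
  obtain e where e: "e > 0" "\<And>x v. x \<in> C \<Longrightarrow> v \<in> M \<Longrightarrow> norm (v - \<phi> x) < e \<Longrightarrow> v \<in> \<phi> ` (ball x \<rho> \<inter> V)"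
    using chart_uniform_neighbourhood[OF lp C(1,3) \<rho>] by blast
  define A where "A = A1 + measure \<mu> (space \<mu>) * (27 / e ^ 6)"
  have main: "\<exists>q\<ge>0. (q = 0 \<longleftrightarrow> umbilic_at \<phi> x) \<and>
     (\<forall>t\<ge>1. \<bar>(\<integral>v. exp (- t * (norm (v - \<phi> x))\<^sup>2) \<partial>\<mu>) - pi / t - q / t\<^sup>2\<bar> \<le> A * t powr (-5/2))" if x: "x \<in> ball x0 r" for x
  proof -
    have xC: "x \<in> C" using x r' by (simp add: C_def r_def)
    have xV: "x \<in> V" using xC C by auto
    have rC: "cball x r \<subseteq> C"
    proof
      fix y assume "y \<in> cball x r"
      then show "y \<in> C" using x dist_triangle[of x0 y x] by (simp add: C_def r_def)
    qed
    have linA: "linear (\<lambda>v. dir_deriv v \<phi> x)" by (rule linear_dir_deriv[OF V(2) xV])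
    obtain L where L: "linear L" "norm (dir_deriv (L (axis 1 1)) \<phi> x) = 1" "norm (dir_deriv (L (axis 2 1)) \<phi> x) = 1"
      "dir_deriv (L (axis 1 1)) \<phi> x \<bullet> dir_deriv (L (axis 2 1)) \<phi> x = 0" "\<And>z. norm (L z) \<le> \<Lambda> * norm z" "det (matrix L) > 0"
      unfolding \<Lambda>_def
      using orthonormalizing_map[OF linA K(1) K(2)[OF xC] K(5)[OF xC, unfolded area_density_dir_deriv]] by blast
    define \<psi> where "\<psi> = (\<lambda>z. \<phi> (x + L z) - \<phi> x)"
    define D where "D = (\<lambda>z v. dir_deriv (L v) \<phi> (x + L z))"
    define B where "B = (\<lambda>z v. dir_deriv (L z) (dir_deriv (L v) \<phi>) x)"
    have np: "normalized_patch \<psi> D B R K'"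
      unfolding \<psi>_def D_def B_def R_def K'_def
      by (rule normalized_patch_chart[OF V(2,1) xC C(3) r rC K(1) K(3) K(4)[OF xC] L(1-4) \<Lambda> L(5)])
    define n where "n = cross3 (D 0 (axis 1 1)) (D 0 (axis 2 1))"
    have D0: "D 0 v = dir_deriv (L v) \<phi> x" for v by (simp add: D_def linear_0[OF L(1)])
    define Q where "Q = (B (axis 1 1) (axis 1 1) \<bullet> n - B (axis 2 1) (axis 2 1) \<bullet> n)\<^sup>2 + 4 * (B (axis 1 1) (axis 2 1) \<bullet> n)\<^sup>2"
    define q where "q = pi / 16 * Q"
    have Q0: "Q \<ge> 0" by (simp add: Q_def)
    have Qumb: "Q = 0 \<longleftrightarrow> umbilic_at \<phi> x"
      unfolding Q_def B_def n_def D0 by (rule umbilic_at_orthonormal[OF V(2,1) xV L(1,6,2-4)])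
    have bl: "bounded_linear L" using L(1) by (simp add: linear_conv_bounded_linear)
    have injL: "inj L" using det_nz_iff_inj[OF L(1)] L(6) by simp
    define g where "g = (\<lambda>z. x + L z)"
    define S where "S = ball (0 :: real^2) \<delta>"
    define E where "E = g ` S"
    have gC: "g z \<in> C" if "z \<in> S" for z
    proof -
      have "norm (L z) \<le> \<Lambda> * norm z" by (rule L)
      also have "\<dots> \<le> \<Lambda> * R" using that \<delta> \<Lambda> by (intro mult_left_mono) (auto simp: S_def)
      also have "\<dots> = r" using \<Lambda> by (simp add: R_def)
      finally have "g z \<in> cball x r" by (simp add: g_def dist_norm)
      then show ?thesis using rC by blast
    qed
    have EC: "E \<subseteq> C" using gC by (auto simp: E_def)
    have contg: "continuous_on S g" unfolding g_def by (intro continuous_intros linear_continuous_on[OF bl])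
    have injg: "inj_on g S" using injL by (auto simp: g_def inj_on_def)
    have openE: "open E" unfolding E_def by (rule invariance_of_domain[OF contg _ injg]) (simp add: S_def)
    have lpE: "local_parametrization M E \<phi>" using local_parametrization_restrict[OF lp openE] EC C(3) by blast
    have ballE: "ball x \<rho> \<subseteq> E"
    proof
      fix y assume y: "y \<in> ball x \<rho>"
      have "surj L" by (rule linear_injective_imp_surjective[OF L(1) injL]) simp
      then obtain z where z: "L z = y - x" by (metis surj_def)
      interpret np: normalized_patch \<psi> D B R K' by (rule np)
      have "norm z = norm (dir_deriv (L z) \<phi> x)" using np.norm_D0[of z] by (simp add: D0)
      also have "\<dots> \<le> K * norm (y - x)" using K(2)[OF xC, of "L z"] by (simp add: z)
      also have "\<dots> < \<delta>" using y K(1) by (simp add: \<rho>_def dist_norm norm_minus_commute field_simps)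
      finally have "z \<in> S" by (simp add: S_def)
      moreover have "y = g z" by (simp add: g_def z)
      ultimately show "y \<in> E" by (auto simp: E_def)
    qed
    have expand: "\<bar>(\<integral>v. exp (- t * (norm (v - \<phi> x))\<^sup>2) \<partial>\<mu>) - pi / t - q / t\<^sup>2\<bar> \<le> A * t powr (-5/2)" if t: "t \<ge> 1" for t
    proof -
      define f where "f = (\<lambda>v. exp (- t * (norm (v - \<phi> x))\<^sup>2))"
      have fm [measurable]: "f \<in> borel_measurable borel" unfolding f_def by measurable
      have f01: "0 \<le> f v" "f v \<le> 1" for v using t by (auto simp: f_def)
      define F where "F = (\<lambda>y. f (\<phi> y) * area_density \<phi> y)"
      have contF: "continuous_on C F"
        unfolding F_def f_def
        by (intro continuous_intros continuous_on_subset[OF smooth_on_continuous[OF V(2)] C(3)] continuous_on_subset[OF continuous_on_area_density[OF V(2)] C(3)])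
      have contFE: "continuous_on E F" using contF EC continuous_on_subset by blast
      have mE: "(\<lambda>y. indicator E y * F y) \<in> borel_measurable borel"
        using borel_measurable_continuous_on_indicator[OF _ contFE] openE by simp
      have "integrable lborel (\<lambda>y. indicator C y *\<^sub>R F y)"
        by (rule borel_integrable_compact[OF C(1) contF])
      then have "set_integrable lborel E F"
        using set_integrable_subset[of lborel C F E] EC openE by (simp add: set_integrable_def)
      then have aiE: "F absolutely_integrable_on (g ` S)"
        using absolutely_integrable_indicator_lborel(1)[OF mE] by (simp add: set_integrable_def E_def)
      have derg: "(g has_derivative L) (at z within S)" for z
        unfolding g_def using has_derivative_add[OF has_derivative_const bounded_linear_imp_has_derivative[OF bl]]
        by simp
      have Sleb: "S \<in> sets lebesgue" by (simp add: S_def)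
      have cov: "(\<lambda>z. \<bar>det (matrix L)\<bar> * F (g z)) absolutely_integrable_on S"
        "integral S (\<lambda>z. \<bar>det (matrix L)\<bar> * F (g z)) = integral (g ` S) F"
        by (rule absolutely_integrable_change_of_variables_real[OF Sleb _ injg aiE], rule derg)+
      define G where "G = (\<lambda>z. exp (- t * (norm (\<psi> z))\<^sup>2) * norm (cross3 (D z (axis 1 1)) (D z (axis 2 1))))"
      have FG: "\<bar>det (matrix L)\<bar> * F (g z) = G z" if z: "z \<in> S" for z
      proof -
        have "g z \<in> V" using gC[OF z] C by auto
        then have "cross3 (D z (axis 1 1)) (D z (axis 2 1)) = det (matrix L) *\<^sub>R cross3 (dir_deriv (axis 1 1) \<phi> (g z)) (dir_deriv (axis 2 1) \<phi> (g z))"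
          unfolding D_def g_def by (intro cross_linear_2 linear_dir_deriv[OF V(2)] L(1))
        then show ?thesis by (simp add: G_def F_def f_def area_density_dir_deriv \<psi>_def g_def)
      qed
      have contG: "continuous_on S G"
      proof -
        have "continuous_on S (\<lambda>z. \<bar>det (matrix L)\<bar> * F (g z))"
          by (intro continuous_intros continuous_on_compose2[OF contF contg]) (use gC in auto)
        then show ?thesis using FG by (simp cong: continuous_on_cong)
      qed
      have mG: "(\<lambda>z. indicator S z * G z) \<in> borel_measurable borel"
        using borel_measurable_continuous_on_indicator[OF _ contG] by (simp add: S_def)
      have aiG: "G absolutely_integrable_on S"
        by (subst set_integrable_cong[OF refl refl FG[symmetric]]) (auto intro: cov(1))
      have "integral S G = integral (g ` S) F"
        unfolding cov(2)[symmetric] by (rule integral_cong) (simp add: FG)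
      then have GE: "(\<integral>z. indicator S z * G z \<partial>lborel) = (\<integral>y. indicator E y * F y \<partial>lborel)"
        using absolutely_integrable_indicator_lborel(2)[OF mG aiG] absolutely_integrable_indicator_lborel(2)[OF mE] aiE
        by (simp add: E_def)
      have EM: "(\<integral>v. indicator (\<phi> ` E) v * f v \<partial>\<mu>) = (\<integral>y. indicator E y * F y \<partial>lborel)"
        unfolding \<mu>_def F_def by (rule integral_area_chart[OF M lpE fm f01(1)])
      have est: "\<bar>(\<integral>v. indicator (\<phi> ` E) v * f v \<partial>\<mu>) - (pi / t + q / t\<^sup>2)\<bar> \<le> A1 * t powr (-5/2)"
        using A1[OF np t] unfolding EM GE[symmetric] Let_def n_def[symmetric] Q_def[symmetric] G_def S_def q_def by simp
      have im [measurable]: "\<phi> ` E \<in> sets borel"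
        by (rule nn_integral_area_chart(2)[OF M lpE, of "\<lambda>_. 0"]) simp
      have if1: "integrable \<mu> f" by (rule \<mu>.integrable_const_bound[of _ 1]) (use f01 in auto)
      have if2: "integrable \<mu> (\<lambda>v. indicator (\<phi> ` E) v * f v)"
        by (rule \<mu>.integrable_const_bound[of _ 1]) (use f01 in \<open>auto simp: indicator_def\<close>)
      have "AE v in \<mu>. v \<in> M"
      proof (rule AE_I)
        show "{v \<in> space \<mu>. v \<notin> M} \<subseteq> - M" by auto
        show "emeasure \<mu> (- M) = 0" unfolding \<mu>_def by (rule emeasure_area_outside[OF M])
        show "- M \<in> sets \<mu>" using M(2) by (auto simp: compact_imp_closed)
      qed
      then have ae: "AE v in \<mu>. \<bar>f v - indicator (\<phi> ` E) v * f v\<bar> \<le> exp (- t * e\<^sup>2)"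
      proof eventually_elim
        case (elim v)
        show ?case
        proof (cases "v \<in> \<phi> ` E")
          case False
          then have "v \<notin> \<phi> ` (ball x \<rho> \<inter> V)" using ballE by auto
          then have "e \<le> norm (v - \<phi> x)" using e(2)[OF xC elim] by linarith
          then have "t * e\<^sup>2 \<le> t * (norm (v - \<phi> x))\<^sup>2" using e(1) t
            by (intro mult_left_mono power_mono) auto
          then show ?thesis using False f01(1)[of v] by (simp add: f_def)
        qed simp
      qed
      have "\<bar>(\<integral>v. f v \<partial>\<mu>) - (\<integral>v. indicator (\<phi> ` E) v * f v \<partial>\<mu>)\<bar> = \<bar>\<integral>v. f v - indicator (\<phi> ` E) v * f v \<partial>\<mu>\<bar>"
        using if1 if2 by simp
      also have "\<dots> \<le> (\<integral>v. \<bar>f v - indicator (\<phi> ` E) v * f v\<bar> \<partial>\<mu>)"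
        by (rule integral_abs_bound)
      also have "\<dots> \<le> (\<integral>v. exp (- t * e\<^sup>2) \<partial>\<mu>)"
        using ae if1 if2 by (intro integral_mono_AE) auto
      also have "\<dots> = measure \<mu> (space \<mu>) * exp (- t * e\<^sup>2)" by simp
      also have "\<dots> \<le> measure \<mu> (space \<mu>) * (27 / e ^ 6 * t powr (-5/2))"
        by (intro mult_left_mono exp_minus_le_powr e t) simp
      finally have "\<bar>(\<integral>v. f v \<partial>\<mu>) - (\<integral>v. indicator (\<phi> ` E) v * f v \<partial>\<mu>)\<bar> \<le> measure \<mu> (space \<mu>) * (27 / e ^ 6) * t powr (-5/2)"
        by (simp add: mult.assoc)
      then have "\<bar>(\<integral>v. f v \<partial>\<mu>) - pi / t - q / t\<^sup>2\<bar> \<le> A1 * t powr (-5/2) + measure \<mu> (space \<mu>) * (27 / e ^ 6) * t powr (-5/2)"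
        using est by linarith
      then show ?thesis by (simp add: A_def f_def distrib_right)
    qed
    show ?thesis using Q0 Qumb expand by (intro exI[of _ q]) (auto simp: q_def)
  qed
  have "ball x0 r \<subseteq> V" using r' r by (auto simp: r_def)
  then show ?thesis using r main unfolding \<mu>_def by blast
qed

section \<open>Umbilic surfaces\<close>

lemma orthogonal_imp_parallel_cross:
  assumes "y \<bullet> u = 0" "y \<bullet> v = 0"
  shows "(norm (cross3 u v))\<^sup>2 *\<^sub>R y = (y \<bullet> cross3 u v) *\<^sub>R cross3 u v"
proof -
  define n where "n = cross3 u v"
  have "cross3 n y = 0" using assms by (simp add: n_def cross_cross_left inner_commute)
  then have "(n \<bullet> n) *\<^sub>R y - (y \<bullet> n) *\<^sub>R n = 0" using cross_cross_left[of n y n] by simp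
  then show ?thesis unfolding n_def power2_norm_eq_inner by simp
qed

definition chart_normal :: "(real^2 \<Rightarrow> real^3) \<Rightarrow> real^2 \<Rightarrow> real^3" where
  "chart_normal \<phi> x = cross3 (dir_deriv (axis 1 1) \<phi> x) (dir_deriv (axis 2 1) \<phi> x)"

lemma norm_chart_normal: "norm (chart_normal \<phi> x) = area_density \<phi> x"
  by (simp add: chart_normal_def area_density_dir_deriv)

lemma dir_deriv_eq_0_if_constant:
  fixes f :: "'a::real_normed_vector \<Rightarrow> real"
  assumes "open U" "x \<in> U" "\<And>y. y \<in> U \<Longrightarrow> f y = k" "(f has_derivative f') (at x)"
  shows "f' v = 0"
proof -
  have "(f has_derivative (\<lambda>v. 0)) (at x)"
    by (rule has_derivative_transform_within_open[OF has_derivative_const[of k] assms(1,2)]) (simp add: assms(3))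
  then show ?thesis using has_derivative_unique[OF assms(4)] by metis
qed

context
  fixes M V \<phi> assumes lp: "local_parametrization M V \<phi>"
begin

lemma chart_open: "open V" and chart_smooth: "smooth_on \<phi> V"
  using lp by (auto simp: local_parametrization_def)

lemma chart_normal_nonzero: "x \<in> V \<Longrightarrow> chart_normal \<phi> x \<noteq> 0"
  using area_density_pos[OF chart_smooth _ inj_dir_deriv[OF lp]] norm_chart_normal[of \<phi> x] by fastforce

lemma chart_injective: "x \<in> V \<Longrightarrow> y \<in> V \<Longrightarrow> \<phi> x = \<phi> y \<Longrightarrow> x = y"
  using lp unfolding local_parametrization_def homeomorphism_def by metis

lemma dir_deriv_normal: "x \<in> V \<Longrightarrow> dir_deriv v \<phi> x \<bullet> chart_normal \<phi> x = 0"
  unfolding linear_2[OF linear_dir_deriv[OF chart_smooth], of x v] chart_normal_def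
  by (simp add: inner_add_left dot_cross_self)

lemma parallel_normal:
  assumes x: "x \<in> V" and y: "\<And>v. dir_deriv v \<phi> x \<bullet> y = 0"
  shows "\<exists>k. y = k *\<^sub>R chart_normal \<phi> x"
proof
  have "(norm (chart_normal \<phi> x))\<^sup>2 *\<^sub>R y = (y \<bullet> chart_normal \<phi> x) *\<^sub>R chart_normal \<phi> x"
    unfolding chart_normal_def
    by (rule orthogonal_imp_parallel_cross) (use y in \<open>simp_all add: inner_commute\<close>)
  then have "(1 / (norm (chart_normal \<phi> x))\<^sup>2) *\<^sub>R ((norm (chart_normal \<phi> x))\<^sup>2 *\<^sub>R y) = (1 / (norm (chart_normal \<phi> x))\<^sup>2) *\<^sub>R ((y \<bullet> chart_normal \<phi> x) *\<^sub>R chart_normal \<phi> x)"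
    by simp
  then show "y = ((y \<bullet> chart_normal \<phi> x) / (norm (chart_normal \<phi> x))\<^sup>2) *\<^sub>R chart_normal \<phi> x"
    using chart_normal_nonzero[OF x] by simp
qed

lemma dir_deriv_nonzero: "x \<in> V \<Longrightarrow> v \<noteq> 0 \<Longrightarrow> dir_deriv v \<phi> x \<noteq> 0"
  using inj_dir_deriv[OF lp, of x] linear_0[OF linear_dir_deriv[OF chart_smooth], of x] by (metis injD)

text \<open>Both identities come from differentiating the constant
  \<open>(\<phi> x - c) \<bullet> (\<phi> x - c)\<close>, once and twice.\<close>

lemma sphere_derivatives:
  assumes U: "open U" "U \<subseteq> V" and sph: "\<phi> ` U \<subseteq> sphere c r" and x: "x \<in> U"
  shows "dir_deriv v \<phi> x \<bullet> (\<phi> x - c) = 0"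
    and "dir_deriv w (dir_deriv v \<phi>) x \<bullet> (\<phi> x - c) = - (dir_deriv v \<phi> x \<bullet> dir_deriv w \<phi> x)"
proof -
  have d: "((\<lambda>y. \<phi> y - c) has_derivative (\<lambda>v. dir_deriv v \<phi> y)) (at y)" if "y \<in> U" for y
    using has_derivative_diff[OF smooth_on_has_derivative[OF chart_smooth] has_derivative_const] that U by fastforce
  have 1: "dir_deriv v \<phi> y \<bullet> (\<phi> y - c) = 0" if y: "y \<in> U" for y v
  proof -
    have "(\<phi> z - c) \<bullet> (\<phi> z - c) = r\<^sup>2" if "z \<in> U" for z
    proof -
      have "norm (\<phi> z - c) = r" using sph that by (auto simp: dist_norm norm_minus_commute)
      then show ?thesis by (simp add: power2_norm_eq_inner[symmetric])
    qed
    then have "(\<phi> y - c) \<bullet> dir_deriv v \<phi> y + dir_deriv v \<phi> y \<bullet> (\<phi> y - c) = 0"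
      using dir_deriv_eq_0_if_constant[OF U(1) y _ has_derivative_inner[OF d[OF y] d[OF y]], of "r\<^sup>2" v] by simp
    then show ?thesis by (simp add: inner_commute)
  qed
  show "dir_deriv v \<phi> x \<bullet> (\<phi> x - c) = 0" by (rule 1[OF x])
  have xV: "x \<in> V" using x U by auto
  have "dir_deriv v \<phi> x \<bullet> dir_deriv w \<phi> x + dir_deriv w (dir_deriv v \<phi>) x \<bullet> (\<phi> x - c) = 0"
  proof -
    have "(dir_deriv v \<phi> has_derivative (\<lambda>w. dir_deriv w (dir_deriv v \<phi>) x)) (at x)"
      by (rule smooth_on_has_derivative[OF smooth_on_dir_deriv[OF chart_smooth] xV])
    from dir_deriv_eq_0_if_constant[OF U(1) x 1 has_derivative_inner[OF this d[OF x]], of w]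
    show ?thesis by simp
  qed
  then show "dir_deriv w (dir_deriv v \<phi>) x \<bullet> (\<phi> x - c) = - (dir_deriv v \<phi> x \<bullet> dir_deriv w \<phi> x)"
    by simp
qed

text \<open>The second identity fixes \<open>k\<close> by the derivatives of \<open>\<phi>\<close>
  alone, without reference to the centre, and shows that it is nonzero. This is what makes the
  sphere through a patch unique.\<close>

lemma sphere_normal:
  assumes "open U" "U \<subseteq> V" "\<phi> ` U \<subseteq> sphere c r" "x \<in> U"
  shows "\<exists>k. \<phi> x - c = k *\<^sub>R chart_normal \<phi> x \<and>
    (\<forall>v w. k * (dir_deriv w (dir_deriv v \<phi>) x \<bullet> chart_normal \<phi> x) = - (dir_deriv v \<phi> x \<bullet> dir_deriv w \<phi> x))"
proof -
  have xV: "x \<in> V" using assms by auto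
  obtain k where k: "\<phi> x - c = k *\<^sub>R chart_normal \<phi> x"
    using parallel_normal[OF xV sphere_derivatives(1)[OF assms]] by metis
  then show ?thesis using sphere_derivatives(2)[OF assms] by (intro exI[of _ k]) simp
qed

lemma sphere_imp_umbilic:
  assumes "open U" "U \<subseteq> V" "\<phi> ` U \<subseteq> sphere c r" "x \<in> U"
  shows "umbilic_at \<phi> x"
proof -
  obtain k where k: "\<And>v w. k * (dir_deriv w (dir_deriv v \<phi>) x \<bullet> chart_normal \<phi> x) = - (dir_deriv v \<phi> x \<bullet> dir_deriv w \<phi> x)"
    using sphere_normal[OF assms] by metis
  have xV: "x \<in> V" using assms by auto
  have "dir_deriv (axis 1 1) \<phi> x \<bullet> dir_deriv (axis 1 1) \<phi> x \<noteq> 0"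
    using dir_deriv_nonzero[OF xV, of "axis 1 1"] by (simp add: axis_eq_0_iff)
  then have k0: "k \<noteq> 0" using k[of "axis 1 1" "axis 1 1"] by auto
  show ?thesis unfolding umbilic_at_def chart_normal_def[symmetric]
  proof (intro exI[of _ "- 1 / k"] allI)
    fix v w
    show "dir_deriv v (dir_deriv w \<phi>) x \<bullet> chart_normal \<phi> x = - 1 / k * (dir_deriv v \<phi> x \<bullet> dir_deriv w \<phi> x)"
      using k[of v w] k0 by (simp add: field_simps inner_commute)
  qed
qed

text \<open>The derivatives of \<open>\<phi>\<close> determine \<open>k\<close> and thereby the
  centre. This is needed to see that overlapping patches lie in the same sphere.\<close>

lemma sphere_unique:
  assumes U: "open U" "U \<subseteq> V" "x \<in> U" and s: "\<phi> ` U \<subseteq> sphere c r" "\<phi> ` U \<subseteq> sphere c' r'"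
  shows "c = c' \<and> r = r'"
proof -
  have xV: "x \<in> V" using U by auto
  obtain k where k: "\<phi> x - c = k *\<^sub>R chart_normal \<phi> x"
    "\<And>v w. k * (dir_deriv w (dir_deriv v \<phi>) x \<bullet> chart_normal \<phi> x) = - (dir_deriv v \<phi> x \<bullet> dir_deriv w \<phi> x)"
    using sphere_normal[OF U(1,2) s(1) U(3)] by metis
  obtain k' where k': "\<phi> x - c' = k' *\<^sub>R chart_normal \<phi> x"
    "\<And>v w. k' * (dir_deriv w (dir_deriv v \<phi>) x \<bullet> chart_normal \<phi> x) = - (dir_deriv v \<phi> x \<bullet> dir_deriv w \<phi> x)"
    using sphere_normal[OF U(1,2) s(2) U(3)] by metis
  have "dir_deriv (axis 1 1) \<phi> x \<bullet> dir_deriv (axis 1 1) \<phi> x \<noteq> 0"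
    using dir_deriv_nonzero[OF xV, of "axis 1 1"] by (simp add: axis_eq_0_iff)
  then have "k = k'" using k(2)[of "axis 1 1" "axis 1 1"] k'(2)[of "axis 1 1" "axis 1 1"]
    by (metis mult_right_cancel mult_zero_right neg_equal_0_iff_equal)
  then have "\<phi> x - c = \<phi> x - c'" using k k' by simp
  then have "c = c'" by simp
  moreover have "dist c (\<phi> x) = r" "dist c' (\<phi> x) = r'" using s U(3) by auto
  ultimately show ?thesis by simp
qed

text \<open>In a plane the second derivatives are tangential, whereas on a sphere their normal part
  is a nonzero multiple of the first fundamental form.\<close>

lemma not_sphere_and_plane:
  assumes U: "open U" "U \<subseteq> V" "x \<in> U" and s: "\<phi> ` U \<subseteq> sphere c r" and b: "b \<noteq> 0" "\<And>y. y \<in> U \<Longrightarrow> \<phi> y \<bullet> b = k"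
  shows False
proof -
  have xV: "x \<in> V" using U by auto
  have 1: "dir_deriv v \<phi> y \<bullet> b = 0" if "y \<in> U" for y v
    using dir_deriv_eq_0_if_constant[OF U(1) that b(2) has_derivative_inner_left[OF smooth_on_has_derivative[OF chart_smooth]]] that U
    by blast
  have 2: "dir_deriv w (dir_deriv v \<phi>) x \<bullet> b = 0" for v w
    by (rule dir_deriv_eq_0_if_constant[OF U(1,3) 1 has_derivative_inner_left[OF smooth_on_has_derivative[OF smooth_on_dir_deriv[OF chart_smooth] xV]]])
  obtain g where g: "b = g *\<^sub>R chart_normal \<phi> x" using parallel_normal[OF xV 1[OF U(3)]] by metis
  obtain k' where k: "\<And>v w. k' * (dir_deriv w (dir_deriv v \<phi>) x \<bullet> chart_normal \<phi> x) = - (dir_deriv v \<phi> x \<bullet> dir_deriv w \<phi> x)"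
    using sphere_normal[OF U(1,2) s U(3)] by metis
  have "dir_deriv (axis 1 1) \<phi> x \<bullet> dir_deriv (axis 1 1) \<phi> x \<noteq> 0"
    using dir_deriv_nonzero[OF xV, of "axis 1 1"] by (simp add: axis_eq_0_iff)
  then have "dir_deriv (axis 1 1) (dir_deriv (axis 1 1) \<phi>) x \<bullet> chart_normal \<phi> x \<noteq> 0"
    using k[of "axis 1 1" "axis 1 1"] by auto
  moreover have "g \<noteq> 0" using g b by auto
  ultimately show False using 2[of "axis 1 1" "axis 1 1"] by (simp add: g)
qed

text \<open>At umbilic points the derivative of the unit normal \<open>\<nu>\<close> is
  \<open>- l x\<close> times that of \<open>\<phi>\<close> (Weingarten). Differentiating once more,
  symmetry of the second derivative of \<open>\<nu>\<close> equates a multiple of \<open>u\<close>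
  with a multiple of the independent vector \<open>v\<close>, the coefficients being the partial
  derivatives of \<open>l\<close>. So \<open>l\<close> is constant, and then so is
  \<open>\<nu> x + l *\<^sub>R \<phi> x\<close>.\<close>

lemma umbilic_patch:
  assumes conv: "convex V" and umb: "\<And>x. x \<in> V \<Longrightarrow> umbilic_at \<phi> x"
  shows "\<exists>l b. \<forall>x\<in>V. (1 / area_density \<phi> x) *\<^sub>R chart_normal \<phi> x + l *\<^sub>R \<phi> x = b"
proof -
  define N where "N = chart_normal \<phi>"
  define \<nu> where "\<nu> = (\<lambda>x. (1 / norm (N x)) *\<^sub>R N x)"
  \<comment> \<open>The factor in \<open>umbilic_at\<close> is chosen point by point; this quotient
    equals it, up to normalization of the normal, and can be differentiated.\<close>
  define l where "l = (\<lambda>x. (dir_deriv (axis 1 1) (dir_deriv (axis 1 1) \<phi>) x \<bullet> \<nu> x) / (dir_deriv (axis 1 1) \<phi> x \<bullet> dir_deriv (axis 1 1) \<phi> x))"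
  have N0: "N x \<noteq> 0" if "x \<in> V" for x using chart_normal_nonzero[OF that] by (simp add: N_def)
  have g0: "dir_deriv (axis 1 1) \<phi> x \<bullet> dir_deriv (axis 1 1) \<phi> x \<noteq> 0" if "x \<in> V" for x
    using dir_deriv_nonzero[OF that, of "axis 1 1"] by (simp add: axis_eq_0_iff)
  have II: "dir_deriv v (dir_deriv w \<phi>) x \<bullet> \<nu> x = l x * (dir_deriv v \<phi> x \<bullet> dir_deriv w \<phi> x)" if x: "x \<in> V" for x v w
  proof -
    obtain m where "\<And>v w. dir_deriv v (dir_deriv w \<phi>) x \<bullet> N x = m * (dir_deriv v \<phi> x \<bullet> dir_deriv w \<phi> x)"
      using umb[OF x] unfolding umbilic_at_def N_def chart_normal_def by blast
    then have m: "dir_deriv v (dir_deriv w \<phi>) x \<bullet> \<nu> x = m / norm (N x) * (dir_deriv v \<phi> x \<bullet> dir_deriv w \<phi> x)" for v w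
      by (simp add: \<nu>_def)
    have "l x = m / norm (N x)" unfolding l_def m using g0[OF x] by simp
    then show ?thesis using m by simp
  qed
  have d\<phi>: "(\<phi> has_derivative (\<lambda>v. dir_deriv v \<phi> x)) (at x)" if "x \<in> V" for x
    by (rule smooth_on_has_derivative[OF chart_smooth that])
  have dd: "(dir_deriv w \<phi> has_derivative (\<lambda>v. dir_deriv v (dir_deriv w \<phi>) x)) (at x)" if "x \<in> V" for x w
    by (rule smooth_on_has_derivative[OF smooth_on_dir_deriv[OF chart_smooth] that])
  have ddd: "(dir_deriv u (dir_deriv w \<phi>) has_derivative (\<lambda>v. dir_deriv v (dir_deriv u (dir_deriv w \<phi>)) x)) (at x)" if "x \<in> V" for x u w
    by (rule smooth_on_has_derivative[OF smooth_on_dir_deriv[OF smooth_on_dir_deriv[OF chart_smooth]] that])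
  have "\<nu> differentiable (at x)" if x: "x \<in> V" for x
  proof -
    have bc: "bounded_bilinear cross3" using bilinear_cross by (simp add: bilinear_conv_bounded_bilinear)
    have "N differentiable (at x)"
      unfolding N_def chart_normal_def[abs_def] differentiable_def
      using bounded_bilinear.FDERIV[OF bc dd[OF x] dd[OF x]] by blast
    then show ?thesis unfolding \<nu>_def
      by (intro differentiable_scaleR differentiable_divide differentiable_const differentiable_compose[of norm N] differentiable_norm_at)
        (use N0[OF x] in auto)
  qed
  then obtain \<nu>' where \<nu>': "\<And>x. x \<in> V \<Longrightarrow> (\<nu> has_derivative \<nu>' x) (at x)"
    unfolding differentiable_def by metis
  have \<nu>\<nu>: "\<nu> x \<bullet> \<nu> x = 1" if "x \<in> V" for x using N0[OF that]
    by (simp add: \<nu>_def power2_norm_eq_inner[symmetric] power2_eq_square)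
  have \<nu>\<phi>: "\<nu> x \<bullet> dir_deriv v \<phi> x = 0" if "x \<in> V" for x v
    using dir_deriv_normal[OF that, of v] by (simp add: \<nu>_def N_def inner_commute)
  have eq: "\<nu>' x v = - (l x *\<^sub>R dir_deriv v \<phi> x)" if x: "x \<in> V" for x v
  proof -
    \<comment> \<open>\<open>y\<close> turns out to be orthogonal to the tangent plane and to the
      normal, hence zero.\<close>
    define y where "y = \<nu>' x v + l x *\<^sub>R dir_deriv v \<phi> x"
    have a: "\<nu>' x v \<bullet> \<nu> x = 0"
      using dir_deriv_eq_0_if_constant[OF chart_open x _ has_derivative_inner[OF \<nu>'[OF x] \<nu>'[OF x]], of 1 v] \<nu>\<nu>
      by (simp add: inner_commute)
    have b: "\<nu>' x v \<bullet> dir_deriv w \<phi> x = - (l x * (dir_deriv v \<phi> x \<bullet> dir_deriv w \<phi> x))" for w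
      using dir_deriv_eq_0_if_constant[OF chart_open x _ has_derivative_inner[OF \<nu>'[OF x] dd[OF x, of w]], of 0 v] \<nu>\<phi> II[OF x, of v w]
      by (simp add: inner_commute)
    have "dir_deriv w \<phi> x \<bullet> y = 0" for w
      using b[of w] by (simp add: y_def inner_add_right inner_commute[of "dir_deriv w \<phi> x"])
    then obtain k where k: "y = k *\<^sub>R chart_normal \<phi> x" using parallel_normal[OF x] by metis
    have "dir_deriv v \<phi> x \<bullet> \<nu> x = 0" using \<nu>\<phi>[OF x, of v] by (simp add: inner_commute)
    then have "y \<bullet> \<nu> x = 0" using a by (simp add: y_def inner_add_left)
    then have "k * norm (N x) = 0" using N0[OF x]
      by (simp add: k \<nu>_def N_def[symmetric] power2_norm_eq_inner[symmetric] power2_eq_square)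
    then have "y = 0" using N0[OF x] k by simp
    then show ?thesis by (simp add: y_def add_eq_0_iff2)
  qed
  have d\<nu>: "(\<nu> has_derivative (\<lambda>v. - (l x *\<^sub>R dir_deriv v \<phi> x))) (at x)" if "x \<in> V" for x
    using \<nu>'[OF that] eq[OF that] by (metis (no_types, lifting) ext)
  have "\<exists>l'. (l has_derivative l') (at x)" if x: "x \<in> V" for x
    unfolding l_def using has_derivative_divide[OF has_derivative_inner[OF ddd[OF x] \<nu>'[OF x]] has_derivative_inner[OF dd[OF x] dd[OF x]] g0[OF x]] by blast
  then obtain l' where l': "\<And>x. x \<in> V \<Longrightarrow> (l has_derivative l' x) (at x)" by metis
  have l'0: "l' x = (\<lambda>v. 0)" if x: "x \<in> V" for x
  proof -
    define u where "u = dir_deriv (axis 1 1) \<phi> x"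
    define v where "v = dir_deriv (axis 2 1) \<phi> x"
    \<comment> \<open>So far \<open>\<nu>\<close> is known to be differentiable only once; a second
      derivative exists because \<open>d\<nu>\<close> expresses the first one by differentiable
      functions.\<close>
    have F: "((\<lambda>y. - (l y *\<^sub>R dir_deriv e \<phi> y)) has_derivative (\<lambda>w. - (l x *\<^sub>R dir_deriv w (dir_deriv e \<phi>) x + l' x w *\<^sub>R dir_deriv e \<phi> x))) (at x)" for e
      by (intro has_derivative_minus has_derivative_scaleR l' dd x)
    have "- (l x *\<^sub>R dir_deriv (axis 2 1) (dir_deriv (axis 1 1) \<phi>) x + l' x (axis 2 1) *\<^sub>R u) =
      - (l x *\<^sub>R dir_deriv (axis 1 1) (dir_deriv (axis 2 1) \<phi>) x + l' x (axis 1 1) *\<^sub>R v)"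
      unfolding u_def v_def by (rule second_derivative_symmetric[OF chart_open x d\<nu> F F])
    then have e: "l' x (axis 2 1) *\<^sub>R u = l' x (axis 1 1) *\<^sub>R v"
      using dir_deriv_commute[OF chart_smooth chart_open x, of "axis 2 1" "axis 1 1"] by simp
    have N: "cross3 u v \<noteq> 0" using N0[OF x] by (simp add: N_def chart_normal_def u_def v_def)
    have "cross3 u (l' x (axis 2 1) *\<^sub>R u) = cross3 u (l' x (axis 1 1) *\<^sub>R v)" using e by simp
    then have 1: "l' x (axis 1 1) = 0" using N by (simp add: cross_mult_right)
    have "cross3 (l' x (axis 2 1) *\<^sub>R u) v = cross3 (l' x (axis 1 1) *\<^sub>R v) v" using e by simp
    then have 2: "l' x (axis 2 1) = 0" using N by (simp add: cross_mult_left)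
    show ?thesis using linear_2[OF has_derivative_linear[OF l'[OF x]]] 1 2
      by (intro ext) (metis add.right_neutral scaleR_zero_right)
  qed
  have "(l has_derivative (\<lambda>v. 0)) (at x within V)" if "x \<in> V" for x
    using l'[OF that] l'0[OF that] by (metis has_derivative_at_withinI)
  then have "\<exists>l0. \<forall>x\<in>V. l x = l0" by (rule has_derivative_zero_constant[OF conv])
  then obtain l0 where l0: "\<And>x. x \<in> V \<Longrightarrow> l x = l0" by blast
  have "((\<lambda>x. \<nu> x + l0 *\<^sub>R \<phi> x) has_derivative (\<lambda>v. 0)) (at x within V)" if x: "x \<in> V" for x
  proof -
    have "((\<lambda>x. \<nu> x + l0 *\<^sub>R \<phi> x) has_derivative (\<lambda>v. - (l x *\<^sub>R dir_deriv v \<phi> x) + l0 *\<^sub>R dir_deriv v \<phi> x)) (at x)"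
      by (intro has_derivative_add d\<nu> has_derivative_scaleR_right d\<phi> x)
    then show ?thesis by (simp add: l0[OF x] has_derivative_at_withinI)
  qed
  then have "\<exists>b. \<forall>x\<in>V. \<nu> x + l0 *\<^sub>R \<phi> x = b"
    by (rule has_derivative_zero_constant[OF conv])
  then show ?thesis unfolding \<nu>_def N_def norm_chart_normal by blast
qed

text \<open>The constants of \<open>umbilic_patch\<close> give the centre
  \<open>(1 / l) *\<^sub>R b\<close> of a sphere or, if \<open>l = 0\<close>, the fixed normal
  \<open>b\<close> of a plane.\<close>

lemma umbilic_sphere_or_plane:
  assumes conv: "convex V" and umb: "\<And>x. x \<in> V \<Longrightarrow> umbilic_at \<phi> x" and ne: "V \<noteq> {}"
  shows "(\<exists>c r. r > 0 \<and> \<phi> ` V \<subseteq> sphere c r) \<or> (\<exists>b k. norm b = 1 \<and> (\<forall>x\<in>V. \<phi> x \<bullet> b = k))"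
proof -
  define \<nu> where "\<nu> = (\<lambda>x. (1 / area_density \<phi> x) *\<^sub>R chart_normal \<phi> x)"
  obtain l b where lb: "\<And>x. x \<in> V \<Longrightarrow> \<nu> x + l *\<^sub>R \<phi> x = b"
    using umbilic_patch[OF conv umb] unfolding \<nu>_def by blast
  have n\<nu>: "norm (\<nu> x) = 1" if "x \<in> V" for x
    using chart_normal_nonzero[OF that] by (simp add: \<nu>_def norm_chart_normal[symmetric])
  show ?thesis
  proof (cases "l = 0")
    case False
    have "\<phi> x \<in> sphere ((1 / l) *\<^sub>R b) (1 / \<bar>l\<bar>)" if x: "x \<in> V" for x
    proof -
      have "(1 / l) *\<^sub>R b - \<phi> x = (1 / l) *\<^sub>R \<nu> x" using lb[OF x] False
        by (auto simp: scaleR_add_right)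
      then show ?thesis using n\<nu>[OF x] by (simp add: dist_norm)
    qed
    then show ?thesis using False by (intro disjI1 exI[of _ "(1 / l) *\<^sub>R b"] exI[of _ "1 / \<bar>l\<bar>"]) auto
  next
    case True
    then have b: "\<nu> x = b" if "x \<in> V" for x using lb[OF that] by simp
    obtain x0 where x0: "x0 \<in> V" using ne by auto
    have nb: "norm b = 1" using n\<nu>[OF x0] b[OF x0] by simp
    have "((\<lambda>x. \<phi> x \<bullet> b) has_derivative (\<lambda>v. 0)) (at x within V)" if x: "x \<in> V" for x
    proof -
      have "((\<lambda>x. \<phi> x \<bullet> b) has_derivative (\<lambda>v. dir_deriv v \<phi> x \<bullet> b)) (at x)"
        by (rule has_derivative_inner_left[OF smooth_on_has_derivative[OF chart_smooth x]])
      moreover have "dir_deriv v \<phi> x \<bullet> b = 0" for v using dir_deriv_normal[OF x, of v] b[OF x]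
        by (auto simp: \<nu>_def)
      ultimately show ?thesis by (simp add: has_derivative_at_withinI)
    qed
    then have "\<exists>k. \<forall>x\<in>V. \<phi> x \<bullet> b = k" by (rule has_derivative_zero_constant[OF conv])
    then show ?thesis using nb by blast
  qed
qed

end

section \<open>Gluing of umbilic patches and the global sphere\<close>

lemma chart_ball_at:
  assumes M: "smooth_surface M" and p: "p \<in> M"
  obtains x d \<phi> where "d > 0" "local_parametrization M (ball x d) \<phi>" "\<phi> x = p"
proof -
  obtain V \<phi> where V: "local_parametrization M V \<phi>" "p \<in> \<phi> ` V" using assms
    by (auto simp: smooth_surface_def)
  then obtain x where x: "x \<in> V" "p = \<phi> x" by auto
  obtain d where d: "d > 0" "ball x d \<subseteq> V" using chart_open[OF V(1)] x(1) openE by blast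
  show thesis using that[OF d(1) local_parametrization_restrict[OF V(1) open_ball d(2)]] x by simp
qed

text \<open>Two arguments below end with a whole chart collapsing to a point; this is the
  contradiction.\<close>

lemma chart_ball_two_points:
  assumes d: "d > 0" and lp: "local_parametrization M (ball x d) \<phi>"
  obtains y where "y \<in> ball x d" "\<phi> y \<noteq> \<phi> x"
proof
  define y where "y = x + (d / 2) *\<^sub>R axis 1 1"
  show "y \<in> ball x d" using d by (simp add: y_def dist_norm)
  moreover have "y \<noteq> x" using d by (simp add: y_def axis_eq_0_iff)
  ultimately show "\<phi> y \<noteq> \<phi> x" using chart_injective[OF lp, of y x] d by auto
qed

lemma image_ball_openin:
  assumes "local_parametrization M V \<phi>"
  obtains T where "open T" "\<phi> ` V = M \<inter> T"
  using assms unfolding local_parametrization_def openin_open by blast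

lemma surface_in_sphere_eq_sphere:
  assumes M: "smooth_surface M" "compact M" "M \<noteq> {}" and r: "r > 0" and sub: "M \<subseteq> sphere c r"
  shows "M = sphere c r"
proof (rule ccontr)
  assume "M \<noteq> sphere c r"
  then obtain q where q: "q \<in> sphere c r" "q \<notin> M" using sub by blast
  \<comment> \<open>On a sphere about \<open>c\<close>, being nearest to \<open>q\<close> means
    having the largest inner product with \<open>q - c\<close>; this function is affine and easy to
    differentiate.\<close>
  have "continuous_on M (\<lambda>v. v \<bullet> (q - c))" by (intro continuous_intros)
  then obtain p where p: "p \<in> M" "\<And>v. v \<in> M \<Longrightarrow> v \<bullet> (q - c) \<le> p \<bullet> (q - c)"
    using continuous_attains_sup[OF M(2,3)] by blast
  obtain x d \<phi> where d: "d > 0" and lp: "local_parametrization M (ball x d) \<phi>" and px: "\<phi> x = p"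
    by (rule chart_ball_at[OF M(1) p(1)]) (rule that)
  have x: "x \<in> ball x d" using d by simp
  have inM: "\<phi> y \<in> M" if "y \<in> ball x d" for y using local_parametrization_image_subset[OF lp] that by blast
  have der: "((\<lambda>y. \<phi> y \<bullet> (q - c)) has_derivative (\<lambda>v. dir_deriv v \<phi> x \<bullet> (q - c))) (at x)"
    by (rule has_derivative_inner_left[OF smooth_on_has_derivative[OF chart_smooth[OF lp] x]])
  have "(\<lambda>v. dir_deriv v \<phi> x \<bullet> (q - c)) = (\<lambda>v. 0)"
    by (rule differential_zero_maxmin[OF x open_ball der]) (use p(2) inM px in blast)
  then have "dir_deriv v \<phi> x \<bullet> (q - c) = 0" for v by (metis)
  then obtain k where k: "q - c = k *\<^sub>R chart_normal \<phi> x" using parallel_normal[OF lp x] by metis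
  obtain m where m: "p - c = m *\<^sub>R chart_normal \<phi> x"
    using sphere_normal[OF lp open_ball order_refl _ x, of c r] sub inM px by (metis image_subset_iff subset_iff)
  have nq: "norm (q - c) = r" using q by (auto simp: dist_norm norm_minus_commute)
  have nM: "norm (v - c) = r" if "v \<in> M" for v using sub that by (auto simp: dist_norm norm_minus_commute)
  \<comment> \<open>Vectors of equal length on the same normal line agree up to sign, so
    \<open>q\<close> is \<open>p\<close> or its antipode.\<close>
  have "\<bar>k\<bar> = \<bar>m\<bar>" using nq nM[OF p(1)] k m chart_normal_nonzero[OF lp x]
    by (metis mult_right_cancel norm_eq_zero norm_scaleR)
  then consider "k = m" | "k = - m" by linarith
  then show False
  proof cases
    case 1
    then have "q = p" using k m by (metis diff_add_cancel)
    then show False using q p by simp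
  next
    case 2
    \<comment> \<open>At the antipode of \<open>q\<close> the inner product is minimal on the whole
      sphere. If it is also the maximum over \<open>M\<close>, every point of the chart has to
      coincide with \<open>p\<close>.\<close>
    then have qp: "q - c = - (p - c)" using k m by simp
    obtain y where y: "y \<in> ball x d" "\<phi> y \<noteq> \<phi> x"
      by (rule chart_ball_two_points[OF d lp]) (rule that)
    define w where "w = \<phi> y - c"
    have wn: "w \<bullet> w = r\<^sup>2" using nM[OF inM[OF y(1)]] by (simp add: w_def power2_norm_eq_inner[symmetric])
    have pn: "(p - c) \<bullet> (p - c) = r\<^sup>2" using nM[OF p(1)] by (simp add: power2_norm_eq_inner[symmetric])
    have "w \<bullet> (q - c) \<le> (p - c) \<bullet> (q - c)" using p(2)[OF inM[OF y(1)]]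
      by (simp add: w_def inner_diff_left)
    then have "w \<bullet> (p - c) \<ge> r\<^sup>2" unfolding qp inner_minus_right pn by simp
    define z where "z = p - c"
    from \<open>w \<bullet> (p - c) \<ge> r\<^sup>2\<close> have "w \<bullet> z \<ge> r\<^sup>2" "z \<bullet> z = r\<^sup>2"
      using pn by (simp_all add: z_def)
    then have "(w - z) \<bullet> (w - z) \<le> 0"
      using wn by (simp add: inner_diff_left inner_diff_right inner_commute)
    then have "w = z" by (metis inner_gt_zero_iff not_less right_minus_eq)
    then show False using y px by (simp add: w_def z_def)
  qed
qed

lemma umbilic_surface_eq_sphere:
  assumes M: "smooth_surface M" "compact M" "connected M" "M \<noteq> {}"
    and umb: "\<And>V \<phi> x. local_parametrization M V \<phi> \<Longrightarrow> x \<in> V \<Longrightarrow> umbilic_at \<phi> x"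
  shows "\<exists>c r. r > 0 \<and> M = sphere c r"
proof -
  have piece: "(\<exists>c r. r > 0 \<and> \<phi> ` ball x d \<subseteq> sphere c r) \<or> (\<exists>b k. norm b = 1 \<and> (\<forall>y\<in>ball x d. \<phi> y \<bullet> b = k))"
    if "local_parametrization M (ball x d) \<phi>" "d > 0" for x d \<phi>
    using umbilic_sphere_or_plane[OF that(1) convex_ball umb[OF that(1)]] that(2) by simp
  obtain p0 where p0: "p0 \<in> M" "\<And>v. v \<in> M \<Longrightarrow> v \<bullet> v \<le> p0 \<bullet> p0"
  proof -
    have "continuous_on M (\<lambda>v. v \<bullet> v)" by (intro continuous_intros)
    then show ?thesis using continuous_attains_sup[OF M(2,4), of "\<lambda>v. v \<bullet> v"] that by blast
  qed
  obtain x0 d0 \<phi>0 where d0: "d0 > 0" and lp0: "local_parametrization M (ball x0 d0) \<phi>0" and px0: "\<phi>0 x0 = p0"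
    by (rule chart_ball_at[OF M(1) p0(1)]) (rule that)
  have x0: "x0 \<in> ball x0 d0" using d0 by simp
  have inM0: "\<phi>0 y \<in> M" if "y \<in> ball x0 d0" for y using local_parametrization_image_subset[OF lp0] that
    by blast
  \<comment> \<open>At a farthest point the position vector is normal to the surface. If the patch
    lay in a plane, that point would be the foot of the perpendicular from the origin, hence the
    nearest point of the plane; being farthest as well, it would be the only point of the
    patch.\<close>
  have "\<not> (\<exists>b k. norm b = 1 \<and> (\<forall>y\<in>ball x0 d0. \<phi>0 y \<bullet> b = k))"
  proof
    assume "\<exists>b k. norm b = 1 \<and> (\<forall>y\<in>ball x0 d0. \<phi>0 y \<bullet> b = k)"
    then obtain b k where b: "norm b = 1" "\<And>y. y \<in> ball x0 d0 \<Longrightarrow> \<phi>0 y \<bullet> b = k"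
      by blast
    have d\<phi>: "(\<phi>0 has_derivative (\<lambda>v. dir_deriv v \<phi>0 x0)) (at x0)"
      by (rule smooth_on_has_derivative[OF chart_smooth[OF lp0] x0])
    have "(\<lambda>v. \<phi>0 x0 \<bullet> dir_deriv v \<phi>0 x0 + dir_deriv v \<phi>0 x0 \<bullet> \<phi>0 x0) = (\<lambda>v. 0)"
      by (rule differential_zero_maxmin[OF x0 open_ball has_derivative_inner[OF d\<phi> d\<phi>]]) (use p0(2) inM0 px0 in blast)
    then have "\<phi>0 x0 \<bullet> dir_deriv v \<phi>0 x0 + dir_deriv v \<phi>0 x0 \<bullet> \<phi>0 x0 = 0" for v
      by metis
    then have 1: "dir_deriv v \<phi>0 x0 \<bullet> \<phi>0 x0 = 0" for v by (simp add: inner_commute)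
    have 2: "dir_deriv v \<phi>0 x0 \<bullet> b = 0" for v
      by (rule dir_deriv_eq_0_if_constant[OF open_ball x0 b(2) has_derivative_inner_left[OF d\<phi>]])
    obtain g where g: "\<phi>0 x0 = g *\<^sub>R chart_normal \<phi>0 x0" using parallel_normal[OF lp0 x0 1] by metis
    obtain h where h: "b = h *\<^sub>R chart_normal \<phi>0 x0" using parallel_normal[OF lp0 x0 2] by metis
    have "h \<noteq> 0" using h b(1) by auto
    then have gb: "\<phi>0 x0 = (g / h) *\<^sub>R b" using g h by simp
    have bb: "b \<bullet> b = 1" using b(1) by (simp add: norm_eq_1)
    have "g / h = k" using b(2)[OF x0] bb unfolding gb by simp
    then have gk: "\<phi>0 x0 = k *\<^sub>R b" using gb by simp
    obtain y where y: "y \<in> ball x0 d0" "\<phi>0 y \<noteq> \<phi>0 x0"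
      by (rule chart_ball_two_points[OF d0 lp0]) (rule that)
    have "\<phi>0 y \<bullet> \<phi>0 y \<le> \<phi>0 x0 \<bullet> \<phi>0 x0" using p0(2)[OF inM0[OF y(1)]] px0 by simp
    then have "(\<phi>0 y - k *\<^sub>R b) \<bullet> (\<phi>0 y - k *\<^sub>R b) \<le> 0"
  proof -
    have "(\<phi>0 y - k *\<^sub>R b) \<bullet> (\<phi>0 y - k *\<^sub>R b) = \<phi>0 y \<bullet> \<phi>0 y - 2 * k * (\<phi>0 y \<bullet> b) + k * k * (b \<bullet> b)"
      by (simp add: inner_diff_left inner_diff_right inner_commute algebra_simps)
    moreover have "\<phi>0 x0 \<bullet> \<phi>0 x0 = k * k" using bb by (simp add: gk)
    ultimately show ?thesis
      using b(2)[OF y(1)] bb \<open>\<phi>0 y \<bullet> \<phi>0 y \<le> \<phi>0 x0 \<bullet> \<phi>0 x0\<close> by simp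
  qed
    then have "\<phi>0 y = k *\<^sub>R b" by (metis inner_gt_zero_iff not_less right_minus_eq)
    then show False using y gk by simp
  qed
  then obtain c r where r: "r > 0" and s0: "\<phi>0 ` ball x0 d0 \<subseteq> sphere c r" using piece[OF lp0 d0] by blast
  \<comment> \<open>\<open>W\<close> is relatively open by definition. For its complement, a chart
    ball about a point outside \<open>W\<close> is shown to miss \<open>W\<close>: otherwise
    uniqueness would force the sphere of this ball to be \<open>sphere c r\<close>, and a plane
    cannot share an open piece with a sphere.\<close>
  define W where "W = {p \<in> M. \<exists>T. open T \<and> p \<in> T \<and> M \<inter> T \<subseteq> sphere c r}"
  have "openin (top_of_set M) W"
    unfolding openin_subopen[of _ W]
  proof
    fix p assume "p \<in> W"
    then obtain T where T: "p \<in> M" "open T" "p \<in> T" "M \<inter> T \<subseteq> sphere c r" by (auto simp: W_def)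
    then have "M \<inter> T \<subseteq> W" by (auto simp: W_def)
    moreover have "openin (top_of_set M) (M \<inter> T)" using T(2) by (rule openin_open_Int)
    ultimately show "\<exists>T. openin (top_of_set M) T \<and> p \<in> T \<and> T \<subseteq> W" using T by blast
  qed
  moreover have "openin (top_of_set M) (M - W)"
    unfolding openin_subopen[of _ "M - W"]
  proof
    fix p assume p: "p \<in> M - W"
    obtain x d \<phi> where d: "d > 0" and lp: "local_parametrization M (ball x d) \<phi>" and px: "\<phi> x = p"
      by (rule chart_ball_at[OF M(1), of p]) (use p that in auto)
    obtain T where T: "open T" "\<phi> ` ball x d = M \<inter> T" by (rule image_ball_openin[OF lp]) (rule that)
    have "\<phi> ` ball x d \<inter> W = {}"
    proof (rule ccontr)
      assume "\<phi> ` ball x d \<inter> W \<noteq> {}"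
      then obtain y where y: "y \<in> ball x d" "\<phi> y \<in> W" by blast
      then obtain T' where T': "open T'" "\<phi> y \<in> T'" "M \<inter> T' \<subseteq> sphere c r"
        by (auto simp: W_def)
      define U where "U = ball x d \<inter> \<phi> -` T'"
      have U: "open U" unfolding U_def
        by (rule continuous_open_preimage[OF smooth_on_continuous[OF chart_smooth[OF lp]] open_ball T'(1)])
      have yU: "y \<in> U" and UV: "U \<subseteq> ball x d" using y T' by (auto simp: U_def)
      have sU: "\<phi> ` U \<subseteq> sphere c r" using T'(3) local_parametrization_image_subset[OF lp]
        by (auto simp: U_def)
      show False using piece[OF lp d]
      proof
        assume "\<exists>c r. r > 0 \<and> \<phi> ` ball x d \<subseteq> sphere c r"
        then obtain c' r' where s': "\<phi> ` ball x d \<subseteq> sphere c' r'" by blast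
        then have "\<phi> ` U \<subseteq> sphere c' r'" using UV by blast
        then have "c = c' \<and> r = r'" using sphere_unique[OF lp U UV yU sU] by blast
        then have "M \<inter> T \<subseteq> sphere c r" using s' T by simp
        moreover have "p \<in> T" using T(2) px d by (metis IntD2 centre_in_ball imageI)
        ultimately have "p \<in> W" using p T(1) by (auto simp: W_def)
        then show False using p by simp
      next
        assume "\<exists>b k. norm b = 1 \<and> (\<forall>y\<in>ball x d. \<phi> y \<bullet> b = k)"
        then obtain b k where b: "norm b = 1" "\<And>y. y \<in> U \<Longrightarrow> \<phi> y \<bullet> b = k" using UV
          by blast
        then show False using not_sphere_and_plane[OF lp U UV yU sU _ b(2)] by force
      qed
    qed
    then have "M \<inter> T \<subseteq> M - W" using T by auto
    moreover have "p \<in> M \<inter> T" using T(2) px d by (metis centre_in_ball imageI)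
    moreover have "openin (top_of_set M) (M \<inter> T)" using T(1) by (rule openin_open_Int)
    ultimately show "\<exists>T. openin (top_of_set M) T \<and> p \<in> T \<and> T \<subseteq> M - W" by blast
  qed
  moreover have "W \<subseteq> M" by (auto simp: W_def)
  ultimately have "openin (top_of_set M) W" "closedin (top_of_set M) W" by (simp_all add: closedin_def)
  then have "W = {} \<or> W = M" using M(3) unfolding connected_clopen by blast
  moreover have "p0 \<in> W"
  proof -
    obtain T where T: "open T" "\<phi>0 ` ball x0 d0 = M \<inter> T" by (rule image_ball_openin[OF lp0]) (rule that)
    have "p0 \<in> T" using T(2) px0 x0 by (metis IntD2 imageI)
    then show ?thesis using T s0 p0(1) by (auto simp: W_def)
  qed
  ultimately have "M \<subseteq> sphere c r" by (auto simp: W_def)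
  then show ?thesis using surface_in_sphere_eq_sphere[OF M(1,2,4) r] r by blast
qed

section \<open>From the Gaussian expansion to the residue\<close>

text \<open>The factor \<open>t powr (z - 1)\<close> is expanded in powers of \<open>z - z0\<close>
  under the integral. The partial sums are dominated by means of
  \<open>exp (\<rho> * \<bar>ln t\<bar>)\<close>, hence by two powers of \<open>t\<close>, one for
  small and one for large \<open>t\<close>, whose exponents still belong to the strip of
  convergence.\<close>

lemma mellin_holomorphic:
  fixes g :: "real \<Rightarrow> real"
  assumes [measurable]: "g \<in> borel_measurable borel"
    and g0: "\<And>t. t \<le> 0 \<Longrightarrow> g t = 0"
    and int: "\<And>\<sigma>. a < \<sigma> \<Longrightarrow> \<sigma> < b \<Longrightarrow> integrable lborel (\<lambda>t. t powr (\<sigma> - 1) * g t)"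
  shows "(\<lambda>z. \<integral>t. complex_of_real t powr (z - 1) * complex_of_real (g t) \<partial>lborel)
           holomorphic_on {z. a < Re z \<and> Re z < b}" (is "?F holomorphic_on ?U")
proof -
  have "\<exists>r>0. ?F holomorphic_on ball z0 r" if z0: "z0 \<in> ?U" for z0
  proof -
    define r where "r = min (Re z0 - a) (b - Re z0) / 2"
    have r: "r > 0" "a < Re z0 - r" "Re z0 + r < b"
      using z0 by (auto simp: r_def min_def field_simps split: if_splits)
    define h where "h = (\<lambda>t. (t powr (Re z0 - r - 1) * \<bar>g t\<bar> + t powr (Re z0 + r - 1) * \<bar>g t\<bar>))"
    have i1: "integrable lborel (\<lambda>t. t powr (Re z0 - r - 1) * \<bar>g t\<bar>)"
      using integrable_abs[OF int[of "Re z0 - r"]] r by (simp add: abs_mult)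
    have i2: "integrable lborel (\<lambda>t. t powr (Re z0 + r - 1) * \<bar>g t\<bar>)"
      using integrable_abs[OF int[of "Re z0 + r"]] r by (simp add: abs_mult)
    have inth: "integrable lborel h"
      unfolding h_def using i1 i2 by (rule Bochner_Integration.integrable_add)
    define a' where "a' = (\<lambda>n t. complex_of_real t powr (z0 - 1) * complex_of_real (g t) * (of_real (ln t))^n /\<^sub>R fact n)"
    have meas_a [measurable]: "a' n \<in> borel_measurable lborel" for n
      unfolding a'_def by measurable
    have "((\<lambda>n. (\<integral>t. a' n t \<partial>lborel) * (w - z0)^n) sums ?F w)" if w: "w \<in> ball z0 r" for w
    proof -
      define \<rho> where "\<rho> = norm (w - z0)"
      have \<rho>: "0 \<le> \<rho>" "\<rho> < r" using w by (auto simp: \<rho>_def dist_norm norm_minus_commute)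
      define f where "f = (\<lambda>n t. a' n t * (w - z0)^n)"
      have meas_f [measurable]: "f n \<in> borel_measurable lborel" for n unfolding f_def by measurable
      have nf: "norm (f n t) = t powr (Re z0 - 1) * \<bar>g t\<bar> * ((\<rho> * \<bar>ln t\<bar>)^n /\<^sub>R fact n)" if "t > 0" for n t
        using that by (simp add: f_def a'_def norm_mult norm_power \<rho>_def norm_powr_real_powr power_mult_distrib divide_inverse)
      have nf0: "f n t = 0" if "t \<le> 0" for n t using g0[OF that] by (simp add: f_def a'_def)
      have hbound: "t powr (Re z0 - 1) * \<bar>g t\<bar> * exp (\<rho> * \<bar>ln t\<bar>) \<le> h t" if t: "t > 0" for t
      proof -
        have "exp (\<rho> * \<bar>ln t\<bar>) \<le> t powr (-r) + t powr r"
        proof (cases "ln t \<ge> 0")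
          case True
          then have "exp (\<rho> * \<bar>ln t\<bar>) \<le> exp (r * ln t)" using \<rho>
            by (auto intro!: mult_right_mono)
          also have "\<dots> = t powr r" using t by (simp add: powr_def)
          also have "\<dots> \<le> t powr (-r) + t powr r" by simp
          finally show ?thesis .
        next
          case False
          then have "exp (\<rho> * \<bar>ln t\<bar>) \<le> exp (- r * ln t)" using \<rho>
            by (auto intro!: mult_right_mono)
          also have "\<dots> = t powr (-r)" using t by (simp add: powr_def)
          also have "\<dots> \<le> t powr (-r) + t powr r" by simp
          finally show ?thesis .
        qed
        then have "t powr (Re z0 - 1) * \<bar>g t\<bar> * exp (\<rho> * \<bar>ln t\<bar>) \<le> t powr (Re z0 - 1) * \<bar>g t\<bar> * (t powr (-r) + t powr r)"
          by (intro mult_left_mono) auto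
        also have "\<dots> = h t" using t
          by (simp add: h_def powr_add powr_diff powr_minus field_simps)
        finally show ?thesis .
      qed
      have psum: "(\<Sum>n<N. norm (f n t)) \<le> h t" for N t
      proof (cases "t > 0")
        case True
        have s: "(\<lambda>n. (\<rho> * \<bar>ln t\<bar>)^n /\<^sub>R fact n) sums exp (\<rho> * \<bar>ln t\<bar>)"
          by (rule exp_converges)
        have "(\<Sum>n<N. (\<rho> * \<bar>ln t\<bar>)^n /\<^sub>R fact n) \<le> exp (\<rho> * \<bar>ln t\<bar>)"
          using sum_le_suminf[OF sums_summable[OF s], of "{..<N}"] \<rho> sums_unique[OF s] by auto
        then have "(\<Sum>n<N. norm (f n t)) \<le> t powr (Re z0 - 1) * \<bar>g t\<bar> * exp (\<rho> * \<bar>ln t\<bar>)"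
          unfolding nf[OF True] sum_distrib_left[symmetric] by (intro mult_left_mono) auto
        then show ?thesis using hbound[OF True] by simp
      qed (simp add: nf0 h_def)
      have f_le: "norm (f n t) \<le> h t" for n t
      proof -
        have "norm (f n t) \<le> (\<Sum>k<Suc n. norm (f k t))"
          by (simp add: sum_nonneg)
        then show ?thesis using psum[of t "Suc n"] by linarith
      qed
      have int_f: "integrable lborel (f n)" for n
        by (rule Bochner_Integration.integrable_bound[OF inth]) (auto intro!: AE_I2 order_trans[OF f_le abs_ge_self])
      have summ: "summable (\<lambda>n. norm (f n t))" for t
        by (rule summableI_nonneg_bounded[OF _ psum]) auto
      have summ2: "summable (\<lambda>n. \<integral>t. norm (f n t) \<partial>lborel)"
      proof (rule summableI_nonneg_bounded)
        fix N
        have "(\<Sum>n<N. \<integral>t. norm (f n t) \<partial>lborel) = (\<integral>t. (\<Sum>n<N. norm (f n t)) \<partial>lborel)"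
          by (subst Bochner_Integration.integral_sum) (auto intro: integrable_norm int_f)
        also have "\<dots> \<le> integral\<^sup>L lborel h"
          by (intro integral_mono inth Bochner_Integration.integrable_sum integrable_norm int_f psum)
        finally show "(\<Sum>n<N. \<integral>t. norm (f n t) \<partial>lborel) \<le> integral\<^sup>L lborel h" .
      qed auto
      have s: "(\<lambda>n. integral\<^sup>L lborel (f n)) sums (\<integral>t. (\<Sum>n. f n t) \<partial>lborel)"
        by (rule sums_integral) (auto intro: int_f summ summ2)
      have "(\<Sum>n. f n t) = complex_of_real t powr (w - 1) * complex_of_real (g t)" for t
      proof (cases "t > 0")
        case True
        have "(\<lambda>n. complex_of_real t powr (z0 - 1) * complex_of_real (g t) * (((w - z0) * of_real (ln t))^n /\<^sub>R fact n))
           sums (complex_of_real t powr (z0 - 1) * complex_of_real (g t) * exp ((w - z0) * of_real (ln t)))"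
          by (intro sums_mult exp_converges)
        moreover have "complex_of_real t powr (z0 - 1) * exp ((w - z0) * of_real (ln t)) = complex_of_real t powr (w - 1)"
          using True by (simp add: powr_def Ln_of_real flip: exp_add) (simp add: algebra_simps)
        ultimately show ?thesis
          by (intro sums_unique[symmetric]) (simp add: f_def a'_def power_mult_distrib mult_ac scaleR_conv_of_real)
      qed (simp add: nf0 g0)
      then have "(\<lambda>n. integral\<^sup>L lborel (f n)) sums ?F w" using s by simp
      then show ?thesis unfolding f_def by (simp add: integral_mult_left_zero)
    qed
    then have "?F holomorphic_on ball z0 r" by (rule power_series_holomorphic)
    then show ?thesis using r by blast
  qed
  then have "?F field_differentiable (at z)" if "z \<in> ?U" for z
    using that by (meson centre_in_ball holomorphic_on_imp_differentiable_at open_ball)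
  then show ?thesis
    by (meson field_differentiable_at_within holomorphic_on_def)
qed

lemma integrable_powr_0_1:
  assumes "(e::real) > -1"
  shows "integrable lborel (\<lambda>t. indicator {0<..<1} t * t powr e)"
proof -
  have "(\<lambda>x. x powr e) absolutely_integrable_on {0..1}"
    using has_integral_powr_from_0[OF assms, of 1]
    by (intro nonnegative_absolutely_integrable_1) (auto simp: integrable_on_def)
  then have "set_integrable lebesgue {0<..<1} (\<lambda>x. x powr e)"
    by (rule set_integrable_subset) auto
  then show ?thesis
    unfolding set_integrable_def by (subst (asm) integrable_completion) auto
qed

lemma integrable_powr_1_inf:
  assumes "(e::real) < -1"
  shows "integrable lborel (\<lambda>t. indicator {1..} t * t powr e)"
    "(\<integral>t. indicator {1..} t * t powr e \<partial>lborel) = 1 / (- e - 1)"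
proof -
  have hi: "((\<lambda>x. x powr e) has_integral (1 / (- e - 1))) {1..}"
  proof -
    have "1 / (- e - 1) = - (1 powr (e + 1)) / (e + 1)"
      using assms by (simp add: divide_simps)
    then show ?thesis using has_integral_powr_to_inf[OF assms, of 1] by simp
  qed
  have "(\<lambda>x. x powr e) absolutely_integrable_on {1..}"
    using hi by (intro nonnegative_absolutely_integrable_1) (auto simp: integrable_on_def)
  then have si: "set_integrable lebesgue {1..} (\<lambda>x. x powr e)" by simp
  then show i: "integrable lborel (\<lambda>t. indicator {1..} t * t powr e)"
    unfolding set_integrable_def by (subst (asm) integrable_completion) auto
  have "1 / (- e - 1) = (LINT x:{1..}|lebesgue. x powr e)"
    using set_lebesgue_integral_eq_integral(2)[OF si] hi by (simp add: integral_unique)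
  also have "\<dots> = (\<integral>t. indicator {1..} t * t powr e \<partial>lborel)"
    unfolding set_lebesgue_integral_def by (subst integral_completion) auto
  finally show "(\<integral>t. indicator {1..} t * t powr e \<partial>lborel) = 1 / (- e - 1)" ..
qed

text \<open>A meromorphic function may have arbitrary values on a discrete set, so the identity
  theorem is applied to \<open>remove_sings D\<close>, and the conclusion is about a punctured
  neighbourhood of \<open>z2\<close>.\<close>

lemma meromorphic_eq_0_eventually:
  assumes D: "D meromorphic_on U" and U: "open U" "connected U" and z1: "z1 \<in> U" "z2 \<in> U"
    and fr: "\<exists>\<^sub>F z in at z1. D z = 0"
  shows "\<forall>\<^sub>F z in at z2. D z = 0"
proof -
  have iso: "isolated_singularity_at D z" if "z \<in> U" for z
    using D that by (meson meromorphic_on_altdef)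
  have nm: "remove_sings D nicely_meromorphic_on U"
    using D by (rule remove_sings_nicely_meromorphic)
  have ev: "\<forall>\<^sub>F z in at z. remove_sings D z = D z" if "z \<in> U" for z
    using iso[OF that] by (rule eventually_remove_sings_eq_at)
  have "\<exists>\<^sub>F z in at z1. remove_sings D z = 0"
    using frequently_eventually_frequently[OF fr ev[OF z1(1)]] by (rule frequently_elim1) auto
  then have "remove_sings D w = 0" if "w \<in> U" for w
    using frequently_eq_meromorphic_imp_constant[OF _ nm U z1(1) that] by blast
  moreover have "\<forall>\<^sub>F z in at z2. z \<in> U" using U z1 by (intro eventually_at_in_open') auto
  ultimately show ?thesis using ev[OF z1(2)] by (auto elim: eventually_elim2)
qed


text \<open>The Mellin integral is split at 1, and the two leading terms of \<open>J\<close> are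
  integrated exactly over \<open>{1..}\<close>, giving \<open>p / (1 - z)\<close> and
  \<open>c / (2 - z)\<close>. What remains is holomorphic for 0 < Re z < 5/2, so the formula
  continues the transform to z = 2, where the principal part is visible.\<close>

lemma residue_from_mellin:
  fixes J :: "real \<Rightarrow> real" and B :: "complex \<Rightarrow> complex"
  assumes [measurable]: "J \<in> borel_measurable borel"
    and J0: "\<And>t. 0 < t \<Longrightarrow> \<bar>J t\<bar> \<le> J0"
    and J1: "\<And>t. 1 \<le> t \<Longrightarrow> \<bar>J t - p / t - c / t\<^sup>2\<bar> \<le> K * t powr (-5/2)"
    and B: "B meromorphic_on UNIV"
    and eq: "\<And>z. 0 < z \<Longrightarrow> z < 1 \<Longrightarrow>
      Gamma (complex_of_real z) * B (-2 * of_real z) = of_real (\<integral>t. indicator {0<..} t * t powr (z - 1) * J t \<partial>lborel)"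
  shows "residue B (-4) = 2 * of_real c"
proof -
  \<comment> \<open>Each half converges on a half-plane of its own: \<open>g1\<close> for Re z > 0
    because \<open>J\<close> is bounded, \<open>g2\<close> for Re z < 5/2 by the error bound. The
    strip \<open>U\<close> is the intersection.\<close>
  define g1 where "g1 = (\<lambda>t. indicator {0<..<1} t * J t)"
  define g2 where "g2 = (\<lambda>t. indicator {1..} t * (J t - p / t - c / t\<^sup>2))"
  have [measurable]: "g1 \<in> borel_measurable borel" "g2 \<in> borel_measurable borel"
    unfolding g1_def g2_def by measurable
  have i1: "integrable lborel (\<lambda>t. t powr (\<sigma> - 1) * g1 t)" if "\<sigma> > 0" for \<sigma>
  proof (rule Bochner_Integration.integrable_bound)
    show "integrable lborel (\<lambda>t. J0 * (indicator {0<..<1} t * t powr (\<sigma> - 1)))"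
      using integrable_powr_0_1[of "\<sigma> - 1"] that by (intro integrable_mult_right) auto
    show "AE t in lborel. norm (t powr (\<sigma> - 1) * g1 t) \<le> norm (J0 * (indicator {0<..<1} t * t powr (\<sigma> - 1)))"
    proof (rule AE_I2)
      fix t :: real
      show "norm (t powr (\<sigma> - 1) * g1 t) \<le> norm (J0 * (indicator {0<..<1} t * t powr (\<sigma> - 1)))"
        using J0[of t] by (auto simp: g1_def abs_mult indicator_def mult_ac intro!: mult_left_mono)
    qed
  qed measurable
  have i2: "integrable lborel (\<lambda>t. t powr (\<sigma> - 1) * g2 t)" if "\<sigma> < 5/2" for \<sigma>
  proof (rule Bochner_Integration.integrable_bound)
    show "integrable lborel (\<lambda>t. K * (indicator {1..} t * t powr (\<sigma> - 1 - 5/2)))"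
      using integrable_powr_1_inf(1)[of "\<sigma> - 1 - 5/2"] that by (intro integrable_mult_right) auto
    show "AE t in lborel. norm (t powr (\<sigma> - 1) * g2 t) \<le> norm (K * (indicator {1..} t * t powr (\<sigma> - 1 - 5/2)))"
    proof (rule AE_I2)
      fix t :: real
      show "norm (t powr (\<sigma> - 1) * g2 t) \<le> norm (K * (indicator {1..} t * t powr (\<sigma> - 1 - 5/2)))"
      proof (cases "t \<ge> 1")
        case True
        have "\<bar>J t - p / t - c / t\<^sup>2\<bar> \<le> \<bar>K\<bar> * t powr (-5/2)"
          using J1[OF True] by (rule order_trans) (auto intro: mult_right_mono)
        then have "t powr (\<sigma> - 1) * \<bar>J t - p / t - c / t\<^sup>2\<bar> \<le> t powr (\<sigma> - 1) * (\<bar>K\<bar> * t powr (-5/2))"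
          by (intro mult_left_mono) auto
        also have "\<dots> = \<bar>K\<bar> * t powr (\<sigma> - 1 - 5/2)"
          by (simp add: powr_add[symmetric] mult_ac)
        finally show ?thesis using True by (simp add: g2_def abs_mult)
      qed (simp add: g2_def)
    qed
  qed measurable
  define U where "U = {z :: complex. 0 < Re z \<and> Re z < 5/2}"
  have openU: "open U" unfolding U_def by (intro open_Collect_conj open_Collect_less continuous_intros)
  have "convex U" unfolding U_def
    using convex_Int[OF convex_halfspace_Re_gt[of 0] convex_halfspace_Re_lt[of "5/2"]] by (simp add: Collect_conj_eq)
  then have connU: "connected U" by (rule convex_connected)
  define F where "F = (\<lambda>z. (\<integral>t. complex_of_real t powr (z - 1) * complex_of_real (g1 t) \<partial>lborel) +
    (\<integral>t. complex_of_real t powr (z - 1) * complex_of_real (g2 t) \<partial>lborel) + of_real p / (1 - z))"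
  have h1: "(\<lambda>z. \<integral>t. complex_of_real t powr (z - 1) * complex_of_real (g1 t) \<partial>lborel) holomorphic_on U"
    unfolding U_def by (intro mellin_holomorphic) (auto simp: g1_def intro: i1[unfolded g1_def])
  have h2: "(\<lambda>z. \<integral>t. complex_of_real t powr (z - 1) * complex_of_real (g2 t) \<partial>lborel) holomorphic_on U"
    unfolding U_def by (intro mellin_holomorphic) (auto simp: g2_def intro: i2[unfolded g2_def])
  have Fhol: "F holomorphic_on (U - {1})"
    unfolding F_def by (intro holomorphic_intros holomorphic_on_subset[OF h1] holomorphic_on_subset[OF h2]) auto
  \<comment> \<open>The summand with the pole at 2 is kept apart, since \<open>F\<close> is
    holomorphic there.\<close>
  define E where "E = (\<lambda>z. F z + of_real c / (2 - z))"
  have Emero: "E meromorphic_on U"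
    unfolding E_def F_def
    by (intro meromorphic_intros analytic_on_imp_meromorphic_on) (use h1 h2 openU in \<open>simp_all add: analytic_on_open\<close>)
  define D where "D = (\<lambda>z. Gamma z * B (-2 * z) - E z)"
  have Gan: "Gamma analytic_on U"
    by (rule analytic_on_subset[OF analytic_Gamma[of "- \<int>\<^sub>\<le>\<^sub>0"]]) (auto simp: U_def elim!: nonpos_Ints_cases)
  have "(\<lambda>z. B (-2 * z)) meromorphic_on U"
    by (rule meromorphic_on_compose[OF B]) (auto intro!: analytic_intros)
  then have Dmero: "D meromorphic_on U"
    unfolding D_def by (intro meromorphic_intros Emero analytic_on_imp_meromorphic_on[OF Gan])
  have D0: "D (of_real z) = 0" if z: "0 < z" "z < 1" for z :: real
  proof -
    have c1: "(\<integral>t. complex_of_real t powr (of_real z - 1) * complex_of_real (g t) \<partial>lborel) = of_real (\<integral>t. t powr (z - 1) * g t \<partial>lborel)"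
      if "\<And>t. t \<le> 0 \<Longrightarrow> g t = 0" for g
    proof -
      have "complex_of_real t powr (of_real z - 1) * complex_of_real (g t) = of_real (t powr (z - 1) * g t)" for t
        using powr_of_real[of t "z - 1"] that[of t] by (cases "t \<ge> 0") auto
      then show ?thesis by (simp only: integral_complex_of_real)
    qed
    define k1 where "k1 = (\<lambda>t. p * (indicator {1..} t * t powr (z - 2)))"
    define k2 where "k2 = (\<lambda>t. c * (indicator {1..} t * t powr (z - 3)))"
    have ik: "integrable lborel k1" "integrable lborel k2" "integral\<^sup>L lborel k1 = p / (1 - z)" "integral\<^sup>L lborel k2 = c / (2 - z)"
      unfolding k1_def k2_def using z integrable_powr_1_inf[of "z - 2"] integrable_powr_1_inf[of "z - 3"]
      by (auto simp: algebra_simps)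
    have "indicator {0<..} t * t powr (z - 1) * J t = t powr (z - 1) * g1 t + t powr (z - 1) * g2 t + k1 t + k2 t" for t
    proof (cases "t \<ge> 1")
      case True
      have "t powr (z - 2) = t powr (z - 1) / t" "t powr (z - 3) = t powr (z - 1) / t\<^sup>2"
        using True powr_diff[of t "z - 1" 1] powr_diff[of t "z - 1" 2] by auto
      then show ?thesis using True by (simp add: g1_def g2_def k1_def k2_def algebra_simps)
    qed (auto simp: g1_def g2_def k1_def k2_def indicator_def)
    then have "(\<integral>t. indicator {0<..} t * t powr (z - 1) * J t \<partial>lborel) =
      (\<integral>t. t powr (z - 1) * g1 t \<partial>lborel) + (\<integral>t. t powr (z - 1) * g2 t \<partial>lborel) + p / (1 - z) + c / (2 - z)"
      using z by (simp add: i1 i2 ik Bochner_Integration.integral_add Bochner_Integration.integrable_add)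
    then show ?thesis
      unfolding D_def E_def F_def eq[OF z]
      by (subst c1, simp add: g1_def, subst c1, simp add: g2_def) simp
  qed
  have fr: "\<exists>\<^sub>F z in at (1/2). D z = 0"
  proof -
    \<comment> \<open>Real points accumulating at 1/2 inside the interval where the identity is
      known; the shift by 3 keeps the sequence below 1.\<close>
    define x where "x = (\<lambda>n. complex_of_real (1/2 + 1 / real (n + 3)))"
    have x: "filterlim x (at (1/2)) sequentially"
      unfolding filterlim_at
    proof
      show "\<forall>\<^sub>F n in sequentially. x n \<in> UNIV \<and> x n \<noteq> 1/2"
      proof (intro always_eventually allI conjI UNIV_I)
        fix n
        have "x n = 1/2 + of_real (1 / real (n + 3))" unfolding x_def of_real_add by simp
        moreover have "complex_of_real (1 / real (n + 3)) \<noteq> 0" unfolding of_real_eq_0_iff by simp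
        ultimately show "x n \<noteq> 1/2" by simp
      qed
      have "(\<lambda>n. 1/2 + 1 / real (n + 3)) \<longlonglongrightarrow> 1/2" by real_asymp
      then have "x \<longlonglongrightarrow> of_real (1/2)" unfolding x_def by (rule tendsto_of_real)
      then show "x \<longlonglongrightarrow> 1/2" by simp
    qed
    have Dx: "D (x n) = 0" for n
      unfolding x_def by (intro D0) (auto simp: field_simps add_pos_nonneg)
    show ?thesis
    proof (rule ccontr)
      assume "\<not> ?thesis"
      then have "\<forall>\<^sub>F z in at (1/2). D z \<noteq> 0" by (simp add: frequently_def)
      then have "\<forall>\<^sub>F n in sequentially. D (x n) \<noteq> 0" using x filterlim_iff[of x] by blast
      then show False using Dx by simp
    qed
  qed
  have "\<forall>\<^sub>F z in at 2. D z = 0"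
    by (rule meromorphic_eq_0_eventually[OF Dmero openU connU _ _ fr]) (auto simp: U_def)
  moreover have "filterlim (\<lambda>s. - s / 2) (at (2::complex)) (at (-4))"
    unfolding filterlim_at
  proof
    have "- s / 2 \<noteq> 2" if "s \<noteq> - 4" for s :: complex
    proof
      assume "- s / 2 = 2"
      then have "s = -2 * 2"
        by (metis (no_types, opaque_lifting) minus_mult_minus minus_minus nonzero_mult_div_cancel_left times_divide_eq_right zero_neq_numeral)
      with that show False by simp
    qed
    then show "\<forall>\<^sub>F s in at (- 4). - s / 2 \<in> UNIV \<and> - s / 2 \<noteq> (2 :: complex)"
      by (auto simp: eventually_at_filter)
    show "((\<lambda>s. - s / 2) \<longlongrightarrow> (2::complex)) (at (- 4))"
      by (auto intro!: tendsto_eq_intros)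
  qed
  ultimately have ev1: "\<forall>\<^sub>F s in at (-4). D (- s / 2) = 0"
    by (auto simp: filterlim_iff)
  \<comment> \<open>Division by Gamma is written with the entire function \<open>rGamma\<close>, so
    that \<open>G\<close> is holomorphic near -4 and \<open>B s\<close> becomes
    \<open>G s / (s + 4)\<close>. The factor 2 stems from
    \<open>2 + s / 2 = (s + 4) / 2\<close>.\<close>
  define G where "G = (\<lambda>s. rGamma (- s / 2) * ((s + 4) * F (- s / 2) + 2 * of_real c))"
  define W where "W = {s :: complex. -5 < Re s \<and> Re s < -3}"
  have W: "open W" "-4 \<in> W" unfolding W_def by (auto intro!: open_Collect_conj open_Collect_less continuous_intros)
  have "(\<lambda>s. F (- s / 2)) holomorphic_on W"
  proof -
    have "- s / 2 \<in> U - {1}" if "s \<in> W" for s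
    proof -
      have "1 < Re (- s / 2)" "Re (- s / 2) < 5/2" using that by (auto simp: W_def)
      moreover from this(1) have "- s / 2 \<noteq> 1" by (metis less_irrefl one_complex.sel(1))
      ultimately show ?thesis by (simp add: U_def)
    qed
    then have "(F \<circ> (\<lambda>s. - s / 2)) holomorphic_on W"
      by (intro holomorphic_on_compose_gen[OF _ Fhol] holomorphic_intros) auto
    then show ?thesis by (simp add: o_def)
  qed
  then have Ghol: "G holomorphic_on W" unfolding G_def by (intro holomorphic_intros) auto
  have "\<forall>\<^sub>F s in at (-4). s \<in> W - {-4}" using W by (intro eventually_at_in_open) auto
  with ev1 have "\<forall>\<^sub>F s in at (-4). B s = G s / (s - (-4))"
  proof eventually_elim
    case (elim s)
    have nz: "Gamma (- s / 2) \<noteq> 0"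
    proof
      assume "Gamma (- s / 2) = 0"
      then obtain n where n: "- s / 2 = of_int n" "n \<le> 0"
        by (auto simp: Gamma_eq_zero_iff elim!: nonpos_Ints_cases)
      have "Re (- s / 2) \<le> 0" unfolding n(1) using n(2) by simp
      then show False using elim(2) by (simp add: W_def)
    qed
    have s4: "s + 4 \<noteq> 0" using elim(2) by (simp add: eq_neg_iff_add_eq_0)
    have e1: "Gamma (- s / 2) * B s = F (- s / 2) + of_real c / (2 + s / 2)"
      using elim(1) by (simp add: D_def E_def)
    have "2 + s / 2 = (s + 4) / 2" by (simp add: field_simps)
    then have "Gamma (- s / 2) * B s * (s + 4) = (s + 4) * F (- s / 2) + 2 * of_real c"
      unfolding e1 using s4 by (simp add: field_simps)
    then have "G s = inverse (Gamma (- s / 2)) * (Gamma (- s / 2) * B s * (s + 4))"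
      by (simp only: G_def rGamma_inverse_Gamma)
    also have "\<dots> = B s * (s + 4)" using nz by simp
    finally show ?case using s4 by simp
  qed
  then have "residue B (-4) = residue (\<lambda>s. G s / (s - (-4))) (-4)" by (rule residue_cong) simp
  also have "\<dots> = G (-4)" by (rule residue_simple[OF W Ghol])
  also have "\<dots> = 2 * of_real c"
    using Gamma_fact[of 1, where 'a = complex] by (simp add: G_def rGamma_inverse_Gamma)
  finally show ?thesis .
qed

section \<open>Mellin transform of the Gaussian energy\<close>

lemma nn_integral_powr_exp:
  fixes a z :: real
  assumes "a > 0" "z > 0"
  shows "(\<integral>\<^sup>+t. ennreal (indicator {0<..} t * t powr (z - 1) * exp (- t * a)) \<partial>lborel) = ennreal (Gamma z * a powr (- z))"
proof -
  have "ennreal (Gamma z) = (\<integral>\<^sup>+t. ennreal (indicator {0..} t * t powr (z - 1) / exp t) \<partial>lborel)"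
    using Gamma_conv_nn_integral_real[OF assms(2)] by simp
  also have "\<dots> = ennreal \<bar>a\<bar> * (\<integral>\<^sup>+t. ennreal (indicator {0..} (0 + a * t) * (0 + a * t) powr (z - 1) / exp (0 + a * t)) \<partial>lborel)"
    using assms by (intro nn_integral_real_affine) auto
  also have "\<dots> = (\<integral>\<^sup>+t. ennreal a * ennreal (indicator {0..} (0 + a * t) * (0 + a * t) powr (z - 1) / exp (0 + a * t)) \<partial>lborel)"
    using assms by (subst nn_integral_cmult) auto
  also have "\<dots> = (\<integral>\<^sup>+t. ennreal (a powr z) * ennreal (indicator {0<..} t * t powr (z - 1) * exp (- t * a)) \<partial>lborel)"
  proof (rule nn_integral_cong)
    fix t :: real
    have "a * (indicator {0..} (0 + a * t) * (0 + a * t) powr (z - 1) / exp (0 + a * t)) = a powr z * (indicator {0<..} t * t powr (z - 1) * exp (- t * a))"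
    proof (cases "t > 0")
      case True
      then show ?thesis using assms
        by (simp add: powr_mult powr_diff exp_minus divide_inverse mult_ac)
    next
      case False
      then show ?thesis using assms by (cases "t = 0") (auto simp: indicator_def mult_le_0_iff zero_le_mult_iff)
    qed
    then show "ennreal a * ennreal (indicator {0..} (0 + a * t) * (0 + a * t) powr (z - 1) / exp (0 + a * t)) = ennreal (a powr z) * ennreal (indicator {0<..} t * t powr (z - 1) * exp (- t * a))"
      using assms by (simp flip: ennreal_mult)
  qed
  also have "\<dots> = ennreal (a powr z) * (\<integral>\<^sup>+t. ennreal (indicator {0<..} t * t powr (z - 1) * exp (- t * a)) \<partial>lborel)"
    by (rule nn_integral_cmult) auto
  finally have e: "ennreal (Gamma z) = ennreal (a powr z) * (\<integral>\<^sup>+t. ennreal (indicator {0<..} t * t powr (z - 1) * exp (- t * a)) \<partial>lborel)" .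
  have "ennreal (Gamma z * a powr (- z)) = ennreal (a powr (- z)) * ennreal (Gamma z)"
    using assms by (simp add: ennreal_mult' mult.commute)
  also have "\<dots> = (ennreal (a powr (- z)) * ennreal (a powr z)) * (\<integral>\<^sup>+t. ennreal (indicator {0<..} t * t powr (z - 1) * exp (- t * a)) \<partial>lborel)"
    unfolding e by (simp add: mult_ac)
  also have "ennreal (a powr (- z)) * ennreal (a powr z) = 1"
    using assms by (simp flip: ennreal_mult powr_add)
  finally show ?thesis by simp
qed


text \<open>Tonelli exchanges the Mellin integral with the double integral of the nonnegative
  integrand, and \<open>nn_integral_powr_exp\<close> with \<open>a = (r q)\<^sup>2\<close> evaluates
  the inner integral. Real \<open>z\<close> between 0 and 1 corresponds to
  \<open>s = -2 * z > -2\<close>, where \<open>B\<close> is given by the energy integral.\<close>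

lemma residue_energy_from_gaussian:
  fixes \<mu> :: "'a::euclidean_space measure" and B :: "complex \<Rightarrow> complex"
  defines "J \<equiv> \<lambda>t. \<integral>q. exp (- t * (norm (fst q - snd q))\<^sup>2) \<partial>(\<mu> \<Otimes>\<^sub>M \<mu>)"
  assumes fin: "finite_measure \<mu>" and sets [measurable_cong]: "sets \<mu> = sets borel"
    and J1: "\<And>t. 1 \<le> t \<Longrightarrow> \<bar>J t - p / t - c / t\<^sup>2\<bar> \<le> K * t powr (-5/2)"
    and B: "B meromorphic_on UNIV"
    and eq: "\<And>s. Re s > -2 \<Longrightarrow> B s = (\<integral>q. complex_of_real (norm (fst q - snd q)) powr s \<partial>(\<mu> \<Otimes>\<^sub>M \<mu>))"
  shows "residue B (-4) = 2 * of_real c"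
proof -
  interpret finite_measure \<mu> by fact
  define N where "N = \<mu> \<Otimes>\<^sub>M \<mu>"
  have finN: "finite_measure N" unfolding N_def by (intro finite_measure_pair_measure fin)
  then interpret N: finite_measure N .
  interpret pair_sigma_finite lborel N ..
  define r where "r = (\<lambda>q :: 'a \<times> 'a. norm (fst q - snd q))"
  have r0: "r q \<ge> 0" for q by (simp add: r_def)
  have rm [measurable]: "r \<in> borel_measurable N" unfolding N_def r_def by measurable
  have J_def': "J t = (\<integral>q. exp (- t * (r q)\<^sup>2) \<partial>N)" for t unfolding J_def N_def r_def ..
  have intJ: "integrable N (\<lambda>q. exp (- t * (r q)\<^sup>2))" if "t \<ge> 0" for t
    by (rule N.integrable_const_bound[where B = 1]) (use that in \<open>auto simp: mult_nonneg_nonneg\<close>)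
  have meas: "(\<lambda>(t, q). exp (- t * (r q)\<^sup>2)) \<in> borel_measurable (lborel \<Otimes>\<^sub>M N)"
    by measurable
  have Jmeas [measurable]: "J \<in> borel_measurable borel"
    unfolding J_def' using N.borel_measurable_lebesgue_integral[OF meas] by simp
  have Jnn: "J t \<ge> 0" for t unfolding J_def' by (intro Bochner_Integration.integral_nonneg) auto
  have Jb: "\<bar>J t\<bar> \<le> measure N (space N)" if "0 < t" for t
  proof -
    have "J t \<le> (\<integral>q. 1 \<partial>N)" unfolding J_def' using that
      by (intro integral_mono intJ N.integrable_const) (auto simp: mult_nonneg_nonneg)
    then show ?thesis using Jnn[of t] by simp
  qed
  \<comment> \<open>The diagonal is a null set because its mass is at most \<open>J t\<close> for
    every \<open>t \<ge> 0\<close>, while the expansion makes \<open>J t\<close> tend to 0. This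
    disposes of the points with \<open>r q = 0\<close>, where the Gamma integral diverges but
    \<open>powr\<close> has the value 0.\<close>
  have pos: "AE q in N. r q > 0"
  proof -
    define d where "d = measure N {q \<in> space N. r q = 0}"
    have int_ind: "integrable N (indicator {q \<in> space N. r q = 0} :: _ \<Rightarrow> real)"
      by (simp add: integrable_indicator_iff N.emeasure_finite less_top[symmetric])
    have dJ: "d \<le> J t" if "t \<ge> 0" for t
    proof -
      have "d = (\<integral>q. indicator {q \<in> space N. r q = 0} q \<partial>N)" by (simp add: d_def)
      also have "\<dots> \<le> J t" unfolding J_def'
        by (intro integral_mono intJ that int_ind) (auto simp: indicator_def)
      finally show ?thesis .
    qed
    have "\<forall>\<^sub>F t in at_top. d \<le> p / t + c / t\<^sup>2 + K * t powr (-5/2)"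
    proof (rule eventually_mono[OF eventually_ge_at_top[of 1]])
      fix t :: real assume t: "1 \<le> t"
      then show "d \<le> p / t + c / t\<^sup>2 + K * t powr (-5/2)"
        using J1[OF t] dJ[of t] by linarith
    qed
    moreover have "((\<lambda>t. p / t + c / t\<^sup>2 + K * t powr (-5/2)) \<longlongrightarrow> 0) at_top"
      by real_asymp
    ultimately have "d \<le> 0" by (intro tendsto_lowerbound[of _ 0 at_top d]) auto
    then have "emeasure N {q \<in> space N. r q = 0} = 0"
      using measure_nonneg[of N] by (simp add: N.emeasure_eq_measure d_def antisym)
    then have "AE q in N. r q \<noteq> 0" by (subst AE_iff_measurable[OF _ refl]) auto
    then show ?thesis by eventually_elim (use r0 in \<open>auto simp: less_le\<close>)
  qed
  show ?thesis
  proof (rule residue_from_mellin[OF Jmeas Jb J1 B])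
    fix z :: real assume z: "0 < z" "z < 1"
    define L where "L = (\<lambda>t. indicator {0<..} t * t powr (z - 1) * J t)"
    have Lmeas [measurable]: "L \<in> borel_measurable borel" unfolding L_def by measurable
    have Lnn: "L t \<ge> 0" for t unfolding L_def using Jnn by auto
    define X where "X = (\<lambda>q. r q powr (-2 * z))"
    have "ennreal (Gamma z) * (\<integral>\<^sup>+q. ennreal (X q) \<partial>N) = (\<integral>\<^sup>+q. ennreal (Gamma z * X q) \<partial>N)"
      using z by (subst nn_integral_cmult[symmetric]) (auto simp: X_def ennreal_mult' Gamma_real_nonneg)
    also have "\<dots> = (\<integral>\<^sup>+q. (\<integral>\<^sup>+t. ennreal (indicator {0<..} t * t powr (z - 1) * exp (- t * (r q)\<^sup>2)) \<partial>lborel) \<partial>N)"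
    proof (rule nn_integral_cong_AE, use pos in eventually_elim)
      case (elim q)
      have "(r q)\<^sup>2 powr (- z) = X q" using elim
        by (simp add: X_def powr_powr flip: powr_numeral)
      then show ?case using nn_integral_powr_exp[of "(r q)\<^sup>2" z] elim z by simp
    qed
    also have "\<dots> = (\<integral>\<^sup>+t. (\<integral>\<^sup>+q. ennreal (indicator {0<..} t * t powr (z - 1) * exp (- t * (r q)\<^sup>2)) \<partial>N) \<partial>lborel)"
      by (rule Fubini') measurable
    also have "\<dots> = (\<integral>\<^sup>+t. ennreal (L t) \<partial>lborel)"
    proof (rule nn_integral_cong)
      fix t :: real
      show "(\<integral>\<^sup>+q. ennreal (indicator {0<..} t * t powr (z - 1) * exp (- t * (r q)\<^sup>2)) \<partial>N) = ennreal (L t)"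
      proof (cases "t > 0")
        case True
        then show ?thesis unfolding L_def J_def'
          by (subst nn_integral_eq_integral) (use intJ[of t] True in auto)
      qed (simp add: L_def)
    qed
    finally have key: "ennreal (Gamma z) * (\<integral>\<^sup>+q. ennreal (X q) \<partial>N) = (\<integral>\<^sup>+t. ennreal (L t) \<partial>lborel)" .
    \<comment> \<open>Passing to real values by \<open>enn2real\<close> treats both sides alike, as
      a divergent integral becomes 0 on either side; convergence is therefore not settled
      separately.\<close>
    have "integral\<^sup>L lborel L = enn2real (\<integral>\<^sup>+t. ennreal (L t) \<partial>lborel)"
      by (rule integral_eq_nn_integral) (use Lnn in auto)
    also have "\<dots> = Gamma z * enn2real (\<integral>\<^sup>+q. ennreal (X q) \<partial>N)"
      unfolding key[symmetric] using z by (simp add: enn2real_mult Gamma_real_nonneg)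
    also have "enn2real (\<integral>\<^sup>+q. ennreal (X q) \<partial>N) = integral\<^sup>L N X"
      by (rule integral_eq_nn_integral[symmetric]) (auto simp: X_def)
    finally have e: "integral\<^sup>L lborel L = Gamma z * integral\<^sup>L N X" .
    have "B (-2 * of_real z) = (\<integral>q. complex_of_real (r q) powr (-2 * of_real z) \<partial>N)"
      using eq[of "-2 * of_real z"] z by (simp add: r_def N_def)
    also have "\<dots> = (\<integral>q. of_real (X q) \<partial>N)"
      using powr_of_real[OF r0, of _ "-2 * z"] by (simp add: X_def)
    finally have "B (-2 * of_real z) = of_real (integral\<^sup>L N X)" by simp
    then show "Gamma (complex_of_real z) * B (-2 * of_real z) = of_real (\<integral>t. indicator {0<..} t * t powr (z - 1) * J t \<partial>lborel)"
      using e by (simp add: L_def Gamma_complex_of_real)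
  qed
qed

section \<open>The residue as an integral over the surface\<close>

text \<open>With the factor \<open>l\<close> eliminated, umbilicity is a family of equations between
  continuous functions, hence a closed condition. The elimination uses the first basis vector, on
  which the first fundamental form is nonzero.\<close>

lemma umbilic_at_iff:
  assumes lp: "local_parametrization M V \<phi>" and x: "x \<in> V"
  shows "umbilic_at \<phi> x \<longleftrightarrow> (\<forall>v w. (dir_deriv v (dir_deriv w \<phi>) x \<bullet> chart_normal \<phi> x) * (dir_deriv (axis 1 1) \<phi> x \<bullet> dir_deriv (axis 1 1) \<phi> x)
     = (dir_deriv (axis 1 1) (dir_deriv (axis 1 1) \<phi>) x \<bullet> chart_normal \<phi> x) * (dir_deriv v \<phi> x \<bullet> dir_deriv w \<phi> x))"
    (is "_ \<longleftrightarrow> (\<forall>v w. ?II v w * ?g = ?l * ?I v w)")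
proof
  assume "umbilic_at \<phi> x"
  then obtain l where "\<And>v w. ?II v w = l * ?I v w" unfolding umbilic_at_def chart_normal_def by blast
  then show "\<forall>v w. ?II v w * ?g = ?l * ?I v w" by simp
next
  assume e: "\<forall>v w. ?II v w * ?g = ?l * ?I v w"
  have "?g \<noteq> 0" using dir_deriv_nonzero[OF lp x, of "axis 1 1"] by (simp add: axis_eq_0_iff)
  then have "?II v w = ?l / ?g * ?I v w" for v w using e[rule_format, of v w] by (simp add: field_simps)
  then show "umbilic_at \<phi> x" unfolding umbilic_at_def chart_normal_def[symmetric] by blast
qed

lemma umbilic_if_dense:
  assumes lp: "local_parametrization M V \<phi>" and dense: "\<And>U. open U \<Longrightarrow> U \<subseteq> V \<Longrightarrow> U \<noteq> {} \<Longrightarrow> \<exists>y\<in>U. umbilic_at \<phi> y" and x: "x \<in> V"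
  shows "umbilic_at \<phi> x"
  unfolding umbilic_at_iff[OF lp x]
proof (intro allI)
  fix v w
  note sm = chart_smooth[OF lp]
  note c1 = smooth_on_continuous[OF smooth_on_dir_deriv[OF sm]]
  note c2 = smooth_on_continuous[OF smooth_on_dir_deriv[OF smooth_on_dir_deriv[OF sm]]]
  have cN: "continuous_on V (chart_normal \<phi>)"
    unfolding chart_normal_def[abs_def] by (rule continuous_on_cross[OF c1 c1])
  define h where "h = (\<lambda>x. (dir_deriv v (dir_deriv w \<phi>) x \<bullet> chart_normal \<phi> x) * (dir_deriv (axis 1 1) \<phi> x \<bullet> dir_deriv (axis 1 1) \<phi> x)
     - (dir_deriv (axis 1 1) (dir_deriv (axis 1 1) \<phi>) x \<bullet> chart_normal \<phi> x) * (dir_deriv v \<phi> x \<bullet> dir_deriv w \<phi> x))"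
  have ch: "continuous_on V h" unfolding h_def
    by (rule continuous_on_diff[OF continuous_on_mult[OF continuous_on_inner[OF c2 cN] continuous_on_inner[OF c1 c1]] continuous_on_mult[OF continuous_on_inner[OF c2 cN] continuous_on_inner[OF c1 c1]]])
  have "open (V \<inter> h -` (- {0}))"
    by (rule continuous_open_preimage[OF ch chart_open[OF lp]]) (simp add: open_Compl)
  moreover have "h y = 0" if "y \<in> V" "umbilic_at \<phi> y" for y
    using that(2) unfolding umbilic_at_iff[OF lp that(1)] h_def by simp
  ultimately have "V \<inter> h -` (- {0}) = {}" using dense[of "V \<inter> h -` (- {0})"] by blast
  then have "h x = 0" using x by blast
  then show "(dir_deriv v (dir_deriv w \<phi>) x \<bullet> chart_normal \<phi> x) * (dir_deriv (axis 1 1) \<phi> x \<bullet> dir_deriv (axis 1 1) \<phi> x)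
     = (dir_deriv (axis 1 1) (dir_deriv (axis 1 1) \<phi>) x \<bullet> chart_normal \<phi> x) * (dir_deriv v \<phi> x \<bullet> dir_deriv w \<phi> x)"
    by (simp add: h_def)
qed

text \<open>The area density is positive and nonempty open sets are not negligible. This upgrades a
  property of almost every point of the surface to one of a dense set of parameters.\<close>

lemma area_measure_chart_image_nonnull:
  assumes M: "smooth_surface M" "compact M" "M \<noteq> {}" and lp: "local_parametrization M U \<phi>" and ne: "U \<noteq> {}"
  shows "\<phi> ` U \<notin> null_sets (area_measure M)"
proof
  note s [simp, measurable_cong] = sets_area_measure[OF M]
  have im [measurable]: "\<phi> ` U \<in> sets borel"
    by (rule nn_integral_area_chart(2)[OF M lp borel_measurable_const])
  assume "\<phi> ` U \<in> null_sets (area_measure M)"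
  then have "(\<integral>\<^sup>+v. 1 * indicator (\<phi> ` U) v \<partial>area_measure M) = 0"
    by (simp add: null_setsD1)
  then have 0: "(\<integral>\<^sup>+y. ennreal (indicator U y * area_density \<phi> y) \<partial>lborel) = 0"
    using nn_integral_area_chart(1)[OF M lp borel_measurable_const, of 1] by simp
  have "(\<lambda>y. indicator U y *\<^sub>R area_density \<phi> y) \<in> borel_measurable borel"
    using chart_open[OF lp] continuous_on_area_density[OF chart_smooth[OF lp]]
    by (intro borel_measurable_continuous_on_indicator) auto
  then have ae: "AE y in lborel. ennreal (indicator U y * area_density \<phi> y) = 0"
    using 0 by (subst (asm) nn_integral_0_iff_AE) simp_all
  have nz: "ennreal (indicator U y * area_density \<phi> y) \<noteq> 0" if "y \<in> U" for y
    using area_density_pos[OF chart_smooth[OF lp] that inj_dir_deriv[OF lp that]] that by simp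
  have "AE y in lborel. y \<notin> U" using ae by (rule eventually_mono) (use nz in blast)
  then have "U \<in> null_sets lborel" using chart_open[OF lp] by (subst (asm) AE_iff_null_sets[symmetric]) simp_all
  then have "negligible U" by (simp add: negligible_iff_null_sets null_sets_completionI)
  then show False using open_not_negligible[OF chart_open[OF lp] ne] by simp
qed

lemma powr_mult_square:
  fixes t :: real
  assumes "t \<ge> 1"
  shows "t powr (-5/2) * t\<^sup>2 = t powr (-1/2)"
proof -
  from assms have "t\<^sup>2 = t powr 2" by simp
  then show ?thesis by (simp only: powr_add[symmetric]) simp
qed

text \<open>The expansion at a point does not mention a chart, so by uniqueness its vanishing second coefficient
  detects umbilicity in every chart through that point.\<close>
lemma second_order_coefficient_unique:
  fixes q q' :: real
  assumes "\<And>t. t \<ge> 1 \<Longrightarrow> \<bar>f t - p / t - q / t\<^sup>2\<bar> \<le> A * t powr (-5/2)" "\<And>t. t \<ge> 1 \<Longrightarrow> \<bar>f t - p / t - q' / t\<^sup>2\<bar> \<le> A' * t powr (-5/2)"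
  shows "q = q'"
proof -
  have b: "\<bar>q - q'\<bar> \<le> (A + A') * t powr (-1/2)" if t: "t \<ge> 1" for t
  proof -
    have "\<bar>q / t\<^sup>2 - q' / t\<^sup>2\<bar> \<le> A * t powr (-5/2) + A' * t powr (-5/2)"
      using assms(1)[OF t] assms(2)[OF t] by linarith
    then have "\<bar>q - q'\<bar> / t\<^sup>2 \<le> (A + A') * t powr (-5/2)"
      by (simp add: diff_divide_distrib[symmetric] distrib_right)
    then have "\<bar>q - q'\<bar> \<le> (A + A') * (t powr (-5/2) * t\<^sup>2)" using t by (simp add: field_simps)
    then show ?thesis by (simp only: powr_mult_square[OF t])
  qed
  have "eventually (\<lambda>t. \<bar>q - q'\<bar> \<le> (A + A') * t powr (-1/2)) at_top"
    by (rule eventually_mono[OF eventually_ge_at_top[of 1]]) (rule b)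
  moreover have "((\<lambda>t. (A + A') * t powr (-1/2)) \<longlongrightarrow> (A + A') * 0) at_top"
    by (intro tendsto_mult tendsto_const tendsto_neg_powr filterlim_ident) simp
  ultimately have "\<bar>q - q'\<bar> \<le> (A + A') * 0" by (intro tendsto_lowerbound[of _ _ at_top]) auto
  then show ?thesis by simp
qed

text \<open>Finitely many neighbourhoods, each with its own error constant, cover the surface, and
  the sum of the absolute values of these constants serves for all points. \<open>q\<close> lives on
  the points of \<open>M\<close> and not on parameters, as the integral over \<open>M\<close>
  requires.\<close>

lemma global_expansion:
  assumes M: "smooth_surface M" "compact M" "M \<noteq> {}"
  shows "\<exists>A q. \<forall>u\<in>M. q u \<ge> 0 \<and> (\<forall>V \<phi> x. local_parametrization M V \<phi> \<longrightarrow> x \<in> V \<longrightarrow> \<phi> x = u \<longrightarrow> (q u = 0 \<longleftrightarrow> umbilic_at \<phi> x)) \<and>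
     (\<forall>t\<ge>1. \<bar>(\<integral>v. exp (- t * (norm (v - u))\<^sup>2) \<partial>area_measure M) - pi / t - q u / t\<^sup>2\<bar> \<le> A * t powr (-5/2))"
proof -
  define I where "I = (\<lambda>u t. (\<integral>v. exp (- t * (norm (v - u))\<^sup>2) \<partial>area_measure M))"
  have "\<exists>T A. open T \<and> p \<in> T \<and> (\<forall>u\<in>M \<inter> T. \<exists>q\<ge>0. \<forall>t\<ge>1. \<bar>I u t - pi / t - q / t\<^sup>2\<bar> \<le> A * t powr (-5/2))" if p: "p \<in> M" for p
  proof -
    obtain V \<phi> where lp: "local_parametrization M V \<phi>" "p \<in> \<phi> ` V" using M(1) p
      unfolding smooth_surface_def by blast
    then obtain x where x: "x \<in> V" "p = \<phi> x" by blast
    obtain r A where r: "r > 0" "ball x r \<subseteq> V" and ex: "\<forall>y\<in>ball x r. \<exists>q\<ge>0. (q = 0 \<longleftrightarrow> umbilic_at \<phi> y) \<and>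
       (\<forall>t\<ge>1. \<bar>I (\<phi> y) t - pi / t - q / t\<^sup>2\<bar> \<le> A * t powr (-5/2))"
      using local_expansion[OF M lp(1) x(1)] unfolding I_def by blast
    obtain T where T: "open T" "\<phi> ` ball x r = M \<inter> T"
      by (rule image_ball_openin[OF local_parametrization_restrict[OF lp(1) open_ball r(2)]]) (rule that)
    have "p \<in> T" using T(2) r(1) x(2) by (metis IntD2 centre_in_ball imageI)
    moreover have "\<exists>q\<ge>0. \<forall>t\<ge>1. \<bar>I u t - pi / t - q / t\<^sup>2\<bar> \<le> A * t powr (-5/2)" if "u \<in> M \<inter> T" for u
    proof -
      obtain y where "y \<in> ball x r" "u = \<phi> y" using \<open>u \<in> M \<inter> T\<close> T(2) by (metis imageE)
      then show ?thesis using ex by blast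
    qed
    ultimately show ?thesis using T(1) by blast
  qed
  then obtain T A where TA: "\<And>p. p \<in> M \<Longrightarrow> open (T p) \<and> p \<in> T p \<and> (\<forall>u\<in>M \<inter> T p. \<exists>q\<ge>0. \<forall>t\<ge>1. \<bar>I u t - pi / t - q / t\<^sup>2\<bar> \<le> A p * t powr (-5/2))"
    by metis
  obtain D where D: "D \<subseteq> M" "finite D" "M \<subseteq> (\<Union>p\<in>D. T p)"
    by (rule compactE_image[OF M(2), of M T]) (use TA that in auto)
  define A0 where "A0 = (\<Sum>p\<in>D. \<bar>A p\<bar>)"
  have "\<exists>q. q \<ge> 0 \<and> (\<forall>t\<ge>1. \<bar>I u t - pi / t - q / t\<^sup>2\<bar> \<le> A0 * t powr (-5/2))" if u: "u \<in> M" for u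
  proof -
    obtain p where p: "p \<in> D" "u \<in> T p" using D(3) u by blast
    then obtain q where q: "q \<ge> 0" "\<And>t. t \<ge> 1 \<Longrightarrow> \<bar>I u t - pi / t - q / t\<^sup>2\<bar> \<le> A p * t powr (-5/2)"
      using TA[of p] D(1) u by blast
    have "A p \<le> A0" unfolding A0_def using member_le_sum[of p D "\<lambda>p. \<bar>A p\<bar>"] p D(2) by simp
    then have "\<bar>I u t - pi / t - q / t\<^sup>2\<bar> \<le> A0 * t powr (-5/2)" if "t \<ge> 1" for t
      using q(2)[OF that] mult_right_mono[of "A p" A0 "t powr (-5/2)"] by simp
    then show ?thesis using q(1) by blast
  qed
  then obtain q where q: "\<And>u. u \<in> M \<Longrightarrow> q u \<ge> 0 \<and> (\<forall>t\<ge>1. \<bar>I u t - pi / t - q u / t\<^sup>2\<bar> \<le> A0 * t powr (-5/2))"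
    by metis
  have "q (\<phi> x) = 0 \<longleftrightarrow> umbilic_at \<phi> x" if lp: "local_parametrization M V \<phi>" and x: "x \<in> V" for V \<phi> x
  proof -
    obtain q' A' where q': "q' = 0 \<longleftrightarrow> umbilic_at \<phi> x" "\<And>t. t \<ge> 1 \<Longrightarrow> \<bar>I (\<phi> x) t - pi / t - q' / t\<^sup>2\<bar> \<le> A' * t powr (-5/2)"
      using local_expansion[OF M lp x] unfolding I_def by (meson centre_in_ball)
    have "\<phi> x \<in> M" using local_parametrization_image_subset[OF lp] x by blast
    then have "q (\<phi> x) = q'" using q q'(2)
      by (intro second_order_coefficient_unique[of "I (\<phi> x)" pi _ A0 _ A']) blast+
    then show ?thesis using q'(1) by simp
  qed
  then show ?thesis using q unfolding I_def by (intro exI[of _ A0] exI[of _ q]) blast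
qed

text \<open>Because \<open>A\<close> is uniform, the expansion may be integrated over
  \<open>u\<close>; the second coefficient of \<open>J\<close> is then the integral of
  \<open>q\<close>, and a nonnegative function has integral 0 exactly when it vanishes almost
  everywhere.\<close>

lemma residue_energy:
  assumes M: "smooth_surface M" "compact M" "M \<noteq> {}" and B: "meromorphic_continuation_of_energy B M"
    and q: "\<And>u. u \<in> M \<Longrightarrow> q u \<ge> 0"
      "\<And>u t. u \<in> M \<Longrightarrow> t \<ge> 1 \<Longrightarrow> \<bar>(\<integral>v. exp (- t * (norm (v - u))\<^sup>2) \<partial>area_measure M) - pi / t - q u / t\<^sup>2\<bar> \<le> A * t powr (-5/2)"
  shows "residue B (-4) = 0 \<longleftrightarrow> (AE u in area_measure M. u \<in> M \<longrightarrow> q u = 0)"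
proof -
  define \<mu> where "\<mu> = area_measure M"
  have sets\<mu> [measurable_cong, simp]: "sets \<mu> = sets borel" unfolding \<mu>_def
    by (rule sets_area_measure[OF M])
  have fin: "finite_measure \<mu>" unfolding \<mu>_def by (rule finite_measure_area[OF M])
  interpret finite_measure \<mu> by (rule fin)
  interpret P: pair_sigma_finite \<mu> \<mu> ..
  define I where "I = (\<lambda>u t. (\<integral>v. exp (- t * (norm (v - u))\<^sup>2) \<partial>\<mu>))"
  define m where "m = measure \<mu> (space \<mu>)"
  define Q where "Q = (\<lambda>u. indicator M u * q u)"
  have [measurable]: "M \<in> sets borel" using M(2) by (simp add: compact_imp_closed borel_closed)
  have AEM: "AE u in \<mu>. u \<in> M"
    using emeasure_area_outside[OF M] by (intro AE_I[of _ _ "- M"]) (auto simp: \<mu>_def[symmetric])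
  have Im [measurable]: "(\<lambda>u. I u t) \<in> borel_measurable borel" for t
    unfolding I_def by measurable
  have I0: "0 \<le> I u t" for u t unfolding I_def by simp
  have I1: "I u t \<le> m" if "t \<ge> 0" for u t
  proof -
    have "I u t \<le> (\<integral>v. 1 \<partial>\<mu>)" unfolding I_def
      by (rule integral_mono) (use that in \<open>auto intro!: integrable_const_bound[of _ 1] simp: mult_nonneg_nonneg\<close>)
    then show ?thesis by (simp add: m_def)
  qed
  \<comment> \<open>\<open>q\<close> arises from choices and is not evidently measurable; it is
    obtained as a pointwise limit of measurable functions.\<close>
  have lim: "(\<lambda>n. indicator M u * ((real (Suc n))\<^sup>2 * (I u (real (Suc n)) - pi / real (Suc n)))) \<longlonglongrightarrow> Q u" for u
  proof (cases "u \<in> M")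
    case True
    have "\<bar>(real (Suc n))\<^sup>2 * (I u (real (Suc n)) - pi / real (Suc n)) - q u\<bar> \<le> A * real (Suc n) powr (-1/2)" for n
    proof -
      define t where "t = real (Suc n)"
      have t: "t \<ge> 1" by (simp add: t_def)
      have "\<bar>t\<^sup>2 * (I u t - pi / t) - q u\<bar> = t\<^sup>2 * \<bar>I u t - pi / t - q u / t\<^sup>2\<bar>"
      proof -
        have "t\<^sup>2 * (I u t - pi / t) - q u = t\<^sup>2 * (I u t - pi / t - q u / t\<^sup>2)" using t
          by (simp add: right_diff_distrib)
        then show ?thesis by (simp add: abs_mult)
      qed
      also have "\<dots> \<le> t\<^sup>2 * (A * t powr (-5/2))" using q(2)[OF True t]
        by (intro mult_left_mono) (simp_all add: I_def \<mu>_def)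
      also have "\<dots> = A * (t powr (-5/2) * t\<^sup>2)" by simp
      finally show ?thesis by (simp only: powr_mult_square[OF t]) (simp add: t_def)
    qed
    then have ev: "\<forall>\<^sub>F n in sequentially. norm ((real (Suc n))\<^sup>2 * (I u (real (Suc n)) - pi / real (Suc n)) - q u) \<le> A * real (Suc n) powr (-1/2)"
      by (intro always_eventually allI) (simp only: real_norm_def)
    have "(\<lambda>n. A * real (Suc n) powr (-1/2)) \<longlonglongrightarrow> A * 0"
      by (intro tendsto_mult tendsto_const tendsto_neg_powr filterlim_compose[OF filterlim_real_sequentially filterlim_Suc]) simp
    then have "(\<lambda>n. A * real (Suc n) powr (-1/2)) \<longlonglongrightarrow> 0" by simp
    with ev have "(\<lambda>n. (real (Suc n))\<^sup>2 * (I u (real (Suc n)) - pi / real (Suc n)) - q u) \<longlonglongrightarrow> 0"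
      by (rule Lim_null_comparison)
    from LIM_zero_cancel[OF this] show ?thesis using True by (simp only: Q_def indicator_simps mult_1)
  qed (simp add: Q_def)
  have Qm [measurable]: "Q \<in> borel_measurable borel"
    by (rule borel_measurable_LIMSEQ_real[OF lim]) measurable
  have Q0: "Q u \<ge> 0" for u using q(1) by (simp add: Q_def indicator_def)
  \<comment> \<open>The expansion at \<open>t = 1\<close> alone bounds \<open>q\<close>, which makes
    it integrable with respect to a finite measure.\<close>
  have Q1: "Q u \<le> \<bar>A\<bar> + m" for u
  proof (cases "u \<in> M")
    case True
    have "\<bar>I u 1 - pi - q u\<bar> \<le> A" using q(2)[OF True, of 1] by (simp add: I_def \<mu>_def)
    moreover have "I u 1 \<le> m" by (rule I1) simp
    moreover have "Q u = q u" using True by (simp add: Q_def)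
    ultimately show ?thesis using pi_gt_zero by linarith
  qed (simp add: Q_def m_def)
  have Qi: "integrable \<mu> Q" by (rule integrable_const_bound[of _ "\<bar>A\<bar> + m"]) (use Q0 Q1 in auto)
  have Ii: "integrable \<mu> (\<lambda>u. I u t)" if "t \<ge> 0" for t
    by (rule integrable_const_bound[of _ m]) (use I0 I1 that in auto)
  define J where "J = (\<lambda>t. \<integral>z. exp (- t * (norm (fst z - snd z))\<^sup>2) \<partial>(\<mu> \<Otimes>\<^sub>M \<mu>))"
  interpret PP: finite_measure "\<mu> \<Otimes>\<^sub>M \<mu>" by (intro finite_measure_pair_measure fin)
  have J: "J t = (\<integral>u. I u t \<partial>\<mu>)" if t: "t \<ge> 0" for t
  proof -
    have "integrable (\<mu> \<Otimes>\<^sub>M \<mu>) (\<lambda>z. exp (- t * (norm (fst z - snd z))\<^sup>2))"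
      by (rule PP.integrable_const_bound[of _ 1]) (use t in auto)
    from P.integral_fst'[OF this] show ?thesis by (simp add: J_def I_def norm_minus_commute)
  qed
  have J1: "\<bar>J t - (pi * m) / t - (\<integral>u. Q u \<partial>\<mu>) / t\<^sup>2\<bar> \<le> (A * m) * t powr (-5/2)" if t: "t \<ge> 1" for t
  proof -
    have i: "integrable \<mu> (\<lambda>u. I u t - pi / t - Q u / t\<^sup>2)"
      by (intro Bochner_Integration.integrable_diff Ii integrable_const integrable_divide Qi) (use t in simp)
    have "(\<integral>u. I u t - pi / t - Q u / t\<^sup>2 \<partial>\<mu>) = (\<integral>u. I u t - pi / t \<partial>\<mu>) - (\<integral>u. Q u / t\<^sup>2 \<partial>\<mu>)"
      by (intro Bochner_Integration.integral_diff Bochner_Integration.integrable_diff Ii integrable_const integrable_divide Qi) (use t in simp)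
    moreover have "(\<integral>u. I u t - pi / t \<partial>\<mu>) = (\<integral>u. I u t \<partial>\<mu>) - (\<integral>u. pi / t \<partial>\<mu>)"
      by (intro Bochner_Integration.integral_diff Ii integrable_const) (use t in simp)
    ultimately have "J t - (pi * m) / t - (\<integral>u. Q u \<partial>\<mu>) / t\<^sup>2 = (\<integral>u. I u t - pi / t - Q u / t\<^sup>2 \<partial>\<mu>)"
      using t by (simp add: J m_def)
    moreover have "\<bar>\<integral>u. I u t - pi / t - Q u / t\<^sup>2 \<partial>\<mu>\<bar> \<le> (\<integral>u. \<bar>I u t - pi / t - Q u / t\<^sup>2\<bar> \<partial>\<mu>)"
      by (rule integral_abs_bound)
    moreover have "(\<integral>u. \<bar>I u t - pi / t - Q u / t\<^sup>2\<bar> \<partial>\<mu>) \<le> (\<integral>u. A * t powr (-5/2) \<partial>\<mu>)"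
    proof (rule integral_mono_AE)
      show "integrable \<mu> (\<lambda>u. \<bar>I u t - pi / t - Q u / t\<^sup>2\<bar>)" using i
        by (rule integrable_abs)
      show "AE u in \<mu>. \<bar>I u t - pi / t - Q u / t\<^sup>2\<bar> \<le> A * t powr (-5/2)"
        using AEM by eventually_elim (use q(2) t in \<open>simp add: Q_def I_def \<mu>_def\<close>)
    qed simp
    moreover have "(\<integral>u. A * t powr (-5/2) \<partial>\<mu>) = (A * m) * t powr (-5/2)" by (simp add: m_def)
    ultimately show ?thesis by linarith
  qed
  have B': "B meromorphic_on UNIV" "\<And>s. Re s > -2 \<Longrightarrow> B s = (\<integral>z. complex_of_real (norm (fst z - snd z)) powr s \<partial>(\<mu> \<Otimes>\<^sub>M \<mu>))"
    using B unfolding meromorphic_continuation_of_energy_def riesz_energy_def \<mu>_def by blast+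
  have "residue B (-4) = 2 * of_real (\<integral>u. Q u \<partial>\<mu>)"
    by (rule residue_energy_from_gaussian[OF fin sets\<mu> J1[unfolded J_def] B'])
  then have "residue B (-4) = 0 \<longleftrightarrow> (\<integral>u. Q u \<partial>\<mu>) = 0" by simp
  also have "\<dots> \<longleftrightarrow> (AE u in \<mu>. Q u = 0)" using Qi Q0
    by (intro integral_nonneg_eq_0_iff_AE) simp_all
  also have "\<dots> \<longleftrightarrow> (AE u in \<mu>. u \<in> M \<longrightarrow> q u = 0)"
    by (intro AE_cong) (auto simp: Q_def indicator_def)
  finally show ?thesis unfolding \<mu>_def .
qed

theorem mainTheorem3:
  fixes M :: "(real^3) set" and B :: "complex \<Rightarrow> complex"
  assumes "smooth_surface M" and "compact M" and "connected M" and "M \<noteq> {}"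
    and "meromorphic_continuation_of_energy B M"
  shows "residue B (-4) = 0 \<longleftrightarrow> (\<exists>c r. r > 0 \<and> M = sphere c r)"
proof -
  note M = assms(1,2,4)
  obtain A q where all: "\<forall>u\<in>M. q u \<ge> 0 \<and> (\<forall>V \<phi> x. local_parametrization M V \<phi> \<longrightarrow> x \<in> V \<longrightarrow> \<phi> x = u \<longrightarrow> (q u = 0 \<longleftrightarrow> umbilic_at \<phi> x)) \<and>
     (\<forall>t\<ge>1. \<bar>(\<integral>v. exp (- t * (norm (v - u))\<^sup>2) \<partial>area_measure M) - pi / t - q u / t\<^sup>2\<bar> \<le> A * t powr (-5/2))"
    using global_expansion[OF M] by (elim exE) (rule that)
  have q: "\<And>u. u \<in> M \<Longrightarrow> q u \<ge> 0"
    and umb: "\<And>V \<phi> x. local_parametrization M V \<phi> \<Longrightarrow> x \<in> V \<Longrightarrow> \<phi> x \<in> M \<Longrightarrow> q (\<phi> x) = 0 \<longleftrightarrow> umbilic_at \<phi> x"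
    and ex: "\<And>u t. u \<in> M \<Longrightarrow> t \<ge> 1 \<Longrightarrow> \<bar>(\<integral>v. exp (- t * (norm (v - u))\<^sup>2) \<partial>area_measure M) - pi / t - q u / t\<^sup>2\<bar> \<le> A * t powr (-5/2)"
    using all by blast+
  have inM: "\<phi> x \<in> M" if "local_parametrization M V \<phi>" "x \<in> V" for V \<phi> x
    using local_parametrization_image_subset[OF that(1)] that(2) by blast
  have res: "residue B (-4) = 0 \<longleftrightarrow> (AE u in area_measure M. u \<in> M \<longrightarrow> q u = 0)"
    by (rule residue_energy[OF M assms(5) q ex])
  show ?thesis
  proof
    assume "residue B (-4) = 0"
    then have "AE u in area_measure M. u \<in> M \<longrightarrow> q u = 0" using res by simp
    then obtain N where N: "{u \<in> space (area_measure M). \<not> (u \<in> M \<longrightarrow> q u = 0)} \<subseteq> N" "N \<in> null_sets (area_measure M)"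
      by (auto elim!: AE_E3)
    have sp: "space (area_measure M) = UNIV" using sets_eq_imp_space_eq[OF sets_area_measure[OF M]] by simp
    \<comment> \<open>The exceptional null set cannot contain the image of a nonempty open set of
      parameters, so the umbilic parameters are dense.\<close>
    have "umbilic_at \<phi> x" if lp: "local_parametrization M V \<phi>" and x: "x \<in> V" for V \<phi> x
    proof (rule umbilic_if_dense[OF lp _ x])
      fix U assume U: "open U" "U \<subseteq> V" "U \<noteq> {}"
      have lpU: "local_parametrization M U \<phi>" by (rule local_parametrization_restrict[OF lp U(1,2)])
      have "\<phi> ` U \<in> sets (area_measure M)"
        using nn_integral_area_chart(2)[OF M lpU borel_measurable_const] by (simp add: sets_area_measure[OF M])
      then have "\<not> \<phi> ` U \<subseteq> N"
        using area_measure_chart_image_nonnull[OF M lpU U(3)] null_sets_subset[OF N(2)] by blast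
      then obtain y where y: "y \<in> U" "\<phi> y \<notin> N" by blast
      then have "q (\<phi> y) = 0" using N(1) inM[OF lpU y(1)] sp by blast
      then show "\<exists>y\<in>U. umbilic_at \<phi> y" using umb[OF lpU y(1) inM[OF lpU y(1)]] y(1) by blast
    qed
    then show "\<exists>c r. r > 0 \<and> M = sphere c r" by (rule umbilic_surface_eq_sphere[OF assms(1-4)])
  next
    assume "\<exists>c r. r > 0 \<and> M = sphere c r"
    then obtain c r where cr: "M = sphere c r" by blast
    have "q u = 0" if u: "u \<in> M" for u
    proof -
      obtain V \<phi> where lp: "local_parametrization M V \<phi>" "u \<in> \<phi> ` V" using M(1) u
        unfolding smooth_surface_def by blast
      then obtain x where x: "x \<in> V" "u = \<phi> x" by blast
      have "\<phi> ` V \<subseteq> sphere c r" using local_parametrization_image_subset[OF lp(1)] cr by simp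
      then have "umbilic_at \<phi> x" by (rule sphere_imp_umbilic[OF lp(1) chart_open[OF lp(1)] order_refl _ x(1)])
      then show ?thesis using umb[OF lp(1) x(1)] u x(2) by simp
    qed
    then show "residue B (-4) = 0" using res by simp
  qed
qed

end
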